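(* Let $\mu,\nu$ be probability measures on $\mathbb{R}$ with $\mu\preceq_C\nu$ (convex order). Then there exists a unique left-monotone martingale transport plan in $\Pi_M(\mu,\nu)$.
   Context: Convex order: two finite Borel measures $\mu,\nu$ on $\mathbb{R}$ with finite first moments satisfy $\mu\preceq_C\nu$ if $\int\varphi\,d\mu\le\int\varphi\,d\nu$ for every convex $\varphi:\mathbb{R}\to\mathbb{R}$. $\Pi(\mu,\nu)$ is the set of Borel measures on $\mathbb{R}\times\mathbb{R}$ with first marginal $\mu$ and second marginal $\nu$. $\Pi_M(\mu,\nu)$ (martingale transport plans) is the set of $\pi\in\Pi(\mu,\nu)$ whose disintegration $(\pi_x)_{x\in\mathbb{R}}$ into probability measures with respect to $\mu$ satisfies $\int y\,d\pi_x(y)=x$ for $\mu$-a.e. $x$. A martingale transport plan $\pi$ is left-monotone if there is a Borel set $\Gamma\subseteq\mathbb{R}\times\mathbb{R}$ with $\pi(\Gamma)=1$ such that whenever $(x,y^-),(x,y^+),(x',y')\in\Gamma$, one cannot have both $x<x'$ and $y^-<y'<y^+$. *)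

theory Defs
  imports "HOL-Probability.Probability"
begin

definition borel_prob :: "real measure \<Rightarrow> bool" where
  "borel_prob \<mu> \<longleftrightarrow> prob_space \<mu> \<and> sets \<mu> = sets borel"

definition finite_first_moment :: "real measure \<Rightarrow> bool" where
  "finite_first_moment \<mu> \<longleftrightarrow>
     finite_measure \<mu> \<and> sets \<mu> = sets borel \<and> integrable \<mu> (\<lambda>x. x)"

text \<open>
  A convex function is bounded below by an affine one, so against a finite measure with finite
  first moment its negative part is integrable and its integral is well defined in
  \<open>(-\<infinity>, \<infinity>]\<close>. The Bochner integral would return the junk value 0 when the positive part has
  infinite integral; hence the extended integral.
\<close>

definition ext_integral :: "real measure \<Rightarrow> (real \<Rightarrow> real) \<Rightarrow> ereal" where
  "ext_integral \<mu> \<phi> =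
     enn2ereal (\<integral>\<^sup>+ x. ennreal (\<phi> x) \<partial>\<mu>) - enn2ereal (\<integral>\<^sup>+ x. ennreal (- \<phi> x) \<partial>\<mu>)"

definition convex_order :: "real measure \<Rightarrow> real measure \<Rightarrow> bool" (infix "\<preceq>\<^sub>C" 50) where
  "\<mu> \<preceq>\<^sub>C \<nu> \<longleftrightarrow>
     finite_first_moment \<mu> \<and> finite_first_moment \<nu> \<and>
     (\<forall>\<phi>::real \<Rightarrow> real. convex_on UNIV \<phi> \<longrightarrow> ext_integral \<mu> \<phi> \<le> ext_integral \<nu> \<phi>)"

definition transport_plans :: "real measure \<Rightarrow> real measure \<Rightarrow> (real \<times> real) measure set" where
  "transport_plans \<mu> \<nu> =
     {\<pi>. sets \<pi> = sets borel \<and> distr \<pi> borel fst = \<mu> \<and> distr \<pi> borel snd = \<nu>}"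

definition is_disintegration ::
  "real measure \<Rightarrow> (real \<times> real) measure \<Rightarrow> (real \<Rightarrow> real measure) \<Rightarrow> bool" where
  "is_disintegration \<mu> \<pi> K \<longleftrightarrow>
     K \<in> borel \<rightarrow>\<^sub>M prob_algebra borel \<and>
     (\<forall>A \<in> sets borel. emeasure \<pi> A = (\<integral>\<^sup>+ x. emeasure (K x) {y. (x, y) \<in> A} \<partial>\<mu>))"

text \<open>
  A disintegration exists and is unique up to \<open>\<mu>\<close>-null sets, so which one is chosen is immaterial.
  Integrability is required explicitly because the Bochner integral of a non-integrable
  function is 0.
\<close>

definition martingale_plans :: "real measure \<Rightarrow> real measure \<Rightarrow> (real \<times> real) measure set" where
  "martingale_plans \<mu> \<nu> =
     {\<pi> \<in> transport_plans \<mu> \<nu>.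
        \<exists>K. is_disintegration \<mu> \<pi> K \<and>
            (AE x in \<mu>. integrable (K x) (\<lambda>y. y) \<and> (\<integral>y. y \<partial>K x) = x)}"

definition left_monotone :: "(real \<times> real) measure \<Rightarrow> bool" where
  "left_monotone \<pi> \<longleftrightarrow>
     (\<exists>\<Gamma> \<in> sets borel. emeasure \<pi> \<Gamma> = 1 \<and>
        (\<forall>x y1 y2 x' y'. (x, y1) \<in> \<Gamma> \<and> (x, y2) \<in> \<Gamma> \<and> (x', y') \<in> \<Gamma> \<longrightarrow>
           \<not> (x < x' \<and> y1 < y' \<and> y' < y2)))"

end

theory Submission
  imports Defs
begin

text \<open>
  Write \<open>P\<^sub>m t = \<integral> max 0 (t - y) dm\<close> for the potential of \<open>m\<close>, and \<open>\<mu>\<^sub>u\<close> for \<open>\<mu>\<close> restricted to \<open>{..u}\<close>.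
  Let \<open>\<theta>\<^sub>u\<close> be the distribution of the mass that a martingale plan transports from \<open>{..u}\<close>; then
  \<open>P\<^bsub>\<theta>u\<^esub> \<ge> P\<^bsub>\<mu>u\<^esub>\<close>, and a strict inequality at \<open>y\<close> means that mass starting in \<open>{..u}\<close> crosses \<open>y\<close>.

  Uniqueness: for a left-monotone plan, \<open>\<nu> - \<theta>\<^sub>u\<close> must therefore vanish on the open set
  \<open>{P\<^bsub>\<theta>u\<^esub> > P\<^bsub>\<mu>u\<^esub>}\<close>, so that the potential of \<open>\<nu> - \<theta>\<^sub>u\<close> is locally affine there. By the maximum principle
  this determines \<open>P\<^bsub>\<theta>u\<^esub>\<close> and hence \<open>\<theta>\<^sub>u\<close> for every \<open>u\<close>.

  Existence: let \<open>C\<^sub>u\<close> be the greatest convex minorant of \<open>P\<^sub>\<nu> - P\<^bsub>\<mu>u\<^esub>\<close>. The functions \<open>P\<^sub>\<nu> - C\<^sub>u\<close> and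
  \<open>C\<^sub>u - C\<^sub>v\<close> for \<open>u \<le> v\<close> are convex, so \<open>P\<^sub>\<nu> - C\<^sub>u\<close> is the potential of a measure \<open>\<theta>\<^sub>u \<le> \<nu>\<close> (the shadow of
  \<open>\<mu>\<^sub>u\<close> in \<open>\<nu>\<close>) that increases with \<open>u\<close>. Densities of \<open>\<theta>\<^sub>u\<close> with respect to \<open>\<nu>\<close> are the distribution
  functions of a kernel, which defines the plan. It is left-monotone because mass starting in \<open>{..u}\<close>
  never crosses a point where \<open>C\<^sub>u\<close> touches \<open>P\<^sub>\<nu> - P\<^bsub>\<mu>u\<^esub>\<close>, while mass starting in \<open>{u<..}\<close> only lands on
  such points.
\<close>

subsection \<open>Local convexity and greatest convex minorants\<close>

text \<open>A maximum principle. If the rightmost maximum point were interior, the local midpoint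
  inequality there would force the maximum value at a point still further to the right.\<close>

lemma local_midpoint_le_endpoints:
  fixes G :: "real \<Rightarrow> real"
  assumes cont: "continuous_on {a..b} G" and ab: "a \<le> b"
    and mid: "\<And>t. a < t \<Longrightarrow> t < b \<Longrightarrow> \<exists>d>0. \<forall>s. 0 < s \<and> s < d \<longrightarrow> 2 * G t \<le> G (t - s) + G (t + s)"
    and t: "a \<le> t" "t \<le> b"
  shows "G t \<le> max (G a) (G b)"
proof (rule ccontr)
  assume neg: "\<not> G t \<le> max (G a) (G b)"
  obtain x0 where x0: "x0 \<in> {a..b}" "\<And>y. y \<in> {a..b} \<Longrightarrow> G y \<le> G x0"
    using continuous_attains_sup[of "{a..b}" G] cont ab by auto
  define S where "S = {x \<in> {a..b}. G x = G x0}"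
  have "closed S"
    unfolding S_def using continuous_closed_preimage_constant[OF cont closed_atLeastAtMost] .
  moreover have "bounded S"
    by (rule bounded_subset[of "{a..b}"]) (auto simp: S_def)
  ultimately have "compact S" by (simp add: compact_eq_bounded_closed)
  moreover have "S \<noteq> {}" using x0 by (auto simp: S_def)
  ultimately obtain m where m: "m \<in> S" "\<And>y. y \<in> S \<Longrightarrow> y \<le> m"
    using compact_attains_sup by metis
  have Gm: "G m = G x0" "m \<in> {a..b}" using m by (auto simp: S_def)
  have "G t \<le> G m" using x0(2)[of t] Gm t by auto
  then have "a < m" "m < b" using neg Gm by (auto simp: order_le_less)
  from mid[OF this] obtain d where d: "d > 0" "\<And>s. 0 < s \<Longrightarrow> s < d \<Longrightarrow> 2 * G m \<le> G (m - s) + G (m + s)"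
    by blast
  \<comment> \<open>Small enough for the local inequality at \<open>m\<close> to apply and for
    \<open>m - s\<close> and \<open>m + s\<close> to stay in \<open>{a..b}\<close>.\<close>
  define s where "s = min (d/2) (min (m - a) (b - m))"
  have s: "0 < s" "s < d" "s \<le> m - a" "s \<le> b - m"
    using d \<open>a < m\<close> \<open>m < b\<close> by (auto simp: s_def min_def)
  have "2 * G m \<le> G (m - s) + G (m + s)" using d s by blast
  moreover have "G (m - s) \<le> G m" "G (m + s) \<le> G m" using x0(2) s Gm by auto
  ultimately have "G (m + s) = G x0" using Gm by linarith
  then have "m + s \<in> S" using s Gm by (auto simp: S_def)
  then show False using m(2)[of "m + s"] s by simp
qed

text \<open>Subtracting the chord over \<open>{a..b}\<close> keeps the local midpoint inequality and
  makes both endpoint values zero, so the maximum principle puts \<open>F\<close> below its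
  chord.\<close>

lemma convex_on_local_midpoint:
  fixes F :: "real \<Rightarrow> real"
  assumes cont: "continuous_on UNIV F"
    and mid: "\<And>t. \<exists>d>0. \<forall>s. 0 < s \<and> s < d \<longrightarrow> 2 * F t \<le> F (t - s) + F (t + s)"
  shows "convex_on UNIV F"
proof (intro convex_on_linorderI)
  fix u a b :: real assume u: "0 < u" "u < 1" and ab: "a < b"
  define l where "l = (F b - F a) / (b - a)"
  define G where "G = (\<lambda>x. F x - F a - l * (x - a))"
  define x where "x = (1 - u) *\<^sub>R a + u *\<^sub>R b"
  have xa: "x - a = u * (b - a)" "b - x = (1 - u) * (b - a)" by (auto simp: x_def algebra_simps)
  have "0 \<le> u * (b - a)" "0 \<le> (1 - u) * (b - a)" using u ab by (simp_all only: mult_nonneg_nonneg diff_ge_0_iff_ge less_imp_le)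
  then have "a \<le> x" "x \<le> b" by (simp_all only: xa[symmetric] diff_ge_0_iff_ge)
  have "G x \<le> max (G a) (G b)"
  proof (rule local_midpoint_le_endpoints[where G = G])
    show "continuous_on {a..b} G" unfolding G_def
      by (intro continuous_intros continuous_on_subset[OF cont]) auto
    fix t
    obtain d where d: "d>0" "\<forall>s. 0 < s \<and> s < d \<longrightarrow> 2 * F t \<le> F (t - s) + F (t + s)" using mid by blast
    show "\<exists>d>0. \<forall>s. 0 < s \<and> s < d \<longrightarrow> 2 * G t \<le> G (t - s) + G (t + s)"
      by (intro exI[of _ d] conjI d(1)) (use d(2) in \<open>auto simp: G_def algebra_simps\<close>)
  qed (use ab \<open>a \<le> x\<close> \<open>x \<le> b\<close> in auto)
  also have "\<dots> = 0" using ab by (simp add: G_def l_def)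
  finally have "F x \<le> F a + l * (x - a)" by (simp add: G_def)
  also have "l * (x - a) = u * (F b - F a)" unfolding xa l_def using ab by simp
  finally show "F ((1 - u) *\<^sub>R a + u *\<^sub>R b) \<le> (1 - u) * F a + u * F b"
    unfolding x_def[symmetric] by (simp add: algebra_simps)
qed simp

text \<open>The positive part of \<open>G\<close> satisfies the midpoint inequality everywhere,
  because where \<open>G\<close> is not positive it vanishes and its neighbours are nonnegative. A
  positive value of \<open>G\<close> would exceed the values at two far points on either side,
  against the maximum principle.\<close>

lemma local_midpoint_nonpos:
  fixes G :: "real \<Rightarrow> real"
  assumes cont: "continuous_on UNIV G"
    and lim: "(G \<longlongrightarrow> 0) at_bot" "(G \<longlongrightarrow> 0) at_top"
    and mid: "\<And>t. G t > 0 \<Longrightarrow> \<exists>d>0. \<forall>s. 0 < s \<and> s < d \<longrightarrow> 2 * G t \<le> G (t - s) + G (t + s)"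
  shows "G t \<le> 0"
proof (rule ccontr)
  assume "\<not> G t \<le> 0"
  then have p: "G t > 0" by simp
  define H where "H = (\<lambda>x. max 0 (G x))"
  have "eventually (\<lambda>x. G x < G t) at_bot" "eventually (\<lambda>x. G x < G t) at_top"
    using order_tendstoD(2)[OF lim(1) p] order_tendstoD(2)[OF lim(2) p] .
  then obtain a0 b0 where ab: "\<And>x. x \<le> a0 \<Longrightarrow> G x < G t" "\<And>x. x \<ge> b0 \<Longrightarrow> G x < G t"
    unfolding eventually_at_bot_linorder eventually_at_top_linorder by metis
  \<comment> \<open>Including \<open>t\<close> in the minimum and the maximum places it in
    \<open>{a..b}\<close>.\<close>
  define a b where "a = min a0 t" and "b = max b0 t"
  have "H t \<le> max (H a) (H b)"
  proof (rule local_midpoint_le_endpoints[where G = H])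
    show "continuous_on {a..b} H" unfolding H_def
      by (intro continuous_intros continuous_on_subset[OF cont]) auto
    fix x
    show "\<exists>d>0. \<forall>s. 0 < s \<and> s < d \<longrightarrow> 2 * H x \<le> H (x - s) + H (x + s)"
    proof (cases "G x > 0")
      case True
      from mid[OF this] obtain d where d: "d>0" "\<forall>s. 0 < s \<and> s < d \<longrightarrow> 2 * G x \<le> G (x - s) + G (x + s)"
        by blast
      show ?thesis
        by (intro exI[of _ d] conjI d(1)) (use d(2) True in \<open>fastforce simp: H_def max_def\<close>)
    next
      case False then show ?thesis by (intro exI[of _ 1]) (auto simp: H_def max_def)
    qed
  qed (auto simp: a_def b_def)
  moreover have "G a < G t" "G b < G t" using ab(1)[of a] ab(2)[of b] by (auto simp: a_def b_def)
  ultimately show False using p by (auto simp: H_def max_def split: if_splits)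
qed

section \<open>Elementary properties of convex functions on the line\<close>

lemma convex_on_midpoint:
  fixes f :: "real \<Rightarrow> real"
  assumes "convex_on UNIV f" shows "2 * f t \<le> f (t - s) + f (t + s)"
proof -
  have "f ((1/2) *\<^sub>R (t - s) + (1/2) *\<^sub>R (t + s)) \<le> (1/2) * f (t - s) + (1/2) * f (t + s)"
    using assms[unfolded convex_on_def, THEN conjunct2, rule_format, of "t - s" "t + s" "1/2" "1/2"] by simp
  moreover have "(1/2) *\<^sub>R (t - s) + (1/2) *\<^sub>R (t + s) = t" by (simp add: field_simps)
  ultimately show ?thesis by simp
qed

lemma convex_on_UNIV_continuous:
  fixes f :: "real \<Rightarrow> real"
  assumes "convex_on UNIV f" shows "continuous_on S f"
  using convex_on_continuous[OF _ assms] continuous_on_subset by blast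

lemma convex_on_max:
  fixes f g :: "real \<Rightarrow> real"
  assumes "convex_on S f" "convex_on S g" shows "convex_on S (\<lambda>x. max (f x) (g x))"
proof -
  have "max (f (u *\<^sub>R x + v *\<^sub>R y)) (g (u *\<^sub>R x + v *\<^sub>R y)) \<le> u * max (f x) (g x) + v * max (f y) (g y)"
    if "x \<in> S" "y \<in> S" "0 \<le> u" "0 \<le> v" "u + v = 1" for x y u v
  proof -
    have "f (u *\<^sub>R x + v *\<^sub>R y) \<le> u * f x + v * f y" "g (u *\<^sub>R x + v *\<^sub>R y) \<le> u * g x + v * g y"
      using assms that unfolding convex_on_def by blast+
    moreover have "u * f x + v * f y \<le> u * max (f x) (g x) + v * max (f y) (g y)"
       "u * g x + v * g y \<le> u * max (f x) (g x) + v * max (f y) (g y)"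
      using that by (auto intro!: add_mono mult_left_mono)
    ultimately show ?thesis by linarith
  qed
  with assms show ?thesis unfolding convex_on_def by blast
qed

lemma convex_on_affine: "convex_on UNIV (\<lambda>x::real. c + l * (x - a))"
  unfolding convex_on_def
proof (intro conjI ballI allI impI)
  fix x y u v :: real assume "u + v = 1"
  then have "v = 1 - u" by simp
  show "c + l * (u *\<^sub>R x + v *\<^sub>R y - a) \<le> u * (c + l * (x - a)) + v * (c + l * (y - a))"
    unfolding \<open>v = 1 - u\<close> by (simp add: algebra_simps)
qed simp

section \<open>Greatest convex minorants\<close>

text \<open>A predicate rather than a function, since such a \<open>C\<close> exists only when some
  convex function lies below \<open>E\<close>.\<close>

definition greatest_convex_minorant :: "(real \<Rightarrow> real) \<Rightarrow> (real \<Rightarrow> real) \<Rightarrow> bool" where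
  "greatest_convex_minorant E C \<longleftrightarrow>
     convex_on UNIV C \<and> (\<forall>t. C t \<le> E t) \<and>
     (\<forall>h. convex_on UNIV h \<and> (\<forall>t. h t \<le> E t) \<longrightarrow> (\<forall>t. h t \<le> C t))"

text \<open>Take the pointwise supremum of all convex minorants. The function \<open>k\<close> makes
  the family nonempty and \<open>E\<close> bounds it, so the supremum is finite, and it is convex as
  a supremum of convex functions.\<close>

lemma greatest_convex_minorant_exists:
  assumes k: "convex_on UNIV k" "\<And>t. k t \<le> E t"
  shows "\<exists>C. greatest_convex_minorant E C"
proof -
  define H where "H = {h. convex_on UNIV h \<and> (\<forall>t. h t \<le> E t)}"
  define C where "C = (\<lambda>t. SUP h\<in>H. h t)"
  have kH: "k \<in> H" using k by (auto simp: H_def)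
  have bdd: "bdd_above ((\<lambda>h. h t) ` H)" for t by (rule bdd_aboveI[of _ "E t"]) (auto simp: H_def)
  have le: "h t \<le> C t" if "h \<in> H" for h t unfolding C_def by (rule cSUP_upper[OF that bdd])
  have "convex_on UNIV C"
    unfolding convex_on_def
  proof (intro conjI ballI allI impI)
    fix x y u v :: real assume uv: "0 \<le> u" "0 \<le> v" "u + v = 1"
    show "C (u *\<^sub>R x + v *\<^sub>R y) \<le> u * C x + v * C y"
    proof (subst C_def)
      show "(SUP h\<in>H. h (u *\<^sub>R x + v *\<^sub>R y)) \<le> u * C x + v * C y"
    proof (rule cSUP_least)
      show "H \<noteq> {}" using kH by auto
      fix h assume h: "h \<in> H"
      then have "h (u *\<^sub>R x + v *\<^sub>R y) \<le> u * h x + v * h y"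
        using uv by (auto simp: H_def convex_on_def)
      also have "\<dots> \<le> u * C x + v * C y" using uv le[OF h] by (auto intro!: add_mono mult_left_mono)
      finally show "h (u *\<^sub>R x + v *\<^sub>R y) \<le> u * C x + v * C y" .
    qed
    qed
  qed simp
  moreover have "C t \<le> E t" for t unfolding C_def
    by (rule cSUP_least) (use kH in \<open>auto simp: H_def\<close>)
  ultimately have "greatest_convex_minorant E C"
    unfolding greatest_convex_minorant_def using le by (auto simp: H_def)
  then show ?thesis by blast
qed

lemma greatest_convex_minorant_locally_affine:
  assumes C: "greatest_convex_minorant E C" and E: "continuous_on UNIV E" and t: "C t < E t"
  shows "\<exists>d>0. \<forall>s. 0 < s \<and> s < d \<longrightarrow> 2 * C t = C (t - s) + C (t + s)"
proof -
  have cv: "convex_on UNIV C" and le: "\<And>t. C t \<le> E t"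
    and gr: "\<And>h t. convex_on UNIV h \<Longrightarrow> (\<And>t. h t \<le> E t) \<Longrightarrow> h t \<le> C t"
    using C unfolding greatest_convex_minorant_def by blast+
  \<comment> \<open>The constant \<open>c\<close> separates \<open>C\<close> from \<open>E\<close>
    near \<open>t\<close>: chords of \<open>C\<close> over a short interval stay below
    \<open>c\<close> and hence below \<open>E\<close>.\<close>
  obtain c where c: "C t < c" "c < E t" using dense t by blast
  have "isCont C t" "isCont E t"
    using convex_on_UNIV_continuous[OF cv, of UNIV] E by (simp_all add: continuous_on_eq_continuous_at)
  then have "eventually (\<lambda>x. C x < c \<and> c < E x) (nhds t)"
    using c by (intro eventually_conj order_tendstoD) (auto simp: continuous_at tendsto_nhds_iff)
  then obtain e where e: "e > 0" "\<And>x. dist x t < e \<Longrightarrow> C x < c \<and> c < E x"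
    unfolding eventually_nhds_metric by blast
  \<comment> \<open>A chord of \<open>C\<close> that stays below \<open>E\<close> cannot exceed \<open>C\<close>: otherwise the maximum of the two
    would be a larger convex minorant.\<close>
  show ?thesis
  proof (intro exI[of _ e] conjI e(1) allI impI)
    fix s assume s: "0 < s \<and> s < e"
    define a b where "a = t - s" and "b = t + s"
    have ab: "a < b" using s by (simp add: a_def b_def)
    define l where "l = (C b - C a) / (b - a)"
    define L where "L = (\<lambda>x. C a + l * (x - a))"
    have La: "L a = C a" and Lb: "L b = C b" using ab by (auto simp: L_def l_def)
    have Lin: "L x < c" if "a \<le> x" "x \<le> b" for x
    proof -
      have "C a < c" "C b < c" using e(2) s by (auto simp: a_def b_def dist_real_def)
      have "L x = ((b - x) * C a + (x - a) * C b) / (b - a)"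
        using ab by (simp add: L_def l_def field_simps)
      also have "(b - x) * C a + (x - a) * C b < (b - x) * c + (x - a) * c"
        using that ab \<open>C a < c\<close> \<open>C b < c\<close>
        by (cases "x = a") (auto intro!: add_le_less_mono mult_left_mono)
      then have "((b - x) * C a + (x - a) * C b) / (b - a) < ((b - x) * c + (x - a) * c) / (b - a)"
        using ab by (simp add: divide_strict_right_mono)
      also have "((b - x) * c + (x - a) * c) / (b - a) = c" using ab by (simp add: field_simps)
      finally show ?thesis .
    qed
    \<comment> \<open>By monotonicity of slopes the line through two points of the graph runs below
      \<open>C\<close> outside these points, so taking the maximum with \<open>L\<close> can change
      \<open>C\<close> only between \<open>a\<close> and \<open>b\<close>.\<close>
    have Lout: "L x \<le> C x" if "x < a \<or> b < x" for x
    proof -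
      from that show ?thesis
      proof
        assume x: "x < a"
        then have "(C b - C x) / (b - x) \<le> (C b - C a) / (b - a)" "(C a - C x) / (a - x) \<le> (C b - C x) / (b - x)"
          using convex_on_slope_le[OF cv, of x b a] ab by (auto simp: divide_simps algebra_simps)
        then have "(C a - C x) / (a - x) \<le> l" by (simp add: l_def)
        then show ?thesis using x by (simp add: L_def field_simps)
      next
        assume x: "b < x"
        have "(C b - C a) / (b - a) \<le> (C x - C a) / (x - a)"
          using convex_on_slope_le[OF cv, of a x b] ab x by (auto simp: divide_simps algebra_simps)
        then have "l \<le> (C x - C a) / (x - a)" by (simp add: l_def)
        then show ?thesis using x ab by (simp add: L_def field_simps)
      qed
    qed
    have "max (C t) (L t) \<le> C t"
    proof (rule gr)
      show "convex_on UNIV (\<lambda>x. max (C x) (L x))"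
        unfolding L_def by (intro convex_on_max cv convex_on_affine)
      show "max (C x) (L x) \<le> E x" for x
      proof (cases "a \<le> x \<and> x \<le> b")
        case True
        then have "L x < c" using Lin by simp
        moreover have "c < E x" using e(2)[of x] True s by (auto simp: a_def b_def dist_real_def)
        ultimately show ?thesis using le[of x] by simp
      next
        case False then show ?thesis using Lout[of x] le[of x] by auto
      qed
    qed
    moreover have "2 * L t = C a + C b" using ab by (simp add: L_def l_def a_def b_def field_simps)
    ultimately have "C (t - s) + C (t + s) \<le> 2 * C t" by (simp add: a_def b_def)
    with convex_on_midpoint[OF cv, of t s] show "2 * C t = C (t - s) + C (t + s)" by simp
  qed
qed

text \<open>Where \<open>C < f - p\<close> the minorant \<open>C\<close> is locally affine, so \<open>f - C\<close> is locally convex there. At the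
  contact points \<open>f - C\<close> touches the convex function \<open>p\<close>, which lies below it.\<close>

lemma convex_minus_greatest_convex_minorant:
  assumes f: "convex_on UNIV f" and p: "convex_on UNIV p"
    and C: "greatest_convex_minorant (\<lambda>t. f t - p t) C"
  shows "convex_on UNIV (\<lambda>t. f t - C t)"
proof (rule convex_on_local_midpoint)
  have cv: "convex_on UNIV C" and le: "\<And>t. C t \<le> f t - p t"
    using C unfolding greatest_convex_minorant_def by blast+
  note cont = convex_on_UNIV_continuous
  show "continuous_on UNIV (\<lambda>t. f t - C t)" by (intro continuous_intros cont f cv)
  fix t
  show "\<exists>d>0. \<forall>s. 0 < s \<and> s < d \<longrightarrow> 2 * (f t - C t) \<le> f (t - s) - C (t - s) + (f (t + s) - C (t + s))"
  proof (cases "C t < f t - p t")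
    case True
    have "continuous_on UNIV (\<lambda>t. f t - p t)" by (intro continuous_intros cont f p)
    from greatest_convex_minorant_locally_affine[OF C this True]
    obtain d where d: "d>0" "\<And>s. 0 < s \<Longrightarrow> s < d \<Longrightarrow> 2 * C t = C (t - s) + C (t + s)" by blast
    show ?thesis
    proof (intro exI[of _ d] conjI d(1) allI impI)
      fix s assume "0 < s \<and> s < d"
      then show "2 * (f t - C t) \<le> f (t - s) - C (t - s) + (f (t + s) - C (t + s))"
        using d(2)[of s] convex_on_midpoint[OF f, of t s] by simp
    qed
  next
    case False
    then have eq: "C t = f t - p t" using le[of t] by simp
    show ?thesis
    proof (intro exI[of _ 1] conjI allI impI)
      fix s assume "0 < s \<and> s < (1::real)"
      show "2 * (f t - C t) \<le> f (t - s) - C (t - s) + (f (t + s) - C (t + s))"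
        using eq le[of "t - s"] le[of "t + s"] convex_on_midpoint[OF p, of t s] by simp
    qed simp
  qed
qed

text \<open>Minorants can be taken in two stages: \<open>C' + p\<close> is a convex minorant of
  \<open>E\<close> and so lies below \<open>C\<close>, and whatever lies below \<open>C - p\<close>
  lies below \<open>E - p\<close>. For shadows this expresses the minorant at a later level through
  the one at an earlier level.\<close>

lemma greatest_convex_minorant_diff:
  assumes p: "convex_on UNIV p" and C: "greatest_convex_minorant E C"
    and C': "greatest_convex_minorant (\<lambda>t. E t - p t) C'"
  shows "greatest_convex_minorant (\<lambda>t. C t - p t) C'"
proof -
  have "C' t + p t \<le> C t" for t
    using C C' p convex_on_add[of UNIV C' p] unfolding greatest_convex_minorant_def
    by (smt (verit, ccfv_SIG))
  moreover have "h t \<le> C' t" if "convex_on UNIV h" "\<And>t. h t \<le> C t - p t" for h t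
    using C C' that unfolding greatest_convex_minorant_def by (smt (verit, ccfv_SIG))
  ultimately show ?thesis using C' unfolding greatest_convex_minorant_def
    by (smt (verit, ccfv_SIG))
qed

subsection \<open>Potential functions of measures on the line\<close>

lemma finite_first_momentD:
  assumes "finite_first_moment m"
  shows "finite_measure m" "sets m = sets borel" "space m = UNIV" "integrable m (\<lambda>x. x)"
    "finite_borel_measure m"
  using assms sets_eq_imp_space_eq[of m borel]
  by (auto simp: finite_first_moment_def finite_borel_measure_def finite_borel_measure_axioms_def)

text \<open>The integrated distribution function. For finite first moment it is convex, tends to 0
  at minus infinity and has the asymptote mass times \<open>t\<close> minus first moment at plus
  infinity, so that mass and mean can be read off from it.\<close>

definition potential :: "real measure \<Rightarrow> real \<Rightarrow> real" where
  "potential m t = (\<integral>y. max 0 (t - y) \<partial>m)"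

lemma integrable_potential:
  assumes "finite_first_moment m"
  shows "integrable m (\<lambda>y. max 0 (t - y))" "integrable m (\<lambda>y. max 0 (y - t))"
proof -
  note m = finite_first_momentD[OF assms]
  interpret finite_measure m by fact
  note [simp] = m(4)
  show "integrable m (\<lambda>y. max 0 (t - y))" "integrable m (\<lambda>y. max 0 (y - t))"
    by (intro integrable_max Bochner_Integration.integrable_diff; simp)+
qed

lemma convex_on_potential_kernel: "convex_on UNIV (\<lambda>t. max 0 (t - y :: real))"
  using convex_on_max[OF convex_on_affine[of 0 0 0] convex_on_affine[of 0 1 y]] by simp

lemma convex_on_potential:
  assumes "finite_first_moment m" shows "convex_on UNIV (potential m)"
  unfolding convex_on_def
proof (intro conjI ballI allI impI)
  note [simp] = integrable_potential[OF assms]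
  fix x z u v :: real assume uv: "0 \<le> u" "0 \<le> v" "u + v = 1"
  have "potential m (u *\<^sub>R x + v *\<^sub>R z) \<le> (\<integral>y. u * max 0 (x - y) + v * max 0 (z - y) \<partial>m)"
    unfolding potential_def
  proof (rule integral_mono)
    fix y show "max 0 (u *\<^sub>R x + v *\<^sub>R z - y) \<le> u * max 0 (x - y) + v * max 0 (z - y)"
      using convex_on_potential_kernel[of y] uv unfolding convex_on_def by auto
  qed simp_all
  also have "\<dots> = u * potential m x + v * potential m z" by (simp add: potential_def)
  finally show "potential m (u *\<^sub>R x + v *\<^sub>R z) \<le> u * potential m x + v * potential m z" .
qed simp

lemma continuous_on_potential: "finite_first_moment m \<Longrightarrow> continuous_on UNIV (potential m)"
  by (intro convex_on_UNIV_continuous convex_on_potential)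

lemma potential_nonneg: "0 \<le> potential m t"
  unfolding potential_def by (rule integral_nonneg_AE) simp

text \<open>Dominated convergence with bound \<open>\<bar>f y\<bar>\<close> for
  \<open>t \<ge> 0\<close>. Taking \<open>f\<close> to be the identity or its negative covers both
  ends of the line.\<close>

lemma tendsto_integral_tail:
  fixes f :: "real \<Rightarrow> real"
  assumes "finite_measure m" "integrable m f"
  shows "((\<lambda>t. \<integral>y. max 0 (f y - t) \<partial>m) \<longlongrightarrow> 0) at_top"
proof -
  have [measurable]: "f \<in> borel_measurable m" using assms(2) by auto
  have "((\<lambda>t. \<integral>y. max 0 (f y - t) \<partial>m) \<longlongrightarrow> (\<integral>y. 0 \<partial>m)) at_top"
  proof (rule integral_dominated_convergence_at_top[where w = "\<lambda>y. \<bar>f y\<bar>"])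
    show "integrable m (\<lambda>y. \<bar>f y\<bar>)" using assms(2) by simp
    show "\<forall>\<^sub>F t in at_top. AE y in m. norm (max 0 (f y - t)) \<le> \<bar>f y\<bar>"
      unfolding eventually_at_top_linorder by (rule exI[of _ 0]) auto
    show "AE y in m. ((\<lambda>t. max 0 (f y - t)) \<longlongrightarrow> 0) at_top"
    proof (rule AE_I2)
      fix y
      have "eventually (\<lambda>t. max 0 (f y - t) = 0) at_top"
        unfolding eventually_at_top_linorder by (rule exI[of _ "f y"]) auto
      then show "((\<lambda>t. max 0 (f y - t)) \<longlongrightarrow> 0) at_top" by (rule tendsto_eventually)
    qed
  qed measurable
  then show ?thesis by simp
qed

lemma potential_at_bot:
  assumes "finite_first_moment m" shows "(potential m \<longlongrightarrow> 0) at_bot"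
proof -
  note m = finite_first_momentD[OF assms]
  have "((\<lambda>t. \<integral>y. max 0 (- y - t) \<partial>m) \<longlongrightarrow> 0) at_top"
    by (rule tendsto_integral_tail) (use m in auto)
  moreover have "potential m (- t) = (\<integral>y. max 0 (- y - t) \<partial>m)" for t
    unfolding potential_def by (rule Bochner_Integration.integral_cong) auto
  ultimately have "((\<lambda>t. potential m (- t)) \<longlongrightarrow> 0) at_top" by simp
  then show ?thesis by (simp add: filterlim_at_bot_mirror)
qed

text \<open>Since \<open>max 0 (t - y) - (t - y) = max 0 (y - t)\<close>, the distance from the
  potential to its asymptote is an upper tail integral.\<close>

lemma potential_at_top:
  assumes "finite_first_moment m"
  shows "((\<lambda>t. potential m t - (measure m UNIV * t - (\<integral>y. y \<partial>m))) \<longlongrightarrow> 0) at_top"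
proof -
  note m = finite_first_momentD[OF assms]
  interpret finite_measure m by fact
  note [simp] = integrable_potential[OF assms] m(4)
  have eq: "potential m t - (measure m UNIV * t - (\<integral>y. y \<partial>m)) = (\<integral>y. max 0 (y - t) \<partial>m)" for t
  proof -
    have "(\<integral>y. max 0 (y - t) \<partial>m) = (\<integral>y. max 0 (t - y) - (t - y) \<partial>m)"
      by (rule Bochner_Integration.integral_cong) auto
    also have "\<dots> = potential m t - (measure m UNIV * t - (\<integral>y. y \<partial>m))"
      by (simp add: potential_def m(3))
    finally show ?thesis ..
  qed
  show ?thesis unfolding eq by (rule tendsto_integral_tail) (use m in auto)
qed

section \<open>Distribution functions as slopes of potentials\<close>

text \<open>The increment is bounded by \<open>\<bar>t - s\<bar>\<close>. Working with increments
  makes sense before the first moment of the measure is known to be finite.\<close>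

lemma (in finite_borel_measure) integrable_potential_increment:
  "integrable M (\<lambda>y. max 0 (t - y) - max 0 (s - y))"
  by (rule integrable_const_bound[where B = "\<bar>t - s\<bar>"]) (auto simp: M_is_borel cong: measurable_cong_sets)

text \<open>The integrand equals \<open>t - s\<close> on \<open>{..s}\<close>, vanishes on
  \<open>{t<..}\<close> and lies between 0 and \<open>t - s\<close> elsewhere, so multiples of two
  indicators enclose it.\<close>

lemma (in finite_borel_measure) potential_increment_bounds:
  assumes "s \<le> t"
  shows "cdf M s * (t - s) \<le> (\<integral>y. max 0 (t - y) - max 0 (s - y) \<partial>M)"
    "(\<integral>y. max 0 (t - y) - max 0 (s - y) \<partial>M) \<le> cdf M t * (t - s)"
proof -
  note [simp] = integrable_potential_increment
  have [simp]: "integrable M (indicator {..c} :: real \<Rightarrow> real)" for c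
    by (rule integrable_real_indicator) (auto simp: M_is_borel less_top[symmetric])
  have ind: "(\<integral>y. indicator {..c} y * (t - s) \<partial>M) = cdf M c * (t - s)"
     "integrable M (\<lambda>y. indicator {..c} y * (t - s) :: real)" for c
    using M_is_borel by (auto simp: cdf_def borel_UNIV)
  show "cdf M s * (t - s) \<le> (\<integral>y. max 0 (t - y) - max 0 (s - y) \<partial>M)"
    unfolding ind(1)[symmetric] by (rule integral_mono) (use assms ind(2) in \<open>auto simp: indicator_def\<close>)
  show "(\<integral>y. max 0 (t - y) - max 0 (s - y) \<partial>M) \<le> cdf M t * (t - s)"
    unfolding ind(1)[symmetric] by (rule integral_mono) (use assms ind(2) in \<open>auto simp: indicator_def\<close>)
qed

lemma potential_cdf_bounds:
  assumes "finite_first_moment m" "s \<le> t"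
  shows "cdf m s * (t - s) \<le> potential m t - potential m s"
    "potential m t - potential m s \<le> cdf m t * (t - s)"
proof -
  interpret finite_borel_measure m using finite_first_momentD[OF assms(1)] by simp
  note [simp] = integrable_potential[OF assms(1)]
  show "cdf m s * (t - s) \<le> potential m t - potential m s"
    "potential m t - potential m s \<le> cdf m t * (t - s)"
    using potential_increment_bounds[OF assms(2)] by (simp_all add: potential_def)
qed

text \<open>Provides the sum as a measure in its own right, so that uniqueness of distribution
  functions can be applied to it.\<close>

lemma sum_measure_exists:
  assumes "sets m1 = sets m" "sets m2 = sets m"
  shows "\<exists>N. sets N = sets m \<and> (\<forall>A\<in>sets m. emeasure N A = emeasure m1 A + emeasure m2 A)"
proof -
  define N where "N = measure_of (space m) (sets m) (\<lambda>A. emeasure m1 A + emeasure m2 A)"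
  have "emeasure N A = emeasure m1 A + emeasure m2 A" if "A \<in> sets m" for A
    unfolding N_def
  proof (rule emeasure_measure_of_sigma)
    show "sigma_algebra (space m) (sets m)" by (rule sets.sigma_algebra_axioms)
    show "positive (sets m) (\<lambda>A. emeasure m1 A + emeasure m2 A)" by (simp add: positive_def)
    show "countably_additive (sets m) (\<lambda>A. emeasure m1 A + emeasure m2 A)"
      unfolding countably_additive_def
    proof (intro allI impI)
      fix A :: "nat \<Rightarrow> _" assume "range A \<subseteq> sets m" "disjoint_family A"
      then show "(\<Sum>i. emeasure m1 (A i) + emeasure m2 (A i)) = emeasure m1 (\<Union> (range A)) + emeasure m2 (\<Union> (range A))"
        by (subst suminf_add[symmetric]) (auto simp: suminf_emeasure assms)
    qed
  qed fact
  moreover have "sets N = sets m" by (simp add: N_def)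
  ultimately show ?thesis by blast
qed

text \<open>Difference quotients of the potential lie between the values of the distribution
  function at the two endpoints. Hence \<open>cdf m\<close> and the sum of the two other
  distribution functions interlace at any \<open>s < t\<close>, and right-continuity makes them
  equal.\<close>

lemma potential_add_unique:
  assumes m: "finite_first_moment m" and m1: "finite_first_moment m1" and m2: "finite_first_moment m2"
    and eq: "\<And>t. potential m t = potential m1 t + potential m2 t" and A: "A \<in> sets borel"
  shows "emeasure m A = emeasure m1 A + emeasure m2 A"
proof -
  interpret m: finite_borel_measure m using finite_first_momentD[OF m] by simp
  interpret m1: finite_borel_measure m1 using finite_first_momentD[OF m1] by simp
  interpret m2: finite_borel_measure m2 using finite_first_momentD[OF m2] by simp
  define c where "c = (\<lambda>x. cdf m1 x + cdf m2 x)"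
  have le: "cdf m s \<le> c t" "c s \<le> cdf m t" if "s < t" for s t
  proof -
    note b = potential_cdf_bounds[OF m, of s t] potential_cdf_bounds[OF m1, of s t]
      potential_cdf_bounds[OF m2, of s t]
    have "cdf m s * (t - s) \<le> c t * (t - s)" "c s * (t - s) \<le> cdf m t * (t - s)"
      using b that eq[of s] eq[of t] by (auto simp: c_def distrib_right)
    then show "cdf m s \<le> c t" "c s \<le> cdf m t" using that by auto
  qed
  have "cdf m = c"
  proof
    fix s
    have lim: "(cdf m \<longlongrightarrow> cdf m s) (at_right s)" "(c \<longlongrightarrow> c s) (at_right s)"
      using m.cdf_is_right_cont[of s] m1.cdf_is_right_cont[of s] m2.cdf_is_right_cont[of s]
      unfolding c_def by (auto simp: continuous_within intro!: tendsto_add)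
    have "eventually (\<lambda>t. t > s) (at_right s)" by (simp add: eventually_at_filter)
    then have "eventually (\<lambda>t. cdf m s \<le> c t) (at_right s)" "eventually (\<lambda>t. c s \<le> cdf m t) (at_right s)"
      by (auto elim: eventually_mono intro: le)
    then have "cdf m s \<le> c s" "c s \<le> cdf m s"
      using tendsto_lowerbound[OF lim(2)] tendsto_lowerbound[OF lim(1)] by auto
    then show "cdf m s = c s" by simp
  qed
  obtain N where N: "sets N = sets m" "\<And>A. A \<in> sets m \<Longrightarrow> emeasure N A = emeasure m1 A + emeasure m2 A"
    using sum_measure_exists[of m1 m m2] m1.M_is_borel m2.M_is_borel m.M_is_borel by auto
  have sp: "space N = UNIV" using N(1) m.M_is_borel by (metis sets_eq_imp_space_eq space_borel)
  have "emeasure N (space N) = emeasure m1 (space N) + emeasure m2 (space N)"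
    using N(2)[of "space N"] N(1) sets.top[of N] by simp
  then have "finite_measure N"
    by (intro finite_measureI) (simp add: ennreal_add_eq_top m1.emeasure_finite m2.emeasure_finite)
  then interpret N: finite_borel_measure N
    by (simp add: finite_borel_measure_def finite_borel_measure_axioms_def N(1) m.M_is_borel)
  have "cdf N = c"
  proof
    fix x
    have "ennreal (cdf N x) = ennreal (c x)"
      using N(2)[of "{..x}"] m.M_is_borel
      by (simp add: N.emeasure_eq_measure m1.emeasure_eq_measure m2.emeasure_eq_measure cdf_def c_def)
    then show "cdf N x = c x" by (simp add: c_def cdf_def flip: ennreal_plus)
  qed
  then have "m = N" using cdf_unique'[OF m.finite_borel_measure_axioms N.finite_borel_measure_axioms] \<open>cdf m = c\<close> by simp
  then show ?thesis using N A m.M_is_borel by auto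
qed

section \<open>Recovering a measure from its potential\<close>

text \<open>Over \<open>Suc n\<close> pieces of equal length the bounds telescope in
  \<open>g\<close>, which leaves \<open>(g t - g s) * (t - s) / Suc n\<close> as a bound for the
  total change of \<open>\<Phi>\<close>.\<close>

lemma quadratic_variation_zero:
  fixes g \<Phi> :: "real \<Rightarrow> real"
  assumes bound: "\<And>s t. s \<le> t \<Longrightarrow> \<bar>\<Phi> t - \<Phi> s\<bar> \<le> (g t - g s) * (t - s)" and st: "s \<le> t"
  shows "\<Phi> s = \<Phi> t"
proof -
  have step: "\<bar>\<Phi> (s + real k * h) - \<Phi> s\<bar> \<le> (g (s + real k * h) - g s) * h" if "h \<ge> 0" for k h
  proof (induction k)
    case (Suc k)
    have "\<bar>\<Phi> (s + real (Suc k) * h) - \<Phi> (s + real k * h)\<bar>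
        \<le> (g (s + real (Suc k) * h) - g (s + real k * h)) * h"
      using bound[of "s + real k * h" "s + real (Suc k) * h"] that by (simp add: algebra_simps)
    with Suc show ?case by (simp add: left_diff_distrib)
  qed simp
  have "\<bar>\<Phi> t - \<Phi> s\<bar> \<le> (g t - g s) * (t - s) * inverse (real (Suc n))" for n
  proof -
    have "s + real (Suc n) * ((t - s) / real (Suc n)) = t" by simp
    then show ?thesis using step[of "(t - s) / real (Suc n)" "Suc n"] st
      by (simp only: divide_inverse mult.assoc[symmetric]) (simp add: mult.assoc)
  qed
  moreover have "(\<lambda>n. (g t - g s) * (t - s) * inverse (real (Suc n))) \<longlonglongrightarrow> (g t - g s) * (t - s) * 0"
    by (intro tendsto_mult tendsto_const LIMSEQ_inverse_real_of_nat)
  ultimately have "\<bar>\<Phi> t - \<Phi> s\<bar> \<le> (g t - g s) * (t - s) * 0"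
    by (intro LIMSEQ_le_const) auto
  then show ?thesis by simp
qed

text \<open>\<open>G\<close> is the right derivative of \<open>F\<close>, obtained as the infimum of
  the slopes to the right. The bounds are monotonicity of slopes.\<close>

lemma convex_right_slope:
  fixes F :: "real \<Rightarrow> real"
  assumes F: "convex_on UNIV F"
  shows "\<exists>G. (\<forall>s t. s < t \<longrightarrow> G s \<le> (F t - F s) / (t - s) \<and> (F t - F s) / (t - s) \<le> G t) \<and>
    mono G \<and> (\<forall>s. continuous (at_right s) G)"
proof -
  define q where "q x y = (F y - F x) / (y - x)" for x y
  have q: "q x t \<le> q x y" "q x y \<le> q t y" if "x < t" "t < y" for x y t
  proof -
    have sl: "(F x - F t) / (x - t) \<le> (F x - F y) / (x - y)" "(F x - F y) / (x - y) \<le> (F t - F y) / (t - y)"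
      using convex_on_slope_le[OF F, of x y t] that by auto
    have flip: "(F u - F v) / (u - v) = q u v" for u v
      unfolding q_def by (metis minus_diff_eq minus_divide_divide)
    show "q x t \<le> q x y" "q x y \<le> q t y" using sl unfolding flip by auto
  qed
  define G where "G s = (INF t\<in>{s<..}. q s t)" for s
  have low: "q r s \<le> q s t" if "r < s" "s < t" for r s t using q[of r s t] that by linarith
  have bdd: "bdd_below (q s ` {s<..})" for s
    by (rule bdd_belowI[of _ "q (s - 1) s"]) (use low[of "s - 1" s] in auto)
  have G1: "G s \<le> q s t" if "s < t" for s t unfolding G_def by (rule cINF_lower[OF bdd]) (use that in auto)
  have G2: "q s t \<le> G t" if "s < t" for s t unfolding G_def
    by (rule cINF_greatest) (use low that in auto)
  have mono: "G s \<le> G t" if "s \<le> t" for s t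
    using G1[of s t] G2[of s t] that by (cases "s = t") auto
  have "(G \<longlongrightarrow> G s) (at_right s)" for s
  proof (rule order_tendstoI)
    fix c assume "c < G s"
    then show "eventually (\<lambda>t. c < G t) (at_right s)"
      unfolding eventually_at_filter
    proof (intro always_eventually allI impI)
      fix t assume "t \<in> {s<..}"
      then have "G s \<le> G t" by (intro mono) simp
      with \<open>c < G s\<close> show "c < G t" by simp
    qed
  next
    fix c assume "G s < c"
    \<comment> \<open>The slope towards \<open>u\<close> nearly attains the infimum at
      \<open>s\<close>. It depends continuously on its base point, so it still bounds
      \<open>G t\<close> for \<open>t\<close> slightly to the right of \<open>s\<close>.\<close>
    then obtain u where u: "s < u" "q s u < c"
      unfolding G_def using cINF_less_iff[OF _ bdd, of s c] by auto
    have "isCont F s" using convex_on_UNIV_continuous[OF F, of UNIV] by (simp add: continuous_on_eq_continuous_at)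
    then have "(F \<longlongrightarrow> F s) (at_right s)" using isCont_def filterlim_at_split by blast
    then have "((\<lambda>t. q t u) \<longlongrightarrow> q s u) (at_right s)" unfolding q_def
      by (intro tendsto_intros) (use u in auto)
    then have "eventually (\<lambda>t. q t u < c) (at_right s)" using u by (auto dest: order_tendstoD)
    moreover have "eventually (\<lambda>t. t < u) (at_right s)" 
      using u eventually_at_right by blast
    ultimately show "eventually (\<lambda>t. G t < c) (at_right s)"
      by eventually_elim (use G1 in fastforce)
  qed
  then have "continuous (at_right s) G" for s by (simp add: continuous_within)
  moreover have "\<forall>s t. s < t \<longrightarrow> G s \<le> (F t - F s) / (t - s) \<and> (F t - F s) / (t - s) \<le> G t"
    using G1 G2 unfolding q_def by blast
  ultimately show ?thesis using mono by (intro exI[of _ G] conjI) (auto intro: monoI)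
qed

text \<open>The right derivative \<open>G\<close> of \<open>F\<close> is the distribution function
  of a finite measure. Increments of its potential and of \<open>F\<close> obey the same bounds in
  terms of \<open>G\<close>, so they agree; the limits of \<open>F\<close> at the two ends then give
  the potential itself, the first moment and the mean.\<close>

lemma measure_with_potential_exists:
  fixes F :: "real \<Rightarrow> real"
  assumes F: "convex_on UNIV F" and bot: "(F \<longlongrightarrow> 0) at_bot"
    and top: "((\<lambda>t. F t - (a * t - b)) \<longlongrightarrow> 0) at_top"
  shows "\<exists>m. finite_first_moment m \<and> measure m UNIV = a \<and> (\<integral>y. y \<partial>m) = b \<and> potential m = F"
proof -
  obtain G where G: "\<And>s t. s < t \<Longrightarrow> G s \<le> (F t - F s) / (t - s)"
    "\<And>s t. s < t \<Longrightarrow> (F t - F s) / (t - s) \<le> G t" "\<And>s t. s \<le> t \<Longrightarrow> G s \<le> G t"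
    "\<And>s. continuous (at_right s) G"
    using convex_right_slope[OF F] unfolding mono_def by metis
  \<comment> \<open>Slopes over unit intervals enclose \<open>G\<close>, which transfers the limits
    of \<open>F\<close> to \<open>G\<close>.\<close>
  have sand: "F t - F (t - 1) \<le> G t" "G t \<le> F (t + 1) - F t" for t
    using G(1)[of t "t + 1"] G(2)[of "t - 1" t] by auto
  have shift_bot: "filterlim (\<lambda>t::real. t + c) at_bot at_bot" for c
    unfolding filterlim_at_bot eventually_at_bot_linorder
  proof
    fix Z show "\<exists>N. \<forall>t\<le>N. t + c \<le> Z" by (rule exI[of _ "Z - c"]) auto
  qed
  have shift_top: "filterlim (\<lambda>t::real. t + c) at_top at_top" for c
    unfolding filterlim_at_top eventually_at_top_linorder
  proof
    fix Z show "\<exists>N. \<forall>t\<ge>N. Z \<le> t + c" by (rule exI[of _ "Z - c"]) auto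
  qed
  have Gbot: "(G \<longlongrightarrow> 0) at_bot"
  proof (rule tendsto_sandwich[OF always_eventually always_eventually])
    show "((\<lambda>t. F t - F (t - 1)) \<longlongrightarrow> 0) at_bot"
      using tendsto_diff[OF bot filterlim_compose[OF bot shift_bot[of "-1"]]] by simp
    show "((\<lambda>t. F (t + 1) - F t) \<longlongrightarrow> 0) at_bot"
      using tendsto_diff[OF filterlim_compose[OF bot shift_bot[of "1"]] bot] by simp
  qed (use sand in auto)
  have Gtop: "(G \<longlongrightarrow> a) at_top"
  proof (rule tendsto_sandwich[OF always_eventually always_eventually])
    have "((\<lambda>t. (F t - (a * t - b)) - (F (t + -1) - (a * (t + -1) - b)) + a) \<longlongrightarrow> 0 - 0 + a) at_top"
      by (intro tendsto_intros top filterlim_compose[OF top shift_top[of "-1"]])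
    then show "((\<lambda>t. F t - F (t - 1)) \<longlongrightarrow> a) at_top" by (simp add: algebra_simps)
    have "((\<lambda>t. (F (t + 1) - (a * (t + 1) - b)) - (F t - (a * t - b)) + a) \<longlongrightarrow> 0 - 0 + a) at_top"
      by (intro tendsto_intros top filterlim_compose[OF top shift_top[of "1"]])
    then show "((\<lambda>t. F (t + 1) - F t) \<longlongrightarrow> a) at_top" by (simp add: algebra_simps)
  qed (use sand in auto)
  have Gpos: "0 \<le> G t" for t
    using Gbot by (rule tendsto_upperbound) (auto simp: eventually_at_bot_linorder G(3) intro!: exI[of _ t])
  have a0: "0 \<le> a" using Gtop by (rule tendsto_lowerbound) (auto simp: Gpos)
  define m where "m = interval_measure G"
  interpret finite_borel_measure m
    unfolding m_def by (rule finite_borel_measure_interval_measure[OF G(3,4) Gbot Gtop a0])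
  have cdf: "cdf m = G" unfolding m_def by (rule cdf_interval_measure[OF G(3,4) Gbot])
  have mU: "measure m UNIV = a"
    using interval_measure_UNIV[OF G(3,4) Gbot Gtop a0] a0 by (simp add: m_def measure_def)
  have spm: "space m = UNIV" by (simp add: m_def)
  have sm: "sets m = sets borel" by (simp add: m_def)
  note [simp] = integrable_potential_increment
  have incr: "(\<integral>y. max 0 (t - y) - max 0 (s - y) \<partial>m) = F t - F s" if st: "s \<le> t" for s t
  proof -
    \<comment> \<open>The potential normalised to vanish at 0; it is an integral of a bounded
      function.\<close>
    define H where "H u = (\<integral>y. max 0 (u - y) - max 0 (0 - y) \<partial>m)" for u
    have H: "H u - H v = (\<integral>y. max 0 (u - y) - max 0 (v - y) \<partial>m)" for u v
    proof -
      have "H u - H v = (\<integral>y. (max 0 (u - y) - max 0 (0 - y)) - (max 0 (v - y) - max 0 (0 - y)) \<partial>m)"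
        unfolding H_def by (rule Bochner_Integration.integral_diff[symmetric]) (rule integrable_potential_increment)+
      then show ?thesis by (simp only: diff_diff_eq2 diff_add_cancel)
    qed
    have "H s - F s = H t - F t"
    proof (rule quadratic_variation_zero[of "\<lambda>t. H t - F t" G, OF _ st])
      fix u v :: real assume uv: "u \<le> v"
      have "G u * (v - u) \<le> H v - H u" "H v - H u \<le> G v * (v - u)"
        using potential_increment_bounds[OF uv] unfolding H cdf by auto
      moreover have "G u * (v - u) \<le> F v - F u" "F v - F u \<le> G v * (v - u)"
        using G(1,2)[of u v] uv by (cases "u = v"; simp add: field_simps)+
      ultimately show "\<bar>(H v - F v) - (H u - F u)\<bar> \<le> (G v - G u) * (v - u)"
        by (simp add: left_diff_distrib abs_le_iff)
    qed
    then show ?thesis using H[of t s] by simp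
  qed
  have pot: "integrable m (\<lambda>y. max 0 (t - y))" "(\<integral>y. max 0 (t - y) \<partial>m) = F t" for t
  proof -
    \<comment> \<open>These increments of the potential kernel increase to
      \<open>max 0 (t - y)\<close>, while \<open>F (t - real i)\<close> tends to 0.\<close>
    define f where "f i y = max 0 (t - y) - max 0 (t - real i - y)" for i y
    have fi: "integrable m (f i)" for i unfolding f_def by simp
    have mono: "AE y in m. mono (\<lambda>i. f i y)" by (auto simp: f_def mono_def)
    have pos: "AE y in m. 0 \<le> f i y" for i by (auto simp: f_def)
    have lim: "AE y in m. (\<lambda>i. f i y) \<longlonglongrightarrow> max 0 (t - y)"
    proof (rule AE_I2)
      fix y
      obtain n where "t - y \<le> real n" using real_arch_simple by blast
      then have "eventually (\<lambda>i. f i y = max 0 (t - y)) sequentially"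
        unfolding eventually_sequentially f_def by (intro exI[of _ n]) auto
      then show "(\<lambda>i. f i y) \<longlonglongrightarrow> max 0 (t - y)" by (rule tendsto_eventually)
    qed
    have "filterlim (\<lambda>i. t - real i) at_bot sequentially"
      unfolding filterlim_at_bot eventually_sequentially
    proof
      fix Z
      obtain n where "t - Z \<le> real n" using real_arch_simple by blast
      then show "\<exists>N. \<forall>n\<ge>N. t - real n \<le> Z" by (intro exI[of _ n]) auto
    qed
    then have "(\<lambda>i. F t - F (t - real i)) \<longlonglongrightarrow> F t - 0"
      by (intro tendsto_intros filterlim_compose[OF bot])
    moreover have "integral\<^sup>L m (f i) = F t - F (t - real i)" for i
      unfolding f_def by (rule incr) simp
    ultimately have ilim: "(\<lambda>i. integral\<^sup>L m (f i)) \<longlonglongrightarrow> F t" by simp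
    have meas: "(\<lambda>y. max 0 (t - y)) \<in> borel_measurable m" by (simp add: m_def)
    show "integrable m (\<lambda>y. max 0 (t - y))" "(\<integral>y. max 0 (t - y) \<partial>m) = F t"
      using integral_monotone_convergence_nonneg[OF fi mono pos lim ilim meas] by auto
  qed
  have plus: "integrable m (\<lambda>y. max 0 y)" "(\<integral>y. max 0 y \<partial>m) = b + F 0"
  proof -
    \<comment> \<open>This is the truncation \<open>min (real i) (max 0 y)\<close> of the positive
      part, written so that its integral is given by an increment of \<open>F\<close>.\<close>
    define f where "f i y = real i - (max 0 (real i - y) - max 0 (0 - y))" for i y
    have fi: "integrable m (f i)" for i unfolding f_def
      by (intro Bochner_Integration.integrable_diff integrable_const integrable_potential_increment)
    have mono: "AE y in m. mono (\<lambda>i. f i y)" by (auto simp: f_def mono_def)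
    have pos: "AE y in m. 0 \<le> f i y" for i by (auto simp: f_def)
    have lim: "AE y in m. (\<lambda>i. f i y) \<longlonglongrightarrow> max 0 y"
    proof (rule AE_I2)
      fix y :: real
      obtain n where "y \<le> real n" using real_arch_simple by blast
      then have "eventually (\<lambda>i. f i y = max 0 y) sequentially"
        unfolding eventually_sequentially f_def by (intro exI[of _ n]) auto
      then show "(\<lambda>i. f i y) \<longlonglongrightarrow> max 0 y" by (rule tendsto_eventually)
    qed
    have "(\<lambda>i. b + F 0 - (F (real i) - (a * real i - b))) \<longlonglongrightarrow> b + F 0 - 0"
      by (intro tendsto_intros filterlim_compose[OF top filterlim_real_sequentially])
    moreover have "integral\<^sup>L m (f i) = b + F 0 - (F (real i) - (a * real i - b))" for i
    proof -
      have "integral\<^sup>L m (f i) = (\<integral>y. real i \<partial>m) - (\<integral>y. max 0 (real i - y) - max 0 (0 - y) \<partial>m)"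
        unfolding f_def
        by (intro Bochner_Integration.integral_diff integrable_const integrable_potential_increment)
      also have "(\<integral>y. max 0 (real i - y) - max 0 (0 - y) \<partial>m) = F (real i) - F 0" by (rule incr) simp
      finally show ?thesis by (simp add: mU spm)
    qed
    ultimately have ilim: "(\<lambda>i. integral\<^sup>L m (f i)) \<longlonglongrightarrow> b + F 0" by simp
    have meas: "(\<lambda>y. max 0 y) \<in> borel_measurable m" by (simp add: m_def)
    show "integrable m (\<lambda>y. max 0 y)" "(\<integral>y. max 0 y \<partial>m) = b + F 0"
      using integral_monotone_convergence_nonneg[OF fi mono pos lim ilim meas] by auto
  qed
  have id: "(\<lambda>y::real. y) = (\<lambda>y. max 0 y - max 0 (0 - y))" by (auto simp: fun_eq_iff max_def)
  have int: "integrable m (\<lambda>y. y)" by (subst id, intro Bochner_Integration.integrable_diff plus pot)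
  have "(\<integral>y. y \<partial>m) = b"
    by (subst id, subst Bochner_Integration.integral_diff) (use plus pot[of 0] in auto)
  moreover have "potential m = F" by (auto simp: potential_def pot(2))
  ultimately show ?thesis using int mU finite_measure_axioms
    by (intro exI[of _ m]) (simp add: finite_first_moment_def sm)
qed

subsection \<open>Kernels and disintegrations\<close>

text \<open>The infimum over rationals strictly above \<open>x\<close> is a right limit of
  \<open>r\<close>, so \<open>h\<close> is right-continuous whether or not \<open>r\<close>
  is.\<close>

lemma rational_cdf_extension:
  fixes r :: "rat \<Rightarrow> real"
  assumes bounds: "\<And>q. 0 \<le> r q" "\<And>q. r q \<le> 1" and mono: "\<And>q q'. q \<le> q' \<Longrightarrow> r q \<le> r q'"
    and inf: "\<And>e. e > 0 \<Longrightarrow> \<exists>q. r q < e" and sup: "\<And>e. e > 0 \<Longrightarrow> \<exists>q. 1 - e < r q"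
  defines "h \<equiv> \<lambda>x::real. INF q\<in>{q. x < of_rat q}. r q"
  shows "x \<le> y \<Longrightarrow> h x \<le> h y" "continuous (at_right x) h" "(h \<longlongrightarrow> 0) at_bot" "(h \<longlongrightarrow> 1) at_top"
    "0 \<le> h x" "h x \<le> 1" "x < of_rat q \<Longrightarrow> h x \<le> r q"
proof -
  have ne: "{q. x < of_rat q} \<noteq> {}" for x :: real
    using of_rat_dense[of x "x + 1"] by auto
  have bdd: "bdd_below (r ` {q. x < of_rat q})" for x
    by (rule bdd_belowI[of _ 0]) (use bounds in auto)
  have low: "h x \<le> r q" if "x < of_rat q" for x q
    unfolding h_def by (rule cINF_lower[OF bdd]) (use that in auto)
  have up: "c \<le> h x" if "\<And>q. x < of_rat q \<Longrightarrow> c \<le> r q" for c x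
    unfolding h_def by (rule cINF_greatest[OF ne]) (use that in auto)
  have pos: "0 \<le> h x" for x by (rule up) (rule bounds)
  have one: "h x \<le> 1" for x
    using of_rat_dense[of x "x + 1"] low bounds(2) order_trans by (metis less_add_one)
  have mn: "h x \<le> h y" if "x \<le> y" for x y by (rule up) (use low that in fastforce)
  show "0 \<le> h x" "h x \<le> 1" "x < of_rat q \<Longrightarrow> h x \<le> r q" "x \<le> y \<Longrightarrow> h x \<le> h y"
    using pos one low mn by auto
  have "(h \<longlongrightarrow> h x) (at_right x)"
  proof (rule order_tendstoI)
    fix c assume c: "c < h x"
    have "c < h t" if "t \<in> {x<..}" for t using mn[of x t] that c by auto
    then show "eventually (\<lambda>t. c < h t) (at_right x)" unfolding eventually_at_filter by simp
  next
    fix c assume "h x < c"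
    then obtain q where q: "x < of_rat q" "r q < c"
      unfolding h_def using cINF_less_iff[OF ne bdd] by auto
    have "eventually (\<lambda>t. t < of_rat q) (at_right x)" using q(1) eventually_at_right by blast
    then show "eventually (\<lambda>t. h t < c) (at_right x)"
      by eventually_elim (use low q(2) in fastforce)
  qed
  then show "continuous (at_right x) h" by (simp add: continuous_within)
  show "(h \<longlongrightarrow> 0) at_bot"
  proof (rule order_tendstoI)
    fix c :: real assume "c < 0"
    then show "eventually (\<lambda>t. c < h t) at_bot" using pos less_le_trans by (intro always_eventually) blast
  next
    fix c :: real assume "0 < c"
    then obtain q where q: "r q < c" using inf by blast
    have "h t < c" if "t \<le> of_rat q - 1" for t using low[of t q] that q by auto
    then show "eventually (\<lambda>t. h t < c) at_bot" unfolding eventually_at_bot_linorder by blast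
  qed
  show "(h \<longlongrightarrow> 1) at_top"
  proof (rule order_tendstoI)
    fix c :: real assume "1 < c"
    then show "eventually (\<lambda>t. h t < c) at_top" using one le_less_trans by (intro always_eventually) blast
  next
    fix c :: real assume "c < 1"
    then obtain q where q: "c < r q" using sup[of "1 - c"] by auto
    have "c < h t" if "t \<ge> of_rat q" for t
    proof -
      have "r q \<le> h t" by (rule up, rule mono) (use that in \<open>simp add: less_eq_rat_def of_rat_less[symmetric, where 'a=real]\<close>)
      with q show ?thesis by simp
    qed
    then show "eventually (\<lambda>t. c < h t) at_top" unfolding eventually_at_top_linorder by blast
  qed
qed

text \<open>A Radon-Nikodym derivative. It is finite almost everywhere because \<open>N\<close> is
  finite, so its real part serves as well.\<close>

lemma (in prob_space) real_density_exists:
  assumes s: "sets N = sets M" and le: "\<And>A. A \<in> sets M \<Longrightarrow> emeasure N A \<le> emeasure M A"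
  shows "\<exists>f. integrable M f \<and> (\<forall>x. 0 \<le> f x) \<and> (\<forall>A\<in>sets M. (LINT x:A|M. f x) = measure N A)"
proof -
  have sp: "space N = space M" using s by (rule sets_eq_imp_space_eq)
  have "emeasure N (space N) \<le> 1" using le[of "space M"] emeasure_space_1 sp by simp
  then interpret N: finite_measure N by (intro finite_measureI) (auto simp: top_unique)
  have "absolutely_continuous M N"
    unfolding absolutely_continuous_def using le s by (auto simp: null_sets_def le_zero_eq[symmetric] simp del: le_zero_eq)
      (metis le_zero_eq le)
  from Radon_Nikodym[OF this s] obtain g where g: "g \<in> borel_measurable M" "density M g = N" by blast
  define f where "f x = enn2real (g x)" for x
  note g(1)[measurable]
  have [measurable]: "f \<in> borel_measurable M" unfolding f_def by measurable
  have "(\<integral>\<^sup>+x. g x \<partial>M) = emeasure N (space M)"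
    unfolding g(2)[symmetric] by (subst emeasure_density) (auto intro!: nn_integral_cong)
  then have fin: "(\<integral>\<^sup>+x. g x \<partial>M) \<noteq> \<infinity>" using N.emeasure_finite by simp
  have ae: "AE x in M. ennreal (f x) = g x"
    using nn_integral_PInf_AE[OF g(1) fin] by eventually_elim (simp add: f_def less_top)
  have "(\<integral>\<^sup>+x. ennreal (f x) \<partial>M) = (\<integral>\<^sup>+x. g x \<partial>M)" by (rule nn_integral_cong_AE[OF ae])
  then have int: "integrable M f" using fin by (intro integrableI_nonneg) (auto simp: f_def less_top)
  have "(LINT x:A|M. f x) = measure N A" if A: "A \<in> sets M" for A
  proof -
    have "emeasure N A = (\<integral>\<^sup>+x. g x * indicator A x \<partial>M)"
      unfolding g(2)[symmetric] by (rule emeasure_density[OF g(1) A])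
    also have "\<dots> = (\<integral>\<^sup>+x. ennreal (indicator A x *\<^sub>R f x) \<partial>M)"
      by (rule nn_integral_cong_AE) (use ae in eventually_elim, auto split: split_indicator)
    also have "\<dots> = ennreal (\<integral>x. indicator A x *\<^sub>R f x \<partial>M)"
      by (rule nn_integral_eq_integral[OF integrable_mult_indicator[OF A int]])
         (auto simp: f_def split: split_indicator)
    finally show ?thesis unfolding set_lebesgue_integral_def
      by (simp add: measure_def f_def integral_nonneg_AE)
  qed
  then show ?thesis using int by (intro exI[of _ f]) (auto simp: f_def)
qed

text \<open>The complement of \<open>A\<close> contributes a nonnegative amount to the difference of
  the total masses. Continuity of total masses thereby passes to every set.\<close>

lemma (in finite_measure) measure_diff_le:
  assumes "sets N = sets M" "finite_measure N" "\<And>A. A \<in> sets M \<Longrightarrow> measure N A \<le> measure M A" "A \<in> sets M"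
  shows "measure M A - measure N A \<le> measure M (space M) - measure N (space M)"
proof -
  interpret N: finite_measure N by fact
  have sp: "space N = space M" using assms(1) by (rule sets_eq_imp_space_eq)
  have "measure N (space M - A) \<le> measure M (space M - A)" using assms by auto
  then show ?thesis using finite_measure_compl[OF assms(4)] N.finite_measure_compl[of A] assms sp by simp
qed

text \<open>For fixed \<open>y\<close> the density of \<open>\<theta> u\<close> with respect to
  \<open>M\<close> grows with \<open>u\<close> from 0 to 1; \<open>L y\<close> is the probability
  measure with this distribution function.\<close>

lemma (in prob_space) kernel_of_increasing_family:
  fixes \<theta> :: "real \<Rightarrow> 'a measure"
  assumes sets: "\<And>u. sets (\<theta> u) = sets M"
    and le: "\<And>u A. A \<in> sets M \<Longrightarrow> emeasure (\<theta> u) A \<le> emeasure M A"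
    and mono: "\<And>u v A. u \<le> v \<Longrightarrow> A \<in> sets M \<Longrightarrow> emeasure (\<theta> u) A \<le> emeasure (\<theta> v) A"
    and rc: "\<And>u. continuous (at_right u) (\<lambda>u. measure (\<theta> u) (space M))"
    and bot: "((\<lambda>u. measure (\<theta> u) (space M)) \<longlongrightarrow> 0) at_bot"
    and top: "((\<lambda>u. measure (\<theta> u) (space M)) \<longlongrightarrow> 1) at_top"
  shows "\<exists>L \<in> M \<rightarrow>\<^sub>M prob_algebra borel. \<forall>u. \<forall>A\<in>sets M.
    emeasure (\<theta> u) A = (\<integral>\<^sup>+y. emeasure (L y) {..u} * indicator A y \<partial>M)"
proof -
  have sp: "space (\<theta> u) = space M" for u using sets by (rule sets_eq_imp_space_eq)
  have fin: "finite_measure (\<theta> u)" for u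
    using le[of "space M" u] emeasure_space_1 sp by (intro finite_measureI) (auto simp: top_unique)
  have mle: "measure (\<theta> u) A \<le> measure M A" "u \<le> v \<Longrightarrow> measure (\<theta> u) A \<le> measure (\<theta> v) A"
    if "A \<in> sets M" for A u v
    using le[OF that] mono[OF _ that] finite_measure.emeasure_eq_measure[OF fin] emeasure_eq_measure by auto
  have "\<exists>r. \<forall>u. integrable M (r u) \<and> (\<forall>x. 0 \<le> r u x) \<and> (\<forall>A\<in>sets M. (LINT x:A|M. r u x) = measure (\<theta> u) A)"
    using real_density_exists[OF sets le] by metis
  then obtain r where r: "\<And>u. integrable M (r u)" "\<And>u x. 0 \<le> r u x"
    "\<And>u A. A \<in> sets M \<Longrightarrow> (LINT x:A|M. r u x) = measure (\<theta> u) A" by blast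
  have [measurable]: "r u \<in> borel_measurable M" for u using r(1) by auto
  have si: "set_integrable M A (r u)" if "A \<in> sets M" for A u
    unfolding set_integrable_def using r(1) that by (intro integrable_mult_indicator)
  have sc: "set_integrable M A (\<lambda>_. c::real)" if "A \<in> sets M" for A c
    unfolding set_integrable_def using that by (intro integrable_mult_indicator) auto
  have lc: "(LINT x:A|M. c) = c * measure M A" if "A \<in> sets M" for A and c::real
    using that by (simp add: set_lebesgue_integral_def)
  have ae_mono: "AE x in M. r u x \<le> r v x" if "u \<le> v" for u v
  proof -
    have "AE x in M. 0 \<le> r v x - r u x"
    proof (rule density_nonneg)
      fix A assume A: "A \<in> sets M"
      show "0 \<le> (LINT x:A|M. r v x - r u x)"
        using set_integral_diff(2)[OF si[OF A] si[OF A]] r(3)[OF A] mle(2)[OF A that] by simp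
    qed (use r in auto)
    then show ?thesis by eventually_elim simp
  qed
  have ae_one: "AE x in M. r u x \<le> 1" for u
  proof -
    have "AE x in M. 0 \<le> 1 - r u x"
    proof (rule density_nonneg)
      fix A assume A: "A \<in> sets M"
      show "0 \<le> (LINT x:A|M. 1 - r u x)"
        using set_integral_diff(2)[OF sc[OF A] si[OF A]] r(3)[OF A] mle(1)[OF A] lc[OF A] by simp
    qed (use r in auto)
    then show ?thesis by eventually_elim simp
  qed
  \<comment> \<open>If the densities stayed above \<open>e\<close> on \<open>B\<close>, every
    \<open>\<theta> (- real n)\<close> would keep mass at least \<open>e * measure M B\<close>,
    although these masses tend to 0.\<close>
  have ae_inf: "AE x in M. \<exists>n::nat. r (of_rat (- of_nat n)) x < e" if e: "e > 0" for e
  proof -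
    define B where "B = {x \<in> space M. \<forall>n::nat. e \<le> r (of_rat (- of_nat n)) x}"
    have [measurable]: "B \<in> sets M" unfolding B_def by measurable
    have *: "e * measure M B \<le> measure (\<theta> (- real n)) (space M)" for n
    proof -
      have "e * measure M B = (LINT x:B|M. e)" by (simp add: lc)
      also have "\<dots> \<le> (LINT x:B|M. r (- real n) x)"
        by (rule set_integral_mono[OF sc si]) (auto simp: B_def of_rat_minus)
      also have "\<dots> = measure (\<theta> (- real n)) B" by (rule r(3)) simp
      also have "\<dots> \<le> measure (\<theta> (- real n)) (space M)"
        using finite_measure.bounded_measure[OF fin] sp by metis
      finally show ?thesis .
    qed
    have "filterlim (\<lambda>n. - real n) at_bot sequentially"
      by (rule filterlim_uminus_at_top[THEN iffD1, OF filterlim_real_sequentially])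
    then have "(\<lambda>n. measure (\<theta> (- real n)) (space M)) \<longlonglongrightarrow> 0" by (rule filterlim_compose[OF bot])
    then have "e * measure M B \<le> 0" by (rule LIMSEQ_le_const) (use * in auto)
    then have "measure M B = 0" using e measure_nonneg[of M B] by (simp add: mult_le_0_iff)
    then have "emeasure M B = 0" by (simp add: emeasure_eq_measure)
    then show ?thesis by (intro AE_I[of _ _ B]) (auto simp: B_def not_less)
  qed
  \<comment> \<open>The same argument for the remainder of \<open>M\<close> after removing
    \<open>\<theta> (real n)\<close>, whose mass also tends to 0; its part in \<open>B\<close> is
    controlled by \<open>measure_diff_le\<close>.\<close>
  have ae_sup: "AE x in M. \<exists>n::nat. 1 - e < r (of_rat (of_nat n)) x" if e: "e > 0" for e
  proof -
    define B where "B = {x \<in> space M. \<forall>n::nat. r (of_rat (of_nat n)) x \<le> 1 - e}"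
    have [measurable]: "B \<in> sets M" unfolding B_def by measurable
    have *: "e * measure M B \<le> 1 - measure (\<theta> (real n)) (space M)" for n
    proof -
      have "measure (\<theta> (real n)) B = (LINT x:B|M. r (real n) x)" by (rule r(3)[symmetric]) simp
      also have "\<dots> \<le> (LINT x:B|M. 1 - e)"
        by (rule set_integral_mono[OF si sc]) (auto simp: B_def)
      also have "\<dots> = (1 - e) * measure M B" by (simp add: lc)
      finally have "e * measure M B \<le> measure M B - measure (\<theta> (real n)) B" by (simp add: algebra_simps)
      also have "\<dots> \<le> measure M (space M) - measure (\<theta> (real n)) (space M)"
        by (rule measure_diff_le) (simp_all add: sets fin mle)
      finally show ?thesis by (simp add: prob_space)
    qed
    have "(\<lambda>n. 1 - measure (\<theta> (real n)) (space M)) \<longlonglongrightarrow> 1 - 1"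
      by (intro tendsto_intros filterlim_compose[OF top filterlim_real_sequentially])
    then have "e * measure M B \<le> 1 - 1" by (rule LIMSEQ_le_const) (use * in auto)
    then have "measure M B = 0" using e measure_nonneg[of M B] by (simp add: mult_le_0_iff)
    then have "emeasure M B = 0" by (simp add: emeasure_eq_measure)
    then show ?thesis by (intro AE_I[of _ _ B]) (auto simp: B_def not_less)
  qed
  \<comment> \<open>The densities are compatible almost everywhere only for countably many indices, so the kernel is
    read off from the rational ones.\<close>
  define good where "good x \<longleftrightarrow> (\<forall>q::rat. r (of_rat q) x \<le> 1) \<and>
    (\<forall>q q'::rat. q \<le> q' \<longrightarrow> r (of_rat q) x \<le> r (of_rat q') x) \<and>
    (\<forall>k::nat. \<exists>n::nat. r (of_rat (- of_nat n)) x < inverse (real (Suc k))) \<and>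
    (\<forall>k::nat. \<exists>n::nat. 1 - inverse (real (Suc k)) < r (of_rat (of_nat n)) x)" for x
  have [measurable]: "Measurable.pred M good" unfolding good_def by measurable
  have ae_good: "AE x in M. good x"
    unfolding good_def AE_conj_iff AE_all_countable
    by (intro conjI allI ae_one ae_inf ae_sup AE_impI ae_mono) (auto simp: of_rat_less_eq)
  define h where "h u x = (INF q\<in>{q. u < of_rat q}. r (of_rat q) x)" for u :: real and x
  have [measurable]: "h u \<in> borel_measurable M" for u unfolding h_def by measurable
  have h: "u \<le> v \<Longrightarrow> h u x \<le> h v x" "continuous (at_right u) (\<lambda>u. h u x)"
    "((\<lambda>u. h u x) \<longlongrightarrow> 0) at_bot" "((\<lambda>u. h u x) \<longlongrightarrow> 1) at_top" "0 \<le> h u x" "h u x \<le> 1"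
    "u < of_rat q \<Longrightarrow> h u x \<le> r (of_rat q) x" if "good x" for u v x q
  proof -
    have g: "0 \<le> r (of_rat q) x" "r (of_rat q) x \<le> 1" "q \<le> q' \<Longrightarrow> r (of_rat q) x \<le> r (of_rat q') x" for q q'
      using that r(2) by (auto simp: good_def)
    have g': "\<exists>q. r (of_rat q) x < e" "\<exists>q. 1 - e < r (of_rat q) x" if e: "e > 0" for e
    proof -
      obtain k where k: "inverse (real (Suc k)) < e" using reals_Archimedean[OF e] by blast
      obtain n m where "r (of_rat (- of_nat n)) x < inverse (real (Suc k))" "1 - inverse (real (Suc k)) < r (of_rat (of_nat m)) x"
        using \<open>good x\<close> unfolding good_def by blast
      then have "r (of_rat (- of_nat n)) x < e" "1 - e < r (of_rat (of_nat m)) x" using k by linarith+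
      then show "\<exists>q. r (of_rat q) x < e" "\<exists>q. 1 - e < r (of_rat q) x" by blast+
    qed
    note ext = rational_cdf_extension[of "\<lambda>q. r (of_rat q) x", OF g(1) g(2) g(3) g'(1) g'(2), folded h_def]
    show "u \<le> v \<Longrightarrow> h u x \<le> h v x" "continuous (at_right u) (\<lambda>u. h u x)"
      "((\<lambda>u. h u x) \<longlongrightarrow> 0) at_bot" "((\<lambda>u. h u x) \<longlongrightarrow> 1) at_top" "0 \<le> h u x" "h u x \<le> 1"
      "u < of_rat q \<Longrightarrow> h u x \<le> r (of_rat q) x"
      by - ((rule ext; assumption) | rule ext)+
  qed
  \<comment> \<open>The point mass at 0 is an arbitrary choice on a null set that keeps every
    \<open>L x\<close> a probability measure.\<close>
  define L where "L x = (if good x then interval_measure (\<lambda>u. h u x) else return borel 0)" for x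
  have L_Iic: "emeasure (L x) {..u} = ennreal (if good x then h u x else indicator {..u} 0)" for x u
    by (auto simp: L_def emeasure_interval_measure_Iic h split: split_indicator)
  have L: "L \<in> M \<rightarrow>\<^sub>M prob_algebra borel"
  proof (rule measurable_prob_algebra_generated)
    show "sets borel = sigma_sets UNIV (range (atMost :: real \<Rightarrow> _))" by (simp add: borel_eq_atMost)
    show "Int_stable (range atMost :: real set set)" by (auto simp: Int_stable_def)
    show "prob_space (L x)" for x
      unfolding L_def using real_distribution_interval_measure[OF h(1-4)]
      by (auto simp: real_distribution_def intro: prob_space_return)
    show "sets (L x) = sets borel" for x by (simp add: L_def)
    show "(\<lambda>x. emeasure (L x) A) \<in> borel_measurable M" if "A \<in> range atMost" for A
      using that by (auto simp: L_Iic)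
  qed simp
  \<comment> \<open>One inequality holds because \<open>r u\<close> lies below all rational
    densities above \<open>u\<close>. For the other, a rational between \<open>u\<close> and
    \<open>v\<close> bounds the integral by \<open>\<theta> v\<close>, and \<open>v\<close> tends to
    \<open>u\<close> from the right.\<close>
  have main: "measure (\<theta> u) A = (LINT x:A|M. h u x)" if A: "A \<in> sets M" for u A
  proof (rule antisym)
    have int: "integrable M (h u)"
      by (rule integrable_const_bound[where B = 1]) (use ae_good in \<open>eventually_elim, use h in auto\<close>, measurable)
    then have sh: "set_integrable M A (h u)"
      unfolding set_integrable_def by (intro integrable_mult_indicator A)
    have "AE x in M. \<forall>q::rat. u < of_rat q \<longrightarrow> r u x \<le> r (of_rat q) x"
      unfolding AE_all_countable by (intro allI AE_impI ae_mono) simp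
    then have "AE x in M. r u x \<le> h u x"
    proof eventually_elim
      fix x assume "\<forall>q::rat. u < of_rat q \<longrightarrow> r u x \<le> r (of_rat q) x"
      moreover have "{q. u < of_rat q} \<noteq> {}" using of_rat_dense[of u "u + 1"] by auto
      ultimately show "r u x \<le> h u x" unfolding h_def by (intro cINF_greatest) auto
    qed
    then have "(LINT x:A|M. r u x) \<le> (LINT x:A|M. h u x)"
      by (intro set_integral_mono_AE si sh A) (auto elim: eventually_mono)
    then show "measure (\<theta> u) A \<le> (LINT x:A|M. h u x)" by (simp add: r(3)[OF A])
    have *: "(LINT x:A|M. h u x) \<le> measure (\<theta> u) A + (measure (\<theta> v) (space M) - measure (\<theta> u) (space M))"
      if "u < v" for v
    proof -
      obtain q where q: "u < of_rat q" "of_rat q < v" using of_rat_dense \<open>u < v\<close> by blast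
      have "(LINT x:A|M. h u x) \<le> (LINT x:A|M. r (of_rat q) x)"
        by (intro set_integral_mono_AE si sh A) (use ae_good q h(7) in \<open>auto elim: eventually_mono\<close>)
      also have "\<dots> = measure (\<theta> (of_rat q)) A" by (rule r(3)[OF A])
      also have "\<dots> \<le> measure (\<theta> v) A" using mle(2)[OF A] q by simp
      finally have "(LINT x:A|M. h u x) \<le> measure (\<theta> v) A" .
      moreover have "measure (\<theta> v) A - measure (\<theta> u) A \<le> measure (\<theta> v) (space (\<theta> v)) - measure (\<theta> u) (space (\<theta> v))"
        by (rule finite_measure.measure_diff_le[OF fin]) (use sets fin mle(2) A \<open>u < v\<close> in auto)
      ultimately show ?thesis by (simp add: sp)
    qed
    show "(LINT x:A|M. h u x) \<le> measure (\<theta> u) A"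
    proof (rule tendsto_lowerbound)
      have "((\<lambda>v. measure (\<theta> v) (space M)) \<longlongrightarrow> measure (\<theta> u) (space M)) (at_right u)"
        using rc[of u] by (simp add: continuous_within)
      then have "((\<lambda>v. measure (\<theta> u) A + (measure (\<theta> v) (space M) - measure (\<theta> u) (space M)))
         \<longlongrightarrow> measure (\<theta> u) A + (measure (\<theta> u) (space M) - measure (\<theta> u) (space M))) (at_right u)"
        by (intro tendsto_intros)
      then show "((\<lambda>v. measure (\<theta> u) A + (measure (\<theta> v) (space M) - measure (\<theta> u) (space M)))
         \<longlongrightarrow> measure (\<theta> u) A) (at_right u)" by simp
      show "\<forall>\<^sub>F v in at_right u. (LINT x:A|M. h u x) \<le> measure (\<theta> u) A + (measure (\<theta> v) (space M) - measure (\<theta> u) (space M))"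
        unfolding eventually_at_filter by (rule always_eventually) (use * in auto)
    qed simp
  qed
  show ?thesis
  proof (intro bexI[of _ L] L allI ballI)
    fix u A assume A: "A \<in> sets M"
    have "emeasure (\<theta> u) A = ennreal (LINT x:A|M. h u x)"
      using main[OF A] finite_measure.emeasure_eq_measure[OF fin] by simp
    \<comment> \<open>Clamping to the unit interval changes nothing at good points and makes the
      integrand nonnegative and bounded everywhere.\<close>
    also have "\<dots> = ennreal (\<integral>x. indicator A x * max 0 (min 1 (h u x)) \<partial>M)"
      unfolding set_lebesgue_integral_def
      by (intro arg_cong[where f = ennreal] integral_cong_AE) (use ae_good A h(5,6) in \<open>auto elim!: eventually_mono\<close>)
    also have "\<dots> = (\<integral>\<^sup>+x. ennreal (indicator A x * max 0 (min 1 (h u x))) \<partial>M)"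
      by (rule nn_integral_eq_integral[symmetric])
        (use A in \<open>auto intro!: integrable_const_bound[where B = 1] split: split_indicator\<close>)
    also have "\<dots> = (\<integral>\<^sup>+x. emeasure (L x) {..u} * indicator A x \<partial>M)"
      by (rule nn_integral_cong_AE)
        (use ae_good h(5,6) in \<open>auto simp: L_Iic split: split_indicator elim!: eventually_mono\<close>)
    finally show "emeasure (\<theta> u) A = (\<integral>\<^sup>+x. emeasure (L x) {..u} * indicator A x \<partial>M)" .
  qed
qed

section \<open>Measures on the plane built from kernels\<close>

lemma measure_eqI_Iic_prod:
  fixes M N :: "(real \<times> real) measure"
  assumes M: "sets M = sets borel" "finite_measure M" and N: "sets N = sets borel"
    and eq: "\<And>a b. emeasure M ({..a} \<times> {..b}) = emeasure N ({..a} \<times> {..b})"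
  shows "M = N"
proof (rule measure_eqI_generator_eq[where \<Omega> = UNIV and E = "range (\<lambda>p::real \<times> real. {..p})"])
  interpret finite_measure M by fact
  have Iic: "{..(a, b)} = {..a} \<times> {..b}" for a b :: real by auto
  show "Int_stable (range (\<lambda>p::real \<times> real. {..p}))"
  proof (rule Int_stableI)
    fix A B :: "(real \<times> real) set" assume "A \<in> range atMost" "B \<in> range atMost"
    then obtain a b c d where "A = {..(a, b)}" "B = {..(c, d)}" by fastforce
    then have "A \<inter> B = {..(min a c, min b d)}" unfolding Iic by auto
    then show "A \<inter> B \<in> range atMost" by simp
  qed
  have gen: "sets (borel :: (real \<times> real) measure) = sigma_sets UNIV (range atMost)"
    by (simp add: borel_eq_atMost)
  show "sets M = sigma_sets UNIV (range atMost)" "sets N = sigma_sets UNIV (range atMost)"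
    using M N gen by auto
  show "emeasure M X = emeasure N X" if "X \<in> range atMost" for X
    using that by (auto simp: Iic eq)
  show "range (\<lambda>i::nat. {..(real i, real i)}) \<subseteq> range atMost" by auto
  show "(\<Union>i::nat. {..(real i, real i)}) = UNIV"
  proof -
    have "\<exists>i::nat. p \<le> (real i, real i)" for p
    proof -
      obtain i where "max (fst p) (snd p) \<le> real i" using real_arch_simple by blast
      then show ?thesis by (intro exI[of _ i]) (simp add: less_eq_prod_def)
    qed
    then show ?thesis by auto
  qed
  show "emeasure M {..(real i, real i)} \<noteq> \<infinity>" for i using emeasure_finite by simp
qed auto

lemma borel_rectangle [measurable]:
  fixes A B :: "real set"
  assumes "A \<in> sets borel" "B \<in> sets borel" shows "A \<times> B \<in> sets borel"
  using assms borel_Times by blast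

text \<open>The semidirect product of \<open>\<mu>\<close> and \<open>K\<close>, formed by
  \<open>bind\<close> so that it carries the Borel sets of the plane and inherits the iterated
  integral formula.\<close>

definition kernel_plan :: "real measure \<Rightarrow> (real \<Rightarrow> real measure) \<Rightarrow> (real \<times> real) measure" where
  "kernel_plan \<mu> K = \<mu> \<bind> (\<lambda>x. distr (K x) borel (Pair x))"

lemma
  assumes \<mu>: "sets \<mu> = sets borel" and K: "K \<in> borel \<rightarrow>\<^sub>M prob_algebra borel"
  shows sets_kernel_plan: "sets (kernel_plan \<mu> K) = sets borel"
    and nn_integral_kernel_plan: "\<And>f. f \<in> borel_measurable borel \<Longrightarrow>
      (\<integral>\<^sup>+p. f p \<partial>kernel_plan \<mu> K) = (\<integral>\<^sup>+x. \<integral>\<^sup>+y. f (x, y) \<partial>K x \<partial>\<mu>)"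
    and emeasure_kernel_plan: "\<And>A. A \<in> sets borel \<Longrightarrow>
      emeasure (kernel_plan \<mu> K) A = (\<integral>\<^sup>+x. emeasure (K x) {y. (x, y) \<in> A} \<partial>\<mu>)"
proof -
  have K'[measurable]: "K \<in> borel \<rightarrow>\<^sub>M subprob_algebra borel" using K by (rule measurable_prob_algebraD)
  have sK: "sets (K x) = sets borel" "space (K x) = UNIV" for x
    using measurable_space[OF K', of x] sets_eq_imp_space_eq[of "K x" borel] by (auto simp: space_subprob_algebra)
  have D: "(\<lambda>x. distr (K x) borel (Pair x)) \<in> \<mu> \<rightarrow>\<^sub>M subprob_algebra (borel :: (real \<times> real) measure)"
    unfolding measurable_cong_sets[OF \<mu> refl]
    by (rule measurable_distr2[OF _ K']) (simp add: borel_prod[symmetric])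
  have sp: "space \<mu> \<noteq> {}" using sets_eq_imp_space_eq[OF \<mu>] by simp
  show s: "sets (kernel_plan \<mu> K) = sets borel"
    unfolding kernel_plan_def by (rule sets_bind) (use sp in auto)
  have Px: "Pair x \<in> K x \<rightarrow>\<^sub>M (borel :: (real \<times> real) measure)" for x
    unfolding measurable_cong_sets[OF sK(1) refl] by (simp add: borel_prod[symmetric])
  show nn: "(\<integral>\<^sup>+p. f p \<partial>kernel_plan \<mu> K) = (\<integral>\<^sup>+x. \<integral>\<^sup>+y. f (x, y) \<partial>K x \<partial>\<mu>)" if f: "f \<in> borel_measurable borel" for f
    unfolding kernel_plan_def nn_integral_bind[OF f D]
    by (rule nn_integral_cong) (simp add: nn_integral_distr[OF Px] f)
  show "emeasure (kernel_plan \<mu> K) A = (\<integral>\<^sup>+x. emeasure (K x) {y. (x, y) \<in> A} \<partial>\<mu>)" if A: "A \<in> sets borel" for A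
    unfolding kernel_plan_def emeasure_bind[OF sp D A]
    by (simp only: emeasure_distr[OF Px A] sK vimage_def Int_UNIV_right)
qed

lemma prob_space_kernel_plan:
  assumes \<mu>: "sets \<mu> = sets borel" "prob_space \<mu>" and K: "K \<in> borel \<rightarrow>\<^sub>M prob_algebra borel"
  shows "prob_space (kernel_plan \<mu> K)"
proof
  have "prob_space (K x)" "space (K x) = UNIV" for x
    using measurable_space[OF K, of x] sets_eq_imp_space_eq[of "K x" borel] by (auto simp: space_prob_algebra)
  then have one: "emeasure (K x) UNIV = 1" for x by (metis prob_space.emeasure_space_1)
  have "space (kernel_plan \<mu> K) = UNIV" using sets_eq_imp_space_eq[OF sets_kernel_plan[OF \<mu>(1) K]] by simp
  then show "emeasure (kernel_plan \<mu> K) (space (kernel_plan \<mu> K)) = 1"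
    using emeasure_kernel_plan[OF \<mu>(1) K, of UNIV] prob_space.emeasure_space_1[OF \<mu>(2)] by (simp add: one)
qed

text \<open>Turns the setwise formula into an equation between measures, after which iterated
  integrals of nonnegative functions are available.\<close>

lemma is_disintegration_iff_kernel_plan:
  assumes "sets \<mu> = sets borel" "sets \<pi> = sets borel"
  shows "is_disintegration \<mu> \<pi> K \<longleftrightarrow> K \<in> borel \<rightarrow>\<^sub>M prob_algebra borel \<and> \<pi> = kernel_plan \<mu> K"
proof (cases "K \<in> borel \<rightarrow>\<^sub>M prob_algebra borel")
  case True
  have "\<pi> = kernel_plan \<mu> K \<longleftrightarrow>
    (\<forall>A\<in>sets borel. emeasure \<pi> A = (\<integral>\<^sup>+x. emeasure (K x) {y. (x, y) \<in> A} \<partial>\<mu>))"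
    (is "_ \<longleftrightarrow> ?R")
  proof
    assume ?R
    then show "\<pi> = kernel_plan \<mu> K"
      by (intro measure_eqI) (simp_all add: emeasure_kernel_plan[OF assms(1) True] sets_kernel_plan[OF assms(1) True] assms(2))
  qed (simp add: emeasure_kernel_plan[OF assms(1) True])
  with True show ?thesis unfolding is_disintegration_def by blast
qed (simp add: is_disintegration_def)

lemma emeasure_section_restriction:
  fixes \<pi> :: "(real \<times> real) measure"
  assumes \<pi>: "sets \<pi> = sets borel" and S: "S \<in> sets borel" and p: "p \<in> borel \<rightarrow>\<^sub>M (borel :: real measure)"
    and B: "B \<in> sets borel"
  shows "emeasure (distr (density \<pi> (indicator S)) borel p) B = emeasure \<pi> (S \<inter> p -` B)"
proof -
  note p[measurable] S[measurable] B[measurable]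
  have sp: "space \<pi> = UNIV" using sets_eq_imp_space_eq[OF \<pi>] by simp
  have p': "p \<in> density \<pi> (indicator S) \<rightarrow>\<^sub>M borel" using p \<pi> by (simp cong: measurable_cong_sets)
  have pB: "p -` B \<in> sets borel" using measurable_sets[OF p B] by simp
  have "emeasure (distr (density \<pi> (indicator S)) borel p) B = emeasure (density \<pi> (indicator S)) (p -` B)"
    by (subst emeasure_distr[OF p' B]) (simp add: sp)
  also have "\<dots> = (\<integral>\<^sup>+x. indicator S x * indicator (p -` B) x \<partial>\<pi>)"
    by (rule emeasure_density) (use pB S \<pi> in auto)
  also have "\<dots> = (\<integral>\<^sup>+x. indicator (S \<inter> p -` B) x \<partial>\<pi>)"
    by (rule nn_integral_cong) (auto split: split_indicator)
  also have "\<dots> = emeasure \<pi> (S \<inter> p -` B)" by (rule nn_integral_indicator) (use pB S \<pi> in auto)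
  finally show ?thesis .
qed

lemma marginal_emeasure:
  fixes \<pi> :: "(real \<times> real) measure"
  assumes \<pi>: "sets \<pi> = sets borel" and B: "B \<in> sets borel"
  shows "emeasure (distr \<pi> borel fst) B = emeasure \<pi> (B \<times> UNIV)"
    "emeasure (distr \<pi> borel snd) B = emeasure \<pi> (UNIV \<times> B)"
proof -
  have sp: "space \<pi> = UNIV" using sets_eq_imp_space_eq[OF \<pi>] by simp
  have m: "fst \<in> \<pi> \<rightarrow>\<^sub>M borel" "snd \<in> \<pi> \<rightarrow>\<^sub>M borel"
    unfolding measurable_cong_sets[OF \<pi> refl] by (simp_all add: borel_prod[symmetric])
  show "emeasure (distr \<pi> borel fst) B = emeasure \<pi> (B \<times> UNIV)"
    "emeasure (distr \<pi> borel snd) B = emeasure \<pi> (UNIV \<times> B)"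
    using m by (auto simp: emeasure_distr B sp intro!: arg_cong2[where f = emeasure])
qed

lemma fst_snd_borel [measurable]:
  "fst \<in> (borel :: (real \<times> real) measure) \<rightarrow>\<^sub>M borel" "snd \<in> (borel :: (real \<times> real) measure) \<rightarrow>\<^sub>M borel"
  by (simp_all add: borel_prod[symmetric])

text \<open>The mass of \<open>\<pi>\<close> that lands in \<open>{..t}\<close>, viewed by its
  starting point, increases with \<open>t\<close> and is dominated by the first marginal. Its
  densities are the distribution functions of the kernel, and the two plans agree on
  quadrants.\<close>

lemma disintegration_exists:
  fixes \<pi> :: "(real \<times> real) measure"
  assumes \<pi>: "sets \<pi> = sets borel" "prob_space \<pi>"
  shows "\<exists>K. is_disintegration (distr \<pi> borel fst) \<pi> K"
proof -
  interpret \<pi>: prob_space \<pi> by fact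
  define \<mu> where "\<mu> = distr \<pi> borel fst"
  have sp\<pi>: "space \<pi> = UNIV" using sets_eq_imp_space_eq[OF \<pi>(1)] by simp
  have s\<mu>[simp]: "sets \<mu> = sets borel" "space \<mu> = UNIV" by (simp_all add: \<mu>_def)
  have "fst \<in> \<pi> \<rightarrow>\<^sub>M borel" using fst_snd_borel(1) \<pi>(1) by (simp cong: measurable_cong_sets)
  then interpret \<mu>: prob_space \<mu> unfolding \<mu>_def by (rule \<pi>.prob_space_distr)
  define \<theta> where "\<theta> t = distr (density \<pi> (indicator (UNIV \<times> {..t}))) borel fst" for t
  have \<theta>: "emeasure (\<theta> t) A = emeasure \<pi> (A \<times> {..t})" if "A \<in> sets borel" for t A
    unfolding \<theta>_def by (subst emeasure_section_restriction) (use that \<pi> in \<open>auto intro!: arg_cong2[where f = emeasure]\<close>)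
  have \<mu>e: "emeasure \<mu> A = emeasure \<pi> (A \<times> UNIV)" if "A \<in> sets borel" for A
    unfolding \<mu>_def by (rule marginal_emeasure(1)[OF \<pi>(1) that])
  have msnd: "snd \<in> \<pi> \<rightarrow>\<^sub>M borel" using fst_snd_borel(2) \<pi>(1) by (simp cong: measurable_cong_sets)
  interpret \<nu>: real_distribution "distr \<pi> borel snd" by (rule \<pi>.real_distribution_distr[OF msnd])
  have cdf: "measure (\<theta> t) UNIV = cdf (distr \<pi> borel snd) t" for t
    using \<theta>[of UNIV t] marginal_emeasure(2)[OF \<pi>(1), of "{..t}"] by (simp add: cdf_def measure_def)
  have "\<exists>L \<in> \<mu> \<rightarrow>\<^sub>M prob_algebra borel. \<forall>u. \<forall>A\<in>sets \<mu>.
    emeasure (\<theta> u) A = (\<integral>\<^sup>+y. emeasure (L y) {..u} * indicator A y \<partial>\<mu>)"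
  proof (rule \<mu>.kernel_of_increasing_family)
    show "sets (\<theta> u) = sets \<mu>" for u by (simp add: \<theta>_def)
    show "emeasure (\<theta> u) A \<le> emeasure \<mu> A" if "A \<in> sets \<mu>" for u A
      using that by (auto simp: \<theta> \<mu>e \<pi> intro!: emeasure_mono)
    show "emeasure (\<theta> u) A \<le> emeasure (\<theta> v) A" if "u \<le> v" "A \<in> sets \<mu>" for u v A
      using that by (auto simp: \<theta> \<pi> intro!: emeasure_mono)
  qed (use \<nu>.cdf_is_right_cont \<nu>.cdf_lim_at_bot \<nu>.cdf_lim_at_top_prob in \<open>simp_all add: cdf\<close>)
  then obtain K where K: "K \<in> \<mu> \<rightarrow>\<^sub>M prob_algebra borel"
    "\<And>u A. A \<in> sets borel \<Longrightarrow> emeasure (\<theta> u) A = (\<integral>\<^sup>+y. emeasure (K y) {..u} * indicator A y \<partial>\<mu>)"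
    unfolding s\<mu>(1) by blast
  have K': "K \<in> borel \<rightarrow>\<^sub>M prob_algebra borel" using K(1) by (simp cong: measurable_cong_sets)
  have "\<pi> = kernel_plan \<mu> K"
  proof (rule measure_eqI_Iic_prod)
    fix a b
    have "emeasure \<pi> ({..a} \<times> {..b}) = (\<integral>\<^sup>+y. emeasure (K y) {..b} * indicator {..a} y \<partial>\<mu>)"
      using \<theta>[of "{..a}" b] K(2)[of "{..a}" b] by simp
    also have "\<dots> = (\<integral>\<^sup>+x. emeasure (K x) {y. (x, y) \<in> {..a} \<times> {..b}} \<partial>\<mu>)"
      by (rule nn_integral_cong) (auto split: split_indicator simp: atMost_def)
    also have "\<dots> = emeasure (kernel_plan \<mu> K) ({..a} \<times> {..b})"
      by (rule emeasure_kernel_plan[symmetric]) (use K' in auto)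
    finally show "emeasure \<pi> ({..a} \<times> {..b}) = emeasure (kernel_plan \<mu> K) ({..a} \<times> {..b})" .
  qed (use \<pi> sets_kernel_plan[OF s\<mu>(1) K'] \<pi>.finite_measure_axioms in auto)
  then show ?thesis using is_disintegration_iff_kernel_plan[OF s\<mu>(1) \<pi>(1), of K] K' unfolding \<mu>_def by auto
qed

text \<open>The kernel obtained from the family runs backwards: \<open>L y\<close> is the law of the
  starting point given the landing point \<open>y\<close>. The semidirect product with
  \<open>\<nu>\<close> therefore has its coordinates exchanged, which \<open>sw\<close>
  corrects.\<close>

lemma plan_of_increasing_family:
  fixes \<nu> :: "real measure" and \<theta> :: "real \<Rightarrow> real measure"
  assumes \<nu>: "sets \<nu> = sets borel" "prob_space \<nu>"
    and sets: "\<And>u. sets (\<theta> u) = sets borel"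
    and le: "\<And>u A. A \<in> sets borel \<Longrightarrow> emeasure (\<theta> u) A \<le> emeasure \<nu> A"
    and mono: "\<And>u v A. u \<le> v \<Longrightarrow> A \<in> sets borel \<Longrightarrow> emeasure (\<theta> u) A \<le> emeasure (\<theta> v) A"
    and rc: "\<And>u. continuous (at_right u) (\<lambda>u. measure (\<theta> u) UNIV)"
    and bot: "((\<lambda>u. measure (\<theta> u) UNIV) \<longlongrightarrow> 0) at_bot"
    and top: "((\<lambda>u. measure (\<theta> u) UNIV) \<longlongrightarrow> 1) at_top"
  shows "\<exists>\<pi>. sets \<pi> = sets borel \<and> prob_space \<pi> \<and> distr \<pi> borel snd = \<nu> \<and>
    (\<forall>u. \<forall>B\<in>sets borel. emeasure \<pi> ({..u} \<times> B) = emeasure (\<theta> u) B)"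
proof -
  interpret \<nu>: prob_space \<nu> by fact
  have sp: "space \<nu> = UNIV" using sets_eq_imp_space_eq[OF \<nu>(1)] by simp
  have "\<exists>L \<in> \<nu> \<rightarrow>\<^sub>M prob_algebra borel. \<forall>u. \<forall>A\<in>sets \<nu>.
    emeasure (\<theta> u) A = (\<integral>\<^sup>+y. emeasure (L y) {..u} * indicator A y \<partial>\<nu>)"
    by (rule \<nu>.kernel_of_increasing_family) (use assms sp in \<open>simp_all\<close>)
  then obtain L where L: "L \<in> \<nu> \<rightarrow>\<^sub>M prob_algebra borel"
    "\<And>u A. A \<in> sets borel \<Longrightarrow> emeasure (\<theta> u) A = (\<integral>\<^sup>+y. emeasure (L y) {..u} * indicator A y \<partial>\<nu>)"
    unfolding \<nu>(1) by blast
  have L': "L \<in> borel \<rightarrow>\<^sub>M prob_algebra borel" using L(1) \<nu> by (simp cong: measurable_cong_sets)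
  have LU: "emeasure (L y) UNIV = 1" for y
  proof -
    have "prob_space (L y)" "sets (L y) = sets borel" using measurable_space[OF L', of y] by (auto simp: space_prob_algebra)
    then show ?thesis using prob_space.emeasure_space_1 sets_eq_imp_space_eq by (metis space_borel)
  qed
  define \<rho> where "\<rho> = kernel_plan \<nu> L"
  have s\<rho>: "sets \<rho> = sets borel" unfolding \<rho>_def by (rule sets_kernel_plan[OF \<nu>(1) L'])
  interpret \<rho>: prob_space \<rho> unfolding \<rho>_def by (rule prob_space_kernel_plan[OF \<nu> L'])
  define sw where "sw p = (snd p, fst p)" for p :: "real \<times> real"
  have sw: "sw \<in> \<rho> \<rightarrow>\<^sub>M borel"
    unfolding measurable_cong_sets[OF s\<rho> refl] sw_def borel_prod[symmetric] by simp
  define \<pi> where "\<pi> = distr \<rho> borel sw"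
  have \<pi>e: "emeasure \<pi> (A \<times> B) = (\<integral>\<^sup>+y. emeasure (L y) A * indicator B y \<partial>\<nu>)" if "A \<in> sets borel" "B \<in> sets borel" for A B
  proof -
    have "emeasure \<pi> (A \<times> B) = emeasure \<rho> (sw -` (A \<times> B) \<inter> space \<rho>)"
      unfolding \<pi>_def by (rule emeasure_distr[OF sw]) (use that in auto)
    also have "sw -` (A \<times> B) \<inter> space \<rho> = B \<times> A"
      using sets_eq_imp_space_eq[OF s\<rho>] by (auto simp: sw_def)
    also have "emeasure \<rho> (B \<times> A) = (\<integral>\<^sup>+x. emeasure (L x) {y. (x, y) \<in> B \<times> A} \<partial>\<nu>)"
      unfolding \<rho>_def by (rule emeasure_kernel_plan[OF \<nu>(1) L']) (use that in auto)
    also have "\<dots> = (\<integral>\<^sup>+y. emeasure (L y) A * indicator B y \<partial>\<nu>)"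
      by (rule nn_integral_cong) (auto split: split_indicator)
    finally show ?thesis .
  qed
  have s\<pi>: "sets \<pi> = sets borel" by (simp add: \<pi>_def)
  have "distr \<pi> borel snd = \<nu>"
  proof (rule measure_eqI)
    fix B :: "real set" assume "B \<in> sets (distr \<pi> borel snd)"
    then have B: "B \<in> sets borel" by simp
    have "emeasure (distr \<pi> borel snd) B = (\<integral>\<^sup>+y. indicator B y \<partial>\<nu>)"
      unfolding marginal_emeasure(2)[OF s\<pi> B] \<pi>e[OF _ B, of UNIV, simplified] LU by simp
    then show "emeasure (distr \<pi> borel snd) B = emeasure \<nu> B" using B \<nu> by simp
  qed (simp add: \<nu>)
  moreover have "prob_space \<pi>" unfolding \<pi>_def by (rule \<rho>.prob_space_distr[OF sw])
  ultimately show ?thesis using s\<pi> \<pi>e[of "{..u}" B for u B] L(2) by (intro exI[of _ \<pi>]) auto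
qed

subsection \<open>Shadows\<close>

lemma ext_integral_eq_integral:
  assumes "integrable \<mu> f" shows "ext_integral \<mu> f = ereal (\<integral>x. f x \<partial>\<mu>)"
proof -
  have "(\<integral>\<^sup>+x. ennreal (norm (f x)) \<partial>\<mu>) < \<infinity>" using assms by (simp add: integrable_iff_bounded)
  moreover have "(\<integral>\<^sup>+x. ennreal (f x) \<partial>\<mu>) \<le> (\<integral>\<^sup>+x. ennreal (norm (f x)) \<partial>\<mu>)"
    "(\<integral>\<^sup>+x. ennreal (- f x) \<partial>\<mu>) \<le> (\<integral>\<^sup>+x. ennreal (norm (f x)) \<partial>\<mu>)"
    by (auto intro!: nn_integral_mono ennreal_leI)
  ultimately have fin: "(\<integral>\<^sup>+x. ennreal (f x) \<partial>\<mu>) < \<infinity>" "(\<integral>\<^sup>+x. ennreal (- f x) \<partial>\<mu>) < \<infinity>"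
    by (auto elim: le_less_trans)
  have *: "enn2ereal a = ereal (enn2real a)" if "a < \<infinity>" for a
    using that by (cases a) (auto simp: enn2ereal_ennreal)
  show ?thesis
    unfolding ext_integral_def real_lebesgue_integral_def[OF assms] *[OF fin(1)] *[OF fin(2)] by simp
qed

text \<open>The identity and its negative as test functions give equal means, and the functions
  \<open>max 0 (t - y)\<close> of \<open>y\<close> compare the potentials. All of them are
  integrable, so the extended integrals are ordinary ones.\<close>

lemma convex_order_potential:
  assumes "\<mu> \<preceq>\<^sub>C \<nu>"
  shows "finite_first_moment \<mu>" "finite_first_moment \<nu>" "(\<integral>y. y \<partial>\<mu>) = (\<integral>y. y \<partial>\<nu>)"
    "potential \<mu> t \<le> potential \<nu> t"
proof -
  show m: "finite_first_moment \<mu>" and n: "finite_first_moment \<nu>" using assms by (auto simp: convex_order_def)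
  have le: "(\<integral>y. \<phi> y \<partial>\<mu>) \<le> (\<integral>y. \<phi> y \<partial>\<nu>)"
    if "convex_on UNIV \<phi>" "integrable \<mu> \<phi>" "integrable \<nu> \<phi>" for \<phi>
    using assms that by (auto simp: convex_order_def ext_integral_eq_integral)
  note int = finite_first_momentD(4)[OF m] finite_first_momentD(4)[OF n]
  have "(\<integral>y. y \<partial>\<mu>) \<le> (\<integral>y. y \<partial>\<nu>)"
    by (rule le) (use int convex_on_affine[of 0 1 0] in auto)
  moreover have "(\<integral>y. - y \<partial>\<mu>) \<le> (\<integral>y. - y \<partial>\<nu>)"
    by (rule le) (use int convex_on_affine[of 0 "-1" 0] in auto)
  ultimately show "(\<integral>y. y \<partial>\<mu>) = (\<integral>y. y \<partial>\<nu>)" by simp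
  have "convex_on UNIV (\<lambda>y. max 0 (t - y))"
    using convex_on_max[OF convex_on_affine[of 0 0 0] convex_on_affine[of t "-1" 0]] by simp
  then show "potential \<mu> t \<le> potential \<nu> t"
    unfolding potential_def by (intro le integrable_potential m n)
qed

text \<open>The second difference of the potential is the integral of a tent function that is
  positive exactly on the open interval.\<close>

lemma potential_affine_iff_null:
  assumes m: "finite_first_moment m" and s: "0 < s"
  shows "2 * potential m t = potential m (t - s) + potential m (t + s)
    \<longleftrightarrow> emeasure m {t - s<..<t + s} = 0"
proof -
  define tent where "tent y = max 0 (t - s - y) + max 0 (t + s - y) - 2 * max 0 (t - y)" for y
  note [simp] = integrable_potential[OF m]
  note mD = finite_first_momentD[OF m]
  have int: "integrable m tent" unfolding tent_def by simp
  have eq: "(\<integral>y. tent y \<partial>m) = potential m (t - s) + potential m (t + s) - 2 * potential m t"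
    unfolding tent_def potential_def by simp
  have pos: "0 \<le> tent y" for y using s by (auto simp: tent_def max_def)
  have "2 * potential m t = potential m (t - s) + potential m (t + s) \<longleftrightarrow> (\<integral>y. tent y \<partial>m) = 0"
    unfolding eq by auto
  also have "\<dots> \<longleftrightarrow> (AE y in m. tent y = 0)"
    by (rule integral_nonneg_eq_0_iff_AE[OF int]) (simp add: pos)
  also have "\<dots> \<longleftrightarrow> (AE y in m. y \<notin> {t - s<..<t + s})"
  proof -
    have "tent y = 0 \<longleftrightarrow> y \<notin> {t - s<..<t + s}" for y using s by (auto simp: tent_def max_def)
    then show ?thesis by simp
  qed
  also have "\<dots> \<longleftrightarrow> emeasure m {t - s<..<t + s} = 0"
    using mD(2,3) by (subst AE_iff_measurable[of "{t - s<..<t + s}"]) auto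
  finally show ?thesis .
qed

section \<open>Restrictions of a measure to a set\<close>

text \<open>A density keeps the whole line as underlying space, so restrictions to different sets
  are comparable Borel measures.\<close>

abbreviation restricted :: "real measure \<Rightarrow> real set \<Rightarrow> real measure" where
  "restricted m A \<equiv> density m (indicator A)"

lemma
  assumes m: "finite_first_moment m" and A[measurable]: "A \<in> sets borel"
  shows finite_first_moment_restricted: "finite_first_moment (restricted m A)"
    and measure_restricted: "measure (restricted m A) UNIV = measure m A"
    and integral_restricted: "\<And>f. f \<in> borel_measurable borel \<Longrightarrow>
      (\<integral>y. f y \<partial>restricted m A) = (\<integral>y. indicator A y * f y \<partial>m :: real)"
proof -
  note mD = finite_first_momentD[OF m]
  interpret finite_measure m by fact
  note mD(2)[measurable_cong]
  have d: "restricted m A = density m (\<lambda>y. ennreal (indicator A y))" by (simp add: ennreal_indicator)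
  have e: "emeasure (restricted m A) UNIV = emeasure m A"
    using mD(2,3) A by (subst emeasure_density) (auto simp: sets.top[of m, unfolded mD(3)])
  show "measure (restricted m A) UNIV = measure m A" by (simp add: measure_def e)
  have Am: "A \<in> sets m" using A mD(2) by simp
  have gm: "(indicator A :: real \<Rightarrow> real) \<in> borel_measurable m" using Am by simp
  have "integrable (restricted m A) (\<lambda>y. y)"
    unfolding d integrable_density[OF borel_measurable_integrable[OF mD(4)] gm AE_I2[OF indicator_pos_le]]
    by (rule integrable_mult_indicator[OF Am mD(4)])
  then show "finite_first_moment (restricted m A)"
    unfolding finite_first_moment_def using mD(2,3) e emeasure_finite by (auto intro!: finite_measureI)
  show "(\<integral>y. f y \<partial>restricted m A) = (\<integral>y. indicator A y * f y \<partial>m)" if "f \<in> borel_measurable borel" for f :: "real \<Rightarrow> real"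
  proof -
    have fm: "f \<in> borel_measurable m" using that mD(2) by (simp cong: measurable_cong_sets)
    show ?thesis unfolding d integral_density[OF fm gm AE_I2[OF indicator_pos_le]] by simp
  qed
qed

lemma potential_restricted:
  assumes m: "finite_first_moment m" and A[measurable]: "A \<in> sets borel"
  shows "potential (restricted m A) t = (\<integral>y. indicator A y * max 0 (t - y) \<partial>m)"
  unfolding potential_def by (rule integral_restricted[OF assms]) measurable

lemma restricted_disjoint_union:
  assumes m: "finite_first_moment m" and A: "A \<in> sets borel" and B: "B \<in> sets borel" and AB: "A \<inter> B = {}"
  shows "potential (restricted m (A \<union> B)) t = potential (restricted m A) t + potential (restricted m B) t"
    "(\<integral>y. y \<partial>restricted m (A \<union> B)) = (\<integral>y. y \<partial>restricted m A) + (\<integral>y. y \<partial>restricted m B)"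
    "measure m (A \<union> B) = measure m A + measure m B"
proof -
  note mD = finite_first_momentD[OF m]
  interpret finite_measure m by fact
  have ind: "indicator (A \<union> B) y = (indicator A y + indicator B y :: real)" for y
    using AB by (auto split: split_indicator)
  have int: "integrable m (\<lambda>y. indicator C y * f y)" if "C \<in> sets borel" "integrable m f" for C and f :: "real \<Rightarrow> real"
    using integrable_mult_indicator[of C m f] that mD(2) by simp
  show "potential (restricted m (A \<union> B)) t = potential (restricted m A) t + potential (restricted m B) t"
    using A B m by (simp add: potential_restricted ind distrib_right int integrable_potential)
  show "(\<integral>y. y \<partial>restricted m (A \<union> B)) = (\<integral>y. y \<partial>restricted m A) + (\<integral>y. y \<partial>restricted m B)"
    using A B by (simp add: integral_restricted[OF m, of _ "\<lambda>y. y"] ind distrib_right int[OF _ mD(4)])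
  show "measure m (A \<union> B) = measure m A + measure m B"
    by (rule finite_measure_Union) (use A B AB mD(2) in simp_all)
qed

lemma restricted_UNIV: "finite_first_moment m \<Longrightarrow> restricted m UNIV = m"
  using density_1[of m] by (simp add: indicator_def)

section \<open>Construction of the shadows\<close>

text \<open>\<open>\<theta> u\<close> is the shadow and \<open>\<sigma> u\<close> the rest of
  \<open>\<nu>\<close>. Their potentials are \<open>F u\<close> and \<open>C u\<close>, which add up
  to the potential of \<open>\<nu>\<close>; the mass and mean of \<open>\<theta> u\<close> come from
  the asymptote of \<open>F u\<close>.\<close>

lemma shadow_family_exists:
  assumes \<mu>: "borel_prob \<mu>" and \<nu>: "borel_prob \<nu>" and ord: "\<mu> \<preceq>\<^sub>C \<nu>"
  obtains \<theta> \<sigma> :: "real \<Rightarrow> real measure" where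
    "\<And>u. finite_first_moment (\<theta> u)" "\<And>u. finite_first_moment (\<sigma> u)"
    "\<And>u A. A \<in> sets borel \<Longrightarrow> emeasure \<nu> A = emeasure (\<theta> u) A + emeasure (\<sigma> u) A"
    "\<And>u. measure (\<theta> u) UNIV = measure \<mu> {..u}"
    "\<And>u. (\<integral>y. y \<partial>\<theta> u) = (\<integral>y. y \<partial>restricted \<mu> {..u})"
    "\<And>u t. potential (restricted \<mu> {..u}) t \<le> potential (\<theta> u) t"
    "\<And>u t. potential (restricted \<mu> {..u}) t < potential (\<theta> u) t \<Longrightarrow>
      \<exists>d>0. emeasure (\<sigma> u) {t - d<..<t + d} = 0"
    "\<And>u v A. u \<le> v \<Longrightarrow> A \<in> sets borel \<Longrightarrow> emeasure (\<theta> u) A \<le> emeasure (\<theta> v) A"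
proof -
  note m = convex_order_potential(1)[OF ord] and n = convex_order_potential(2)[OF ord]
  have one: "measure \<mu> UNIV = 1" "measure \<nu> UNIV = 1"
    using \<mu> \<nu> finite_first_momentD(3)[OF m] finite_first_momentD(3)[OF n]
    by (auto simp: borel_prob_def dest!: prob_space.prob_space)
  define f where "f = potential \<nu>"
  define p where "p u = potential (restricted \<mu> {..u})" for u
  define k where "k u = potential (restricted \<mu> {u<..})" for u
  define a where "a u = measure \<mu> {..u}" for u
  define b where "b u = (\<integral>y. y \<partial>restricted \<mu> {..u})" for u
  define M where "M = (\<integral>y. y \<partial>\<nu>)"
  note res = finite_first_moment_restricted[OF m]
  have fp: "convex_on UNIV f" "convex_on UNIV (p u)" "convex_on UNIV (k u)" for u
    unfolding f_def p_def k_def by (intro convex_on_potential res n; simp)+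
  have split: "potential \<mu> t = p u t + k u t" "M = b u + (\<integral>y. y \<partial>restricted \<mu> {u<..})"
    "measure \<mu> {u<..} = 1 - a u" for u t
  proof -
    have eq: "{..u} \<union> {u<..} = UNIV" and dj: "{..u} \<inter> {u<..} = {}" by auto
    note r = restricted_disjoint_union[OF m, of "{..u}" "{u<..}", OF _ _ dj, unfolded eq restricted_UNIV[OF m]]
    show "potential \<mu> t = p u t + k u t" "M = b u + (\<integral>y. y \<partial>restricted \<mu> {u<..})"
      "measure \<mu> {u<..} = 1 - a u"
      using r one(1) convex_order_potential(3)[OF ord] by (auto simp: p_def k_def b_def a_def M_def)
  qed
  define E where "E u t = f t - p u t" for u t
  \<comment> \<open>By the convex order, the potential of the part of \<open>\<mu>\<close> beyond
    \<open>u\<close> is a convex minorant of \<open>E u\<close>. It also bounds \<open>C u\<close>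
    from below.\<close>
  have kE: "k u t \<le> E u t" for u t
    using convex_order_potential(4)[OF ord, of t] split(1)[of t u] by (simp add: E_def f_def)
  have "\<exists>C. \<forall>u. greatest_convex_minorant (E u) (C u)"
    using greatest_convex_minorant_exists[OF fp(3) kE] by metis
  then obtain C where C: "\<And>u. greatest_convex_minorant (E u) (C u)" by blast
  have Cc: "convex_on UNIV (C u)" and CE: "C u t \<le> E u t" and kC: "k u t \<le> C u t" for u t
    using C[of u] kE fp(3) unfolding greatest_convex_minorant_def by auto
  have fbot: "(f \<longlongrightarrow> 0) at_bot" unfolding f_def by (rule potential_at_bot[OF n])
  have ftop: "((\<lambda>t. f t - (t - M)) \<longlongrightarrow> 0) at_top"
    using potential_at_top[OF n] unfolding f_def M_def one(2) by simp
  have ptop: "((\<lambda>t. p u t - (a u * t - b u)) \<longlongrightarrow> 0) at_top" for u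
    using potential_at_top[OF res, of "{..u}"] unfolding p_def a_def b_def by (simp add: measure_restricted[OF m])
  have ktop: "((\<lambda>t. k u t - ((1 - a u) * t - (M - b u))) \<longlongrightarrow> 0) at_top" for u
    using potential_at_top[OF res, of "{u<..}"] split(2)[of u] split(3)[of u] unfolding k_def
    by (simp add: measure_restricted[OF m])
  have pk0: "0 \<le> p u t" "0 \<le> k u t" for u t by (simp_all add: p_def k_def potential_nonneg)
  have Cbot: "(C u \<longlongrightarrow> 0) at_bot" for u
  proof (rule tendsto_sandwich[OF always_eventually always_eventually])
    show "((\<lambda>_. 0) \<longlongrightarrow> (0::real)) at_bot" "(f \<longlongrightarrow> 0) at_bot" by (simp_all add: fbot)
    show "\<forall>t. 0 \<le> C u t" using pk0 kC order_trans by blast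
    show "\<forall>t. C u t \<le> f t" using CE[of u] pk0(1)[of u] unfolding E_def by (smt (verit))
  qed
  \<comment> \<open>Since \<open>\<mu>\<close> and \<open>\<nu>\<close> share mass and mean,
    \<open>k u\<close> and \<open>E u\<close> have the same asymptote, and \<open>C u\<close> is
    squeezed between them.\<close>
  have Ctop: "((\<lambda>t. C u t - ((1 - a u) * t - (M - b u))) \<longlongrightarrow> 0) at_top" for u
  proof (rule tendsto_sandwich[OF always_eventually always_eventually])
    show "((\<lambda>t. k u t - ((1 - a u) * t - (M - b u))) \<longlongrightarrow> 0) at_top" by (rule ktop)
    have "((\<lambda>t. f t - (t - M) - (p u t - (a u * t - b u))) \<longlongrightarrow> 0 - 0) at_top"
      by (intro tendsto_diff ftop ptop)
    then show "((\<lambda>t. E u t - ((1 - a u) * t - (M - b u))) \<longlongrightarrow> 0) at_top"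
      by (simp add: E_def algebra_simps)
  qed (use kC CE in auto)
  define F where "F u t = f t - C u t" for u t
  have Fc: "convex_on UNIV (F u)" for u
    unfolding F_def by (rule convex_minus_greatest_convex_minorant[OF fp(1) fp(2)[of u]]) (use C[of u] in \<open>simp add: E_def[abs_def]\<close>)
  have Fbot: "(F u \<longlongrightarrow> 0) at_bot" for u
    using tendsto_diff[OF fbot Cbot[of u]] by (simp add: F_def[abs_def])
  have Ftop: "((\<lambda>t. F u t - (a u * t - b u)) \<longlongrightarrow> 0) at_top" for u
    using tendsto_diff[OF ftop Ctop[of u]] by (simp add: F_def algebra_simps)
  have "\<exists>\<theta>. \<forall>u. finite_first_moment (\<theta> u) \<and> measure (\<theta> u) UNIV = a u \<and> (\<integral>y. y \<partial>\<theta> u) = b u \<and> potential (\<theta> u) = F u"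
    using measure_with_potential_exists[OF Fc Fbot Ftop] by metis
  then obtain \<theta> where \<theta>: "\<And>u. finite_first_moment (\<theta> u)" "\<And>u. measure (\<theta> u) UNIV = a u"
    "\<And>u. (\<integral>y. y \<partial>\<theta> u) = b u" "\<And>u. potential (\<theta> u) = F u" by blast
  have "\<exists>\<sigma>. \<forall>u. finite_first_moment (\<sigma> u) \<and> potential (\<sigma> u) = C u"
    using measure_with_potential_exists[OF Cc Cbot Ctop] by metis
  then obtain \<sigma> where \<sigma>: "\<And>u. finite_first_moment (\<sigma> u)" "\<And>u. potential (\<sigma> u) = C u" by blast
  show ?thesis
  proof (rule that[of \<theta> \<sigma>])
    show "finite_first_moment (\<theta> u)" "finite_first_moment (\<sigma> u)" "measure (\<theta> u) UNIV = measure \<mu> {..u}"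
      "(\<integral>y. y \<partial>\<theta> u) = (\<integral>y. y \<partial>restricted \<mu> {..u})" for u
      using \<theta> \<sigma> by (auto simp: a_def b_def)
    show "emeasure \<nu> A = emeasure (\<theta> u) A + emeasure (\<sigma> u) A" if "A \<in> sets borel" for u A
      by (rule potential_add_unique[OF n \<theta>(1) \<sigma>(1) _ that]) (simp add: \<theta>(4) \<sigma>(2) F_def f_def)
    show "potential (restricted \<mu> {..u}) t \<le> potential (\<theta> u) t" for u t
      using CE[of u t] by (simp add: \<theta>(4) F_def E_def p_def)
    show "\<exists>d>0. emeasure (\<sigma> u) {t - d<..<t + d} = 0"
      if "potential (restricted \<mu> {..u}) t < potential (\<theta> u) t" for u t
    proof -
      have "C u t < E u t" using that by (simp add: \<theta>(4) F_def E_def p_def)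
      moreover have "continuous_on UNIV (E u)" unfolding E_def[abs_def]
        by (intro continuous_intros convex_on_UNIV_continuous fp)
      ultimately obtain d where d: "d > 0" "\<And>s. 0 < s \<and> s < d \<Longrightarrow> 2 * C u t = C u (t - s) + C u (t + s)"
        using greatest_convex_minorant_locally_affine[OF C] by blast
      have "emeasure (\<sigma> u) {t - d/2<..<t + d/2} = 0"
        using potential_affine_iff_null[OF \<sigma>(1), of "d/2" u t] d(1) d(2)[of "d/2"] by (simp add: \<sigma>(2))
      then show ?thesis using d(1) by (intro exI[of _ "d/2"]) simp
    qed
    show "emeasure (\<theta> u) A \<le> emeasure (\<theta> v) A" if uv: "u \<le> v" and A: "A \<in> sets borel" for u v A
    proof -
      \<comment> \<open>Passing from \<open>u\<close> to \<open>v\<close> subtracts \<open>q\<close>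
        from \<open>E u\<close>, so \<open>C v\<close> is the greatest convex minorant of
        \<open>C u - q\<close>. Hence \<open>C u - C v = F v - F u\<close> is convex, and it is the
        potential of the increment \<open>\<delta>\<close>.\<close>
      define q where "q = potential (restricted \<mu> {u<..v})"
      have "{..v} = {..u} \<union> {u<..v}" "{..u} \<inter> {u<..v} = {}" using uv by auto
      then have pv: "p v t = p u t + q t" for t
        using restricted_disjoint_union(1)[OF m, of "{..u}" "{u<..v}" t] by (simp add: p_def q_def)
      have qc: "convex_on UNIV q" unfolding q_def by (intro convex_on_potential res) simp
      have "E v = (\<lambda>t. E u t - q t)" by (auto simp: E_def pv)
      then have "greatest_convex_minorant (\<lambda>t. E u t - q t) (C v)" using C[of v] by simp
      from greatest_convex_minorant_diff[OF qc C this]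
      have "convex_on UNIV (\<lambda>t. C u t - C v t)"
        by (rule convex_minus_greatest_convex_minorant[OF Cc qc])
      then have c: "convex_on UNIV (\<lambda>t. F v t - F u t)" by (simp add: F_def)
      have bt: "((\<lambda>t. F v t - F u t) \<longlongrightarrow> 0) at_bot" using tendsto_diff[OF Fbot Fbot] by simp
      have tp: "((\<lambda>t. F v t - F u t - ((a v - a u) * t - (b v - b u))) \<longlongrightarrow> 0) at_top"
        using tendsto_diff[OF Ftop[of v] Ftop[of u]] by (simp add: algebra_simps)
      obtain \<delta> where \<delta>: "finite_first_moment \<delta>" "potential \<delta> = (\<lambda>t. F v t - F u t)"
        using measure_with_potential_exists[OF c bt tp] by blast
      have "emeasure (\<theta> v) A = emeasure (\<theta> u) A + emeasure \<delta> A"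
        by (rule potential_add_unique[OF \<theta>(1) \<theta>(1) \<delta>(1) _ A]) (simp add: \<theta>(4) \<delta>(2))
      then show ?thesis by simp
    qed
  qed
qed

subsection \<open>Martingale kernels\<close>

text \<open>For \<open>S = {..u}\<close> this is the measure \<open>\<theta>\<close> at level
  \<open>u\<close> attached to a plan; it is not normalised.\<close>

abbreviation section_marginal :: "(real \<times> real) measure \<Rightarrow> real set \<Rightarrow> real measure" where
  "section_marginal \<pi> S \<equiv> distr (density \<pi> (indicator (S \<times> UNIV))) borel snd"

lemma emeasure_section_marginal:
  assumes \<pi>: "sets \<pi> = sets borel" and S: "S \<in> sets borel" and B: "B \<in> sets borel"
  shows "emeasure (section_marginal \<pi> S) B = emeasure \<pi> (S \<times> B)"
proof -
  have "S \<times> UNIV \<inter> snd -` B = S \<times> B" by auto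
  then show ?thesis
    using emeasure_section_restriction[OF \<pi> _ fst_snd_borel(2) B, of "S \<times> UNIV"] S by simp
qed

lemma
  fixes \<pi> :: "(real \<times> real) measure"
  assumes \<pi>: "sets \<pi> = sets borel" "finite_measure \<pi>" and int: "integrable \<pi> snd" and S: "S \<in> sets borel"
  shows finite_first_moment_section_marginal: "finite_first_moment (section_marginal \<pi> S)"
    and integral_section_marginal: "\<And>f. f \<in> borel_measurable borel \<Longrightarrow>
      (\<integral>y. f y \<partial>section_marginal \<pi> S) = (\<integral>p. indicator S (fst p) * f (snd p) \<partial>\<pi> :: real)"
proof -
  interpret finite_measure \<pi> by fact
  have sp: "space \<pi> = UNIV" using sets_eq_imp_space_eq[OF \<pi>(1)] by simp
  have Sm: "S \<times> UNIV \<in> sets \<pi>" using S \<pi>(1) by simp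
  have d: "density \<pi> (indicator (S \<times> UNIV)) = density \<pi> (\<lambda>p. ennreal (indicator (S \<times> UNIV) p))"
    by (simp add: ennreal_indicator)
  have gm: "(indicator (S \<times> UNIV) :: _ \<Rightarrow> real) \<in> borel_measurable \<pi>" using Sm by simp
  have snd\<pi>: "snd \<in> \<pi> \<rightarrow>\<^sub>M borel" using int by (rule borel_measurable_integrable)
  then have snd': "snd \<in> density \<pi> (indicator (S \<times> UNIV)) \<rightarrow>\<^sub>M borel" by simp
  have "integrable (section_marginal \<pi> S) (\<lambda>y. y)"
    unfolding integrable_distr_eq[OF snd' measurable_ident_sets[OF refl]]
    unfolding d integrable_density[OF borel_measurable_integrable[OF int] gm AE_I2[OF indicator_pos_le]]
    by (rule integrable_mult_indicator[OF Sm int])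
  moreover have "finite_measure (section_marginal \<pi> S)"
    using emeasure_section_marginal[OF \<pi>(1) S, of UNIV] emeasure_finite by (intro finite_measureI) simp
  ultimately show "finite_first_moment (section_marginal \<pi> S)" by (simp add: finite_first_moment_def)
  show "(\<integral>y. f y \<partial>section_marginal \<pi> S) = (\<integral>p. indicator S (fst p) * f (snd p) \<partial>\<pi>)"
    if f: "f \<in> borel_measurable borel" for f :: "real \<Rightarrow> real"
  proof -
    have fm: "(\<lambda>p. f (snd p)) \<in> borel_measurable \<pi>" using measurable_compose[OF snd\<pi> f] .
    have "(\<integral>y. f y \<partial>section_marginal \<pi> S) = (\<integral>p. f (snd p) \<partial>density \<pi> (indicator (S \<times> UNIV)))"
      by (rule integral_distr[OF snd' f])
    also have "\<dots> = (\<integral>p. indicator (S \<times> UNIV) p *\<^sub>R f (snd p) \<partial>\<pi>)"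
      unfolding d by (rule integral_density[OF fm gm AE_I2[OF indicator_pos_le]])
    also have "\<dots> = (\<integral>p. indicator S (fst p) * f (snd p) \<partial>\<pi>)"
      by (rule Bochner_Integration.integral_cong) (auto simp: indicator_def mem_Times_iff)
    finally show ?thesis .
  qed
qed

lemma kernel_nn_integral_measurable:
  assumes K: "K \<in> borel \<rightarrow>\<^sub>M prob_algebra borel" and f: "f \<in> borel_measurable (borel :: (real \<times> real) measure)"
  shows "(\<lambda>x. \<integral>\<^sup>+y. f (x, y) \<partial>K x) \<in> borel_measurable borel"
  by (rule nn_integral_measurable_subprob_algebra2[OF _ measurable_prob_algebraD[OF K]])
    (use f in \<open>simp add: borel_prod\<close>)

lemma kernel_prob:
  assumes K: "K \<in> borel \<rightarrow>\<^sub>M prob_algebra borel"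
  shows "prob_space (K x)" "sets (K x) = sets borel" "space (K x) = UNIV"
  using measurable_space[OF K, of x] sets_eq_imp_space_eq[of "K x" borel] by (auto simp: space_prob_algebra)

text \<open>Tonelli applied to the complement of \<open>S\<close>: almost every section of a null
  set is null.\<close>

lemma AE_kernel_plan:
  assumes \<mu>: "sets \<mu> = sets borel" and K: "K \<in> borel \<rightarrow>\<^sub>M prob_algebra borel"
    and S: "S \<in> sets borel" and ae: "AE p in kernel_plan \<mu> K. p \<in> S"
  shows "AE x in \<mu>. AE y in K x. (x, y) \<in> S"
proof -
  have S': "- S \<in> sets borel" using S by (rule borel_comp)
  have sp: "space (kernel_plan \<mu> K) = UNIV" using sets_eq_imp_space_eq[OF sets_kernel_plan[OF \<mu> K]] by simp
  have "emeasure (kernel_plan \<mu> K) (- S) = 0"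
    using ae S' sets_kernel_plan[OF \<mu> K] sp by (subst (asm) AE_iff_measurable[of "- S"]) auto
  then have z: "(\<integral>\<^sup>+x. \<integral>\<^sup>+y. indicator (- S) (x, y) \<partial>K x \<partial>\<mu>) = 0"
    using nn_integral_kernel_plan[OF \<mu> K, of "indicator (- S)"] S' sets_kernel_plan[OF \<mu> K] by simp
  have "(\<lambda>x. \<integral>\<^sup>+y. indicator (- S) (x, y) \<partial>K x) \<in> borel_measurable \<mu>"
    using kernel_nn_integral_measurable[OF K, of "indicator (- S)"] S' \<mu> by (simp cong: measurable_cong_sets)
  then have "AE x in \<mu>. (\<integral>\<^sup>+y. indicator (- S) (x, y) \<partial>K x) = 0" using z by (simp add: nn_integral_0_iff_AE)
  then show ?thesis
  proof eventually_elim
    fix x assume z: "(\<integral>\<^sup>+y. indicator (- S) (x, y) \<partial>K x) = 0"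
    have "Pair x \<in> borel \<rightarrow>\<^sub>M (borel :: (real \<times> real) measure)" by (simp add: borel_prod[symmetric])
    then have "(\<lambda>y. indicator (- S) (x, y) :: ennreal) \<in> borel_measurable borel"
      using S' by (intro measurable_compose[OF _ borel_measurable_indicator]) auto
    then have "(\<lambda>y. indicator (- S) (x, y) :: ennreal) \<in> borel_measurable (K x)"
      using kernel_prob(2)[OF K] by (simp cong: measurable_cong_sets)
    then have "AE y in K x. indicator (- S) (x, y) = (0::ennreal)" using z by (simp add: nn_integral_0_iff_AE)
    then show "AE y in K x. (x, y) \<in> S" by eventually_elim (auto simp: indicator_def split: if_splits)
  qed
qed

lemma finite_borel_measure_density:
  assumes "sets \<mu> = sets borel" "f \<in> borel_measurable \<mu>" "(\<integral>\<^sup>+x. f x \<partial>\<mu>) < \<infinity>"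
  shows "finite_borel_measure (density \<mu> f)"
proof -
  have "emeasure (density \<mu> f) (space \<mu>) = (\<integral>\<^sup>+x. f x * indicator (space \<mu>) x \<partial>\<mu>)"
    by (rule emeasure_density) (use assms in auto)
  also have "\<dots> = (\<integral>\<^sup>+x. f x \<partial>\<mu>)" by (rule nn_integral_cong) simp
  finally have "finite_measure (density \<mu> f)" using assms(3) by (intro finite_measureI) simp
  then show ?thesis using assms by (simp add: finite_borel_measure_def finite_borel_measure_axioms_def)
qed

text \<open>The identity on half-lines is rearranged so that only nonnegative terms occur: positive
  part of \<open>y\<close> plus negative part of \<open>x\<close> against negative part of
  \<open>y\<close> plus positive part of \<open>x\<close>. The two resulting densities have the same
  distribution function, so they agree almost everywhere, and their finiteness yields
  integrability.\<close>

lemma martingale_kernelI: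
  assumes \<mu>: "borel_prob \<mu>" and K: "K \<in> borel \<rightarrow>\<^sub>M prob_algebra borel"
    and int: "integrable (kernel_plan \<mu> K) fst" "integrable (kernel_plan \<mu> K) snd"
    and mean: "\<And>u. (\<integral>p. indicator {..u} (fst p) * snd p \<partial>kernel_plan \<mu> K) =
      (\<integral>p. indicator {..u} (fst p) * fst p \<partial>kernel_plan \<mu> K)"
  shows "AE x in \<mu>. integrable (K x) (\<lambda>y. y) \<and> (\<integral>y. y \<partial>K x) = x"
proof -
  have \<mu>': "prob_space \<mu>" "sets \<mu> = sets borel" using \<mu> by (auto simp: borel_prob_def)
  interpret \<mu>: prob_space \<mu> by fact
  define \<pi> where "\<pi> = kernel_plan \<mu> K"
  note s\<pi> = sets_kernel_plan[OF \<mu>'(2) K, folded \<pi>_def]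
  note int' = int[folded \<pi>_def]
  define kp where "kp x = (\<integral>\<^sup>+y. ennreal y \<partial>K x)" for x
  define kn where "kn x = (\<integral>\<^sup>+y. ennreal (- y) \<partial>K x)" for x
  have km: "(\<lambda>x. \<integral>\<^sup>+y. f y \<partial>K x) \<in> borel_measurable \<mu>" if "f \<in> borel_measurable borel" for f :: "real \<Rightarrow> ennreal"
  proof -
    have "(\<lambda>p. f (snd p)) \<in> borel_measurable (borel :: (real \<times> real) measure)"
      by (rule measurable_compose[OF fst_snd_borel(2) that])
    from kernel_nn_integral_measurable[OF K this] show ?thesis
      using \<mu>'(2) by (simp cong: measurable_cong_sets)
  qed
  have [measurable]: "kp \<in> borel_measurable \<mu>" "kn \<in> borel_measurable \<mu>"
    unfolding kp_def kn_def by (intro km; measurable)+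
  have idm[measurable]: "(\<lambda>x. x) \<in> borel_measurable \<mu>" using \<mu>'(2) by (simp cong: measurable_cong_sets)
  \<comment> \<open>One function covers both sides of the comparison. Coercion by
    \<open>ennreal\<close> sends negative reals to 0 and so takes positive parts.\<close>
  define F where "F g h x = (\<integral>\<^sup>+y. ennreal (g y) \<partial>K x) + ennreal (h x)" for g h :: "real \<Rightarrow> real" and x
  have dens: "(\<integral>\<^sup>+x. F g h x * indicator A x \<partial>\<mu>) = ennreal (\<integral>p. indicator A (fst p) * (max 0 (g (snd p)) + max 0 (h (fst p))) \<partial>\<pi>)"
    if g: "g \<in> borel_measurable borel" "integrable \<pi> (\<lambda>p. g (snd p))"
    and h: "h \<in> borel_measurable borel" "integrable \<pi> (\<lambda>p. h (fst p))" and A: "A \<in> sets borel" for g h A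
  proof -
    note g(1)[measurable] h(1)[measurable] A[measurable]
    have "F g h x * indicator A x = (\<integral>\<^sup>+y. (ennreal (g y) + ennreal (h x)) * indicator A x \<partial>K x)" for x
    proof -
      interpret K: prob_space "K x" by (rule kernel_prob(1)[OF K])
      have gm: "g \<in> borel_measurable (K x)" using g(1) kernel_prob(2)[OF K] by (simp cong: measurable_cong_sets)
      have "(\<integral>\<^sup>+y. (ennreal (g y) + ennreal (h x)) * indicator A x \<partial>K x)
        = (\<integral>\<^sup>+y. (ennreal (g y) + ennreal (h x)) \<partial>K x) * indicator A x"
        by (rule nn_integral_multc) (use gm in measurable)
      also have "(\<integral>\<^sup>+y. (ennreal (g y) + ennreal (h x)) \<partial>K x) = F g h x"
        using gm by (subst nn_integral_add) (auto simp: F_def K.emeasure_space_1)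
      finally show ?thesis ..
    qed
    then have "(\<integral>\<^sup>+x. F g h x * indicator A x \<partial>\<mu>) =
      (\<integral>\<^sup>+x. \<integral>\<^sup>+y. (\<lambda>p. (ennreal (g (snd p)) + ennreal (h (fst p))) * indicator A (fst p)) (x, y) \<partial>K x \<partial>\<mu>)" by simp
    also have "\<dots> = (\<integral>\<^sup>+p. (ennreal (g (snd p)) + ennreal (h (fst p))) * indicator A (fst p) \<partial>\<pi>)"
      unfolding \<pi>_def by (rule nn_integral_kernel_plan[OF \<mu>'(2) K, symmetric]) measurable
    also have "\<dots> = (\<integral>\<^sup>+p. ennreal (indicator A (fst p) * (max 0 (g (snd p)) + max 0 (h (fst p)))) \<partial>\<pi>)"
      by (rule nn_integral_cong) (auto split: split_indicator simp: ennreal_max_0 ennreal_max_0')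
    also have "\<dots> = ennreal (\<integral>p. indicator A (fst p) * (max 0 (g (snd p)) + max 0 (h (fst p))) \<partial>\<pi>)"
    proof (rule nn_integral_eq_integral)
      have Am: "A \<times> UNIV \<in> sets \<pi>" using A s\<pi> by simp
      have "integrable \<pi> (\<lambda>p. max 0 (g (snd p)) + max 0 (h (fst p)))"
        using g h by (intro Bochner_Integration.integrable_add integrable_max) auto
      from integrable_mult_indicator[OF Am this]
      show "integrable \<pi> (\<lambda>p. indicator A (fst p) * (max 0 (g (snd p)) + max 0 (h (fst p))))"
        by (simp add: indicator_def mem_Times_iff)
    qed (auto split: split_indicator)
    finally show ?thesis .
  qed
  have m1: "(\<lambda>y::real. y) \<in> borel_measurable borel" "(\<lambda>y::real. - y) \<in> borel_measurable borel" by measurable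
  have i1: "integrable \<pi> (\<lambda>p. - snd p)" "integrable \<pi> (\<lambda>p. - fst p)" using int' by auto
  \<comment> \<open>Where both are finite, \<open>D1 x = D2 x\<close> says precisely that
    \<open>K x\<close> has mean \<open>x\<close>.\<close>
  define D1 where "D1 = F (\<lambda>y. y) (\<lambda>x. - x)"
  define D2 where "D2 = F (\<lambda>y. - y) (\<lambda>x. x)"
  have D1: "D1 = (\<lambda>x. kp x + ennreal (- x))" and D2: "D2 = (\<lambda>x. kn x + ennreal x)"
    by (auto simp: D1_def D2_def F_def kp_def kn_def)
  have Dm[measurable]: "D1 \<in> borel_measurable \<mu>" "D2 \<in> borel_measurable \<mu>" unfolding D1 D2 by measurable
  have fin: "(\<integral>\<^sup>+x. D1 x \<partial>\<mu>) < \<infinity>" "(\<integral>\<^sup>+x. D2 x \<partial>\<mu>) < \<infinity>"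
    using dens[OF m1(1) int'(2) m1(2) i1(2), of UNIV] dens[OF m1(2) i1(1) m1(1) int'(1), of UNIV]
    unfolding D1_def D2_def by auto
  have fb: "finite_borel_measure (density \<mu> D1)" "finite_borel_measure (density \<mu> D2)"
    using fin \<mu>'(2) by (intro finite_borel_measure_density Dm; simp)+
  have "cdf (density \<mu> D1) = cdf (density \<mu> D2)"
  proof
    fix u
    have si: "integrable \<pi> (\<lambda>p. indicator {..u} (fst p) * f p)" if "integrable \<pi> f" for f :: "real \<times> real \<Rightarrow> real"
    proof -
      have Am: "{..u} \<times> UNIV \<in> sets \<pi>" using s\<pi> by simp
      from integrable_mult_indicator[OF Am that] show ?thesis by (simp add: indicator_def mem_Times_iff)
    qed
    have "(\<integral>p. indicator {..u} (fst p) * (max 0 (snd p) + max 0 (- fst p)) \<partial>\<pi>)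
      - (\<integral>p. indicator {..u} (fst p) * (max 0 (- snd p) + max 0 (fst p)) \<partial>\<pi>)
      = (\<integral>p. indicator {..u} (fst p) * (max 0 (snd p) + max 0 (- fst p)) - indicator {..u} (fst p) * (max 0 (- snd p) + max 0 (fst p)) \<partial>\<pi>)"
      using int' i1 by (intro Bochner_Integration.integral_diff[symmetric] si Bochner_Integration.integrable_add integrable_max) auto
    also have "\<dots> = (\<integral>p. indicator {..u} (fst p) * snd p - indicator {..u} (fst p) * fst p \<partial>\<pi>)"
      by (rule Bochner_Integration.integral_cong) (auto split: split_indicator)
    also have "\<dots> = 0"
      using mean[of u, folded \<pi>_def] by (subst Bochner_Integration.integral_diff) (auto intro!: si int')
    finally have eq: "(\<integral>p. indicator {..u} (fst p) * (max 0 (snd p) + max 0 (- fst p)) \<partial>\<pi>)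
      = (\<integral>p. indicator {..u} (fst p) * (max 0 (- snd p) + max 0 (fst p)) \<partial>\<pi>)" by simp
    have Am: "{..u} \<in> sets \<mu>" using \<mu>'(2) by simp
    have "emeasure (density \<mu> D1) {..u} = emeasure (density \<mu> D2) {..u}"
      unfolding emeasure_density[OF Dm(1) Am] emeasure_density[OF Dm(2) Am]
      unfolding D1_def D2_def dens[OF m1(1) int'(2) m1(2) i1(2) atMost_borel] dens[OF m1(2) i1(1) m1(1) int'(1) atMost_borel] eq ..
    then show "cdf (density \<mu> D1) u = cdf (density \<mu> D2) u" by (simp add: cdf_def measure_def)
  qed
  then have "density \<mu> D1 = density \<mu> D2" by (rule cdf_unique'[OF fb])
  then have ae: "AE x in \<mu>. D1 x = D2 x"
    using finite_density_unique[OF Dm] fin by auto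
  have ae1: "AE x in \<mu>. D1 x \<noteq> \<infinity>" "AE x in \<mu>. D2 x \<noteq> \<infinity>"
    using nn_integral_PInf_AE[OF Dm(1)] nn_integral_PInf_AE[OF Dm(2)] fin by auto
  show ?thesis using ae ae1
  proof eventually_elim
    fix x assume x: "D1 x = D2 x" "D1 x \<noteq> \<infinity>" "D2 x \<noteq> \<infinity>"
    have fin: "kp x < \<infinity>" "kn x < \<infinity>"
      using x(2,3) unfolding D1 D2 infinity_ennreal_def by (simp_all add: ennreal_add_eq_top less_top)
    have ym: "(\<lambda>y. y) \<in> borel_measurable (K x)" using kernel_prob(2)[OF K] by (simp cong: measurable_cong_sets)
    have i: "integrable (K x) (\<lambda>y. y)"
    proof (rule integrableI_bounded[OF ym])
      have "(\<integral>\<^sup>+y. ennreal (norm y) \<partial>K x) = (\<integral>\<^sup>+y. ennreal y + ennreal (- y) \<partial>K x)"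
        by (rule nn_integral_cong) (auto simp: abs_if ennreal_neg)
      also have "\<dots> = kp x + kn x" unfolding kp_def kn_def by (rule nn_integral_add) (use ym in measurable)
      also have "\<dots> < \<infinity>" using fin by (simp add: less_top ennreal_add_eq_top)
      finally show "(\<integral>\<^sup>+y. ennreal (norm y) \<partial>K x) < \<infinity>" .
    qed
    obtain a b where ab: "kp x = ennreal a" "0 \<le> a" "kn x = ennreal b" "0 \<le> b"
      using fin by (cases "kp x"; cases "kn x") auto
    have "ennreal (a + max 0 (- x)) = ennreal (b + max 0 x)"
      using x(1) ab unfolding D1 D2 by (simp add: ennreal_max_0' ennreal_max_0)
    then have "a + max 0 (- x) = b + max 0 x" using ab by (subst (asm) ennreal_inj) auto
    then have "enn2real (kp x) - enn2real (kn x) = x" using ab by (simp add: max_def split: if_splits)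
    then show "integrable (K x) (\<lambda>y. y) \<and> (\<integral>y. y \<partial>K x) = x"
      using i real_lebesgue_integral_def[OF i] by (simp add: kp_def kn_def)
  qed
qed

subsection \<open>Existence\<close>

text \<open>Every point of \<open>S\<close> lies in a null interval with rational endpoints, and
  there are only countably many of these.\<close>

lemma locally_null_imp_null:
  fixes m :: "real measure"
  assumes m: "sets m = sets borel" and S: "S \<in> sets borel"
    and loc: "\<And>t. t \<in> S \<Longrightarrow> \<exists>d>0. emeasure m {t - d<..<t + d} = 0"
  shows "emeasure m S = 0"
proof -
  define I where "I = {(p, q :: rat). emeasure m {of_rat p<..<of_rat q} = 0}"
  have null: "(\<Union>(p, q)\<in>I. {of_rat p<..<of_rat q :: real}) \<in> null_sets m"
  proof (rule null_sets_UN')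
    show "countable I" by simp
    show "(case i of (p, q) \<Rightarrow> {of_rat p<..<of_rat q :: real}) \<in> null_sets m" if "i \<in> I" for i
      using that m by (cases i) (auto simp: I_def null_sets_def)
  qed
  have "S \<subseteq> (\<Union>(p, q)\<in>I. {of_rat p<..<of_rat q :: real})"
  proof
    fix t assume "t \<in> S"
    then obtain d where d: "d > 0" "emeasure m {t - d<..<t + d} = 0" using loc by blast
    obtain p q :: rat where pq: "t - d < of_rat p" "of_rat p < t" "t < of_rat q" "of_rat q < t + d"
      using of_rat_dense[of "t - d" t] of_rat_dense[of t "t + d"] d(1) by auto
    have "emeasure m {of_rat p<..<of_rat q} \<le> emeasure m {t - d<..<t + d}"
      by (rule emeasure_mono) (use pq m in auto)
    then have "(p, q) \<in> I" using d(2) by (simp add: I_def)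
    then show "t \<in> (\<Union>(p, q)\<in>I. {of_rat p<..<of_rat q :: real})"
      by (intro UN_I[of "(p, q)"]) (use pq in auto)
  qed
  then have "S \<in> null_sets m" using null S m by (intro null_sets_subset[OF null]) auto
  then show ?thesis by auto
qed

lemma plan_facts:
  fixes \<pi> :: "(real \<times> real) measure"
  assumes \<mu>: "borel_prob \<mu>" "finite_first_moment \<mu>" and \<nu>: "finite_first_moment \<nu>"
    and \<pi>: "sets \<pi> = sets borel" "distr \<pi> borel fst = \<mu>" "distr \<pi> borel snd = \<nu>"
  shows "prob_space \<pi>" "integrable \<pi> fst" "integrable \<pi> snd"
    "\<And>f. f \<in> borel_measurable borel \<Longrightarrow> (\<integral>x. f x \<partial>\<mu>) = (\<integral>p. f (fst p) \<partial>\<pi> :: real)"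
proof -
  have sp: "space \<pi> = UNIV" using sets_eq_imp_space_eq[OF \<pi>(1)] by simp
  have m: "fst \<in> \<pi> \<rightarrow>\<^sub>M borel" "snd \<in> \<pi> \<rightarrow>\<^sub>M borel"
    unfolding measurable_cong_sets[OF \<pi>(1) refl] by (rule fst_snd_borel)+
  have "emeasure \<pi> (space \<pi>) = emeasure \<mu> UNIV"
    using marginal_emeasure(1)[OF \<pi>(1), of UNIV] \<pi>(2) sp by simp
  also have "\<dots> = 1" using \<mu> finite_first_momentD(3)[OF \<mu>(2)] by (auto simp: borel_prob_def dest: prob_space.emeasure_space_1)
  finally show "prob_space \<pi>" by (rule prob_spaceI)
  show "integrable \<pi> fst"
    using finite_first_momentD(4)[OF \<mu>(2)] unfolding \<pi>(2)[symmetric] integrable_distr_eq[OF m(1) measurable_ident_sets[OF refl]] .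
  show "integrable \<pi> snd"
    using finite_first_momentD(4)[OF \<nu>] unfolding \<pi>(3)[symmetric] integrable_distr_eq[OF m(2) measurable_ident_sets[OF refl]] .
  show "(\<integral>x. f x \<partial>\<mu>) = (\<integral>p. f (fst p) \<partial>\<pi>)" if "f \<in> borel_measurable borel" for f :: "real \<Rightarrow> real"
    unfolding \<pi>(2)[symmetric] by (rule integral_distr[OF m(1) that])
qed

text \<open>Jensen's inequality is an equality at a contact point, so its nonnegative defect
  \<open>g\<close> vanishes almost everywhere; \<open>g\<close> is positive exactly where mass
  starting in \<open>{..u}\<close> jumps across \<open>t\<close>.\<close>

lemma no_crossing_at_contact:
  fixes \<pi> :: "(real \<times> real) measure"
  assumes s: "sets \<pi> = sets borel" and P: "prob_space \<pi>" and int: "integrable \<pi> fst" "integrable \<pi> snd"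
    and mean: "\<And>u. (\<integral>p. indicator {..u} (fst p) * snd p \<partial>\<pi>) = (\<integral>p. indicator {..u} (fst p) * fst p \<partial>\<pi>)"
    and contact: "(\<integral>p. indicator {..u} (fst p) * max 0 (t - snd p) \<partial>\<pi>)
      = (\<integral>p. indicator {..u} (fst p) * max 0 (t - fst p) \<partial>\<pi>)"
  shows "emeasure \<pi> ({..min u t} \<times> {t<..} \<union> {t<..u} \<times> {..<t}) = 0"
proof -
  interpret prob_space \<pi> by fact
  have sp: "space \<pi> = UNIV" using sets_eq_imp_space_eq[OF s] by simp
  have i: "integrable \<pi> (\<lambda>p. indicator {..c} (fst p) * f p)" if "integrable \<pi> f" for f :: "real \<times> real \<Rightarrow> real" and c
  proof -
    have Am: "{..c} \<times> UNIV \<in> sets \<pi>" using s by simp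
    from integrable_mult_indicator[OF Am that] show ?thesis by (simp add: indicator_def mem_Times_iff)
  qed
  have ip: "integrable \<pi> (\<lambda>p. max 0 (t - snd p))" "integrable \<pi> (\<lambda>p. max 0 (t - fst p))"
    "integrable \<pi> (\<lambda>p. t - snd p)" "integrable \<pi> (\<lambda>p. t - fst p)"
    using int by (auto intro!: integrable_max)
  \<comment> \<open>For \<open>fst p \<le> min u t\<close> this is \<open>max 0 (snd p - t)\<close>,
    and for \<open>t < fst p \<le> u\<close> it is \<open>max 0 (t - snd p)\<close>. The mean
    condition at level \<open>min u t\<close> lets \<open>fst p\<close> replace \<open>snd p\<close>
    in the second term.\<close>
  define g where "g p = indicator {..u} (fst p) * max 0 (t - snd p) - indicator {..min u t} (fst p) * (t - snd p)" for p
  have gi: "integrable \<pi> g" unfolding g_def by (intro Bochner_Integration.integrable_diff i ip)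
  have gpos: "0 \<le> g p" for p by (auto simp: g_def split: split_indicator)
  have "(\<integral>p. g p \<partial>\<pi>) = (\<integral>p. indicator {..u} (fst p) * max 0 (t - snd p) \<partial>\<pi>) - (\<integral>p. indicator {..min u t} (fst p) * (t - snd p) \<partial>\<pi>)"
    unfolding g_def by (intro Bochner_Integration.integral_diff i ip)
  also have "(\<integral>p. indicator {..min u t} (fst p) * (t - snd p) \<partial>\<pi>) = (\<integral>p. indicator {..min u t} (fst p) * (t - fst p) \<partial>\<pi>)"
  proof -
    have e: "(\<integral>p. indicator {..min u t} (fst p) * (t - f p) \<partial>\<pi>) =
       (\<integral>p. indicator {..min u t} (fst p) * t \<partial>\<pi>) - (\<integral>p. indicator {..min u t} (fst p) * f p \<partial>\<pi>)"
      if "integrable \<pi> f" for f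
      unfolding right_diff_distrib by (intro Bochner_Integration.integral_diff i that integrable_const)
    show ?thesis unfolding e[OF int(1)] e[OF int(2)] mean ..
  qed
  also have "\<dots> = (\<integral>p. indicator {..u} (fst p) * max 0 (t - fst p) \<partial>\<pi>)"
    by (rule Bochner_Integration.integral_cong) (auto split: split_indicator)
  finally have "(\<integral>p. g p \<partial>\<pi>) = 0" using contact by simp
  then have "AE p in \<pi>. g p = 0" using integral_nonneg_eq_0_iff_AE[OF gi] gpos by simp
  then have "AE p in \<pi>. p \<notin> {..min u t} \<times> {t<..} \<union> {t<..u} \<times> {..<t}"
    by eventually_elim (auto simp: g_def split: split_indicator_asm)
  then show ?thesis
    using s sp by (subst (asm) AE_iff_measurable[of "{..min u t} \<times> {t<..} \<union> {t<..u} \<times> {..<t}"]) auto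
qed

lemma left_monotone_martingale_plan_exists:
  assumes \<mu>: "borel_prob \<mu>" and \<nu>: "borel_prob \<nu>" and ord: "\<mu> \<preceq>\<^sub>C \<nu>"
  shows "\<exists>\<pi>. \<pi> \<in> martingale_plans \<mu> \<nu> \<and> left_monotone \<pi>"
proof -
  note m = convex_order_potential(1)[OF ord] and n = convex_order_potential(2)[OF ord]
  note mD = finite_first_momentD[OF m] and nD = finite_first_momentD[OF n]
  obtain \<theta> \<sigma> :: "real \<Rightarrow> real measure" where
    \<theta>: "\<And>u. finite_first_moment (\<theta> u)" and \<sigma>: "\<And>u. finite_first_moment (\<sigma> u)"
    and sum: "\<And>u A. A \<in> sets borel \<Longrightarrow> emeasure \<nu> A = emeasure (\<theta> u) A + emeasure (\<sigma> u) A"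
    and mass: "\<And>u. measure (\<theta> u) UNIV = measure \<mu> {..u}"
    and mn: "\<And>u. (\<integral>y. y \<partial>\<theta> u) = (\<integral>y. y \<partial>restricted \<mu> {..u})"
    and pot: "\<And>u t. potential (restricted \<mu> {..u}) t \<le> potential (\<theta> u) t"
    and loc: "\<And>u t. potential (restricted \<mu> {..u}) t < potential (\<theta> u) t \<Longrightarrow>
      \<exists>d>0. emeasure (\<sigma> u) {t - d<..<t + d} = 0"
    and mono: "\<And>u v A. u \<le> v \<Longrightarrow> A \<in> sets borel \<Longrightarrow> emeasure (\<theta> u) A \<le> emeasure (\<theta> v) A"
    using shadow_family_exists[OF \<mu> \<nu> ord] by blast
  note \<theta>D = finite_first_momentD[OF \<theta>]
  have P: "prob_space \<mu>" "prob_space \<nu>" using \<mu> \<nu> by (auto simp: borel_prob_def)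
  interpret \<mu>: real_distribution \<mu> using P(1) mD(2) by (simp add: real_distribution_def real_distribution_axioms_def)
  \<comment> \<open>The total masses of the shadows form the distribution function of
    \<open>\<mu>\<close>. This supplies right-continuity and limits for assembling the plan, and
    later identifies its first marginal.\<close>
  have cdf: "measure (\<theta> u) UNIV = cdf \<mu> u" for u by (simp add: mass cdf_def)
  have "\<exists>\<pi>. sets \<pi> = sets borel \<and> prob_space \<pi> \<and> distr \<pi> borel snd = \<nu> \<and>
    (\<forall>u. \<forall>B\<in>sets borel. emeasure \<pi> ({..u} \<times> B) = emeasure (\<theta> u) B)"
  proof (rule plan_of_increasing_family[OF nD(2) P(2) \<theta>D(2) _ mono])
    show "emeasure (\<theta> u) A \<le> emeasure \<nu> A" if "A \<in> sets borel" for u A using sum[OF that, of u] by simp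
  qed (simp_all add: cdf \<mu>.cdf_is_right_cont \<mu>.cdf_lim_at_bot \<mu>.cdf_lim_at_top_prob)
  then obtain \<pi> where \<pi>: "sets \<pi> = sets borel" "prob_space \<pi>" "distr \<pi> borel snd = \<nu>"
    "\<And>u B. B \<in> sets borel \<Longrightarrow> emeasure \<pi> ({..u} \<times> B) = emeasure (\<theta> u) B" by blast
  interpret \<pi>: prob_space \<pi> by fact
  have sp: "space \<pi> = UNIV" using sets_eq_imp_space_eq[OF \<pi>(1)] by simp
  have fst\<pi>: "fst \<in> \<pi> \<rightarrow>\<^sub>M borel"
    unfolding measurable_cong_sets[OF \<pi>(1) refl] by (rule fst_snd_borel)
  have "cdf (distr \<pi> borel fst) = cdf \<mu>"
  proof
    fix u
    have "emeasure (distr \<pi> borel fst) {..u} = emeasure (\<theta> u) UNIV"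
      using marginal_emeasure(1)[OF \<pi>(1), of "{..u}"] \<pi>(4)[of UNIV u] by simp
    then show "cdf (distr \<pi> borel fst) u = cdf \<mu> u" using cdf[of u] by (simp add: cdf_def measure_def)
  qed
  then have fst: "distr \<pi> borel fst = \<mu>"
    by (intro cdf_unique \<pi>.real_distribution_distr[OF fst\<pi>] \<mu>.real_distribution_axioms)
  note pf = plan_facts[OF \<mu> m n \<pi>(1) fst \<pi>(3)]
  have \<theta>s: "section_marginal \<pi> {..u} = \<theta> u" for u
    by (rule measure_eqI) (simp_all add: \<theta>D(2) emeasure_section_marginal[OF \<pi>(1)] \<pi>(4))
  have secint: "(\<integral>p. indicator {..u} (fst p) * f (snd p) \<partial>\<pi>) = (\<integral>y. f y \<partial>\<theta> u)"
    if "f \<in> borel_measurable borel" for f :: "real \<Rightarrow> real" and u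
    using integral_section_marginal[OF \<pi>(1) \<pi>.finite_measure_axioms pf(3), of "{..u}" f] that \<theta>s by simp
  have resint: "(\<integral>p. indicator {..u} (fst p) * f (fst p) \<partial>\<pi>) = (\<integral>x. f x \<partial>restricted \<mu> {..u})"
    if f: "f \<in> borel_measurable borel" for f :: "real \<Rightarrow> real" and u
    using integral_restricted[OF m, of "{..u}" f] pf(4)[of "\<lambda>x. indicator {..u} x * f x"] f by simp
  \<comment> \<open>Equality of the means of the shadow and of the restricted \<open>\<mu>\<close>
    is the martingale property tested on half-lines.\<close>
  have mean: "(\<integral>p. indicator {..u} (fst p) * snd p \<partial>\<pi>) = (\<integral>p. indicator {..u} (fst p) * fst p \<partial>\<pi>)" for u
    using secint[of "\<lambda>y. y" u] resint[of "\<lambda>y. y" u] mn[of u] by simp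
  obtain K where K: "is_disintegration \<mu> \<pi> K" using disintegration_exists[OF \<pi>(1,2)] fst by auto
  then have K': "K \<in> borel \<rightarrow>\<^sub>M prob_algebra borel" "\<pi> = kernel_plan \<mu> K"
    using is_disintegration_iff_kernel_plan[OF mD(2) \<pi>(1)] by auto
  have "AE x in \<mu>. integrable (K x) (\<lambda>y. y) \<and> (\<integral>y. y \<partial>K x) = x"
    by (rule martingale_kernelI[OF \<mu> K'(1)]) (use pf(2,3) mean K'(2) in simp_all)
  then have mart: "\<pi> \<in> martingale_plans \<mu> \<nu>"
    using K \<pi> fst by (auto simp: martingale_plans_def transport_plans_def)
  \<comment> \<open>The contact set at level \<open>q\<close>. Rational levels suffice because
    left-monotonicity only asks for a level between \<open>x\<close> and \<open>x'\<close>.\<close>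
  define A where "A q = {t. potential (\<theta> (of_rat q)) t = potential (restricted \<mu> {..of_rat q}) t}" for q :: rat
  have A_closed: "closed (A q)" for q
    unfolding A_def by (intro closed_Collect_eq continuous_on_potential \<theta> finite_first_moment_restricted m) simp
  have "\<exists>T. countable T \<and> T \<subseteq> A q \<and> A q \<subseteq> closure T" for q
    by (rule separable[of "A q"]) blast
  then obtain D where "\<And>q. countable (D q) \<and> D q \<subseteq> A q \<and> A q \<subseteq> closure (D q)" by metis
  then have D: "\<And>q. countable (D q)" "\<And>q. D q \<subseteq> A q" "\<And>q. A q \<subseteq> closure (D q)" by auto
  \<comment> \<open>Each contact point costs one null set, so only countably many of them, dense in the contact set,
    can be used.\<close>
  define N1 where "N1 q = {real_of_rat q<..} \<times> (- A q)" for q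
  define N2 where "N2 q t = {..min (of_rat q) t} \<times> {t<..} \<union> {t<..of_rat q} \<times> {..<t}" for q :: rat and t :: real
  define N where "N = (\<Union>q. N1 q \<union> (\<Union>t\<in>D q. N2 q t))"
  have N1: "N1 q \<in> null_sets \<pi>" for q
  proof -
    define u :: real where "u = of_rat q"
    have Am: "- A q \<in> sets borel" using A_closed by (intro borel_comp borel_closed)
    \<comment> \<open>Off the contact set the remainder \<open>\<sigma> u\<close> is locally null,
      so mass starting up to \<open>u\<close> already exhausts \<open>\<nu>\<close> there.\<close>
    have "emeasure (\<sigma> u) (- A q) = 0"
    proof (rule locally_null_imp_null[OF finite_first_momentD(2)[OF \<sigma>] Am])
      fix t assume "t \<in> - A q"
      then show "\<exists>d>0. emeasure (\<sigma> u) {t - d<..<t + d} = 0" using loc[of u t] pot[of u t] by (auto simp: A_def u_def)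
    qed
    then have "emeasure \<nu> (- A q) = emeasure (\<theta> u) (- A q)" using sum[OF Am, of u] by simp
    moreover have "emeasure \<nu> (- A q) = emeasure \<pi> (UNIV \<times> (- A q))" using marginal_emeasure(2)[OF \<pi>(1) Am] \<pi>(3) by simp
    moreover have "emeasure \<pi> (UNIV \<times> (- A q)) = emeasure \<pi> ({..u} \<times> (- A q)) + emeasure \<pi> ({u<..} \<times> (- A q))"
      using Am \<pi>(1) by (subst plus_emeasure) (auto intro!: arg_cong2[where f = emeasure])
    ultimately have "emeasure (\<theta> u) (- A q) + emeasure \<pi> ({u<..} \<times> (- A q)) = emeasure (\<theta> u) (- A q)"
      using \<pi>(4)[OF Am, of u] by simp
    moreover have "emeasure (\<theta> u) (- A q) \<noteq> \<infinity>" using finite_measure.emeasure_finite[OF \<theta>D(1)] by simp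
    ultimately have "emeasure \<pi> ({u<..} \<times> (- A q)) = 0"
      by (metis add.right_neutral ennreal_add_left_cancel infinity_ennreal_def)
    then show ?thesis using Am \<pi>(1) by (simp add: null_sets_def N1_def u_def)
  qed
  have N2: "N2 q t \<in> null_sets \<pi>" if "t \<in> A q" for q t
  proof -
    have "emeasure \<pi> (N2 q t) = 0" unfolding N2_def
    proof (rule no_crossing_at_contact[OF \<pi>(1,2) pf(2,3) mean])
      show "(\<integral>p. indicator {..real_of_rat q} (fst p) * max 0 (t - snd p) \<partial>\<pi>)
        = (\<integral>p. indicator {..real_of_rat q} (fst p) * max 0 (t - fst p) \<partial>\<pi>)"
        using that secint[of "\<lambda>y. max 0 (t - y)" "of_rat q"] resint[of "\<lambda>y. max 0 (t - y)" "of_rat q"]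
        by (simp add: A_def potential_def)
    qed
    then show ?thesis using \<pi>(1) by (simp add: null_sets_def N2_def)
  qed
  have N: "N \<in> null_sets \<pi>" unfolding N_def
    using D(2) by (intro null_sets_UN null_sets.Un N1 null_sets_UN' D(1) N2) auto
  have "left_monotone \<pi>"
    unfolding left_monotone_def
  proof (intro bexI[of _ "- N"] conjI allI impI)
    have Nb: "N \<in> sets borel" using N \<pi>(1) by (auto simp: null_sets_def)
    then show "- N \<in> sets borel" by (rule borel_comp)
    show "emeasure \<pi> (- N) = 1"
      using \<open>- N \<in> sets borel\<close> \<pi>(1) AE_not_in[OF N] by (intro \<pi>.emeasure_eq_1_AE) auto
    fix x y1 y2 x' y'
    assume *: "(x, y1) \<in> - N \<and> (x, y2) \<in> - N \<and> (x', y') \<in> - N"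
    show "\<not> (x < x' \<and> y1 < y' \<and> y' < y2)"
    proof
      assume lt: "x < x' \<and> y1 < y' \<and> y' < y2"
      \<comment> \<open>Mass starting at \<open>x'\<close> lands on the contact set at level
        \<open>q\<close>, so some \<open>t\<close> in \<open>D q\<close> lies strictly between
        \<open>y1\<close> and \<open>y2\<close>. Starting at \<open>x\<close>, one of the two
        landing points is then across \<open>t\<close>: \<open>y2\<close> if
        \<open>x \<le> t\<close>, and \<open>y1\<close> otherwise.\<close>
      obtain q where q: "x < of_rat q" "of_rat q < x'" using of_rat_dense lt by blast
      have "(x', y') \<notin> N1 q" using * by (auto simp: N_def)
      then have "y' \<in> closure (D q)" using q D(3) by (auto simp: N1_def)
      moreover have "open {y1<..<y2}" "y' \<in> {y1<..<y2}" using lt by auto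
      ultimately obtain t where t: "t \<in> D q" "t \<in> {y1<..<y2}"
        using open_Int_closure_eq_empty[of "{y1<..<y2}" "D q"] by blast
      have "(x, y1) \<notin> N2 q t" "(x, y2) \<notin> N2 q t" using * t by (auto simp: N_def)
      then show False using t q by (cases "x \<le> t") (auto simp: N2_def)
    qed
  qed
  with mart show ?thesis by blast
qed

subsection \<open>Uniqueness\<close>

text \<open>Both potentials become integrals over the starting point, which reduces their comparison
  to a single \<open>K x\<close>. Here \<open>ennreal (t - y)\<close> is the positive part of
  \<open>t - y\<close>.\<close>

lemma
  assumes \<mu>: "borel_prob \<mu>" "finite_first_moment \<mu>" and \<nu>: "finite_first_moment \<nu>"
    and \<pi>: "\<pi> \<in> transport_plans \<mu> \<nu>" and K: "is_disintegration \<mu> \<pi> K" and S: "S \<in> sets borel"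
  shows potential_section_kernel: "ennreal (potential (section_marginal \<pi> S) t) =
      (\<integral>\<^sup>+x. indicator S x * (\<integral>\<^sup>+y. ennreal (t - y) \<partial>K x) \<partial>\<mu>)"
    and potential_restricted_nn: "ennreal (potential (restricted \<mu> S) t) =
      (\<integral>\<^sup>+x. indicator S x * ennreal (t - x) \<partial>\<mu>)"
proof -
  have \<pi>': "sets \<pi> = sets borel" "distr \<pi> borel fst = \<mu>" "distr \<pi> borel snd = \<nu>"
    using \<pi> by (auto simp: transport_plans_def)
  note pf = plan_facts[OF \<mu> \<nu> \<pi>']
  interpret \<pi>: prob_space \<pi> by (rule pf)
  note mD = finite_first_momentD[OF \<mu>(2)]
  have K': "K \<in> borel \<rightarrow>\<^sub>M prob_algebra borel" "\<pi> = kernel_plan \<mu> K"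
    using K is_disintegration_iff_kernel_plan[OF mD(2) \<pi>'(1)] by auto
  note S[measurable]
  have i: "integrable \<pi> (\<lambda>p. indicator S (fst p) * max 0 (t - snd p))"
  proof -
    have Am: "S \<times> UNIV \<in> sets \<pi>" using \<pi>'(1) by simp
    have "integrable \<pi> (\<lambda>p. max 0 (t - snd p))" using pf(3) by (auto intro!: integrable_max)
    from integrable_mult_indicator[OF Am this] show ?thesis by (simp add: indicator_def mem_Times_iff)
  qed
  have "ennreal (potential (section_marginal \<pi> S) t) = ennreal (\<integral>p. indicator S (fst p) * max 0 (t - snd p) \<partial>\<pi>)"
    unfolding potential_def
    by (subst integral_section_marginal[OF \<pi>'(1) \<pi>.finite_measure_axioms pf(3) S]) auto
  also have "\<dots> = (\<integral>\<^sup>+p. ennreal (indicator S (fst p) * max 0 (t - snd p)) \<partial>\<pi>)"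
    by (rule nn_integral_eq_integral[OF i, symmetric]) (auto split: split_indicator)
  also have "\<dots> = (\<integral>\<^sup>+p. indicator S (fst p) * ennreal (t - snd p) \<partial>\<pi>)"
    by (rule nn_integral_cong) (auto split: split_indicator simp: ennreal_max_0 ennreal_max_0')
  also have "\<dots> = (\<integral>\<^sup>+x. \<integral>\<^sup>+y. indicator S x * ennreal (t - y) \<partial>K x \<partial>\<mu>)"
    unfolding K'(2) by (subst nn_integral_kernel_plan[OF mD(2) K'(1)]) simp_all
  also have "\<dots> = (\<integral>\<^sup>+x. indicator S x * (\<integral>\<^sup>+y. ennreal (t - y) \<partial>K x) \<partial>\<mu>)"
  proof (rule nn_integral_cong)
    fix x
    have "(\<lambda>y. ennreal (t - y)) \<in> borel_measurable (K x)"
      using kernel_prob(2)[OF K'(1)] by (simp cong: measurable_cong_sets)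
    then show "(\<integral>\<^sup>+y. indicator S x * ennreal (t - y) \<partial>K x) = indicator S x * (\<integral>\<^sup>+y. ennreal (t - y) \<partial>K x)"
      by (rule nn_integral_cmult)
  qed
  finally show "ennreal (potential (section_marginal \<pi> S) t) =
      (\<integral>\<^sup>+x. indicator S x * (\<integral>\<^sup>+y. ennreal (t - y) \<partial>K x) \<partial>\<mu>)" .
  have i: "integrable \<mu> (\<lambda>x. indicator S x * max 0 (t - x))"
    using integrable_mult_indicator[of S \<mu> "\<lambda>x. max 0 (t - x)"] integrable_potential(1)[OF \<mu>(2)] mD(2) by simp
  have "ennreal (potential (restricted \<mu> S) t) = (\<integral>\<^sup>+x. ennreal (indicator S x * max 0 (t - x)) \<partial>\<mu>)"
    unfolding potential_restricted[OF \<mu>(2) S]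
    by (rule nn_integral_eq_integral[OF i, symmetric]) (auto split: split_indicator)
  also have "\<dots> = (\<integral>\<^sup>+x. indicator S x * ennreal (t - x) \<partial>\<mu>)"
    by (rule nn_integral_cong) (auto split: split_indicator simp: ennreal_max_0 ennreal_max_0')
  finally show "ennreal (potential (restricted \<mu> S) t) = (\<integral>\<^sup>+x. indicator S x * ennreal (t - x) \<partial>\<mu>)" .
qed

lemma nn_integral_potential_kernel:
  assumes "finite_first_moment m" shows "(\<integral>\<^sup>+y. ennreal (t - y) \<partial>m) = ennreal (potential m t)"
proof -
  have "(\<integral>\<^sup>+y. ennreal (t - y) \<partial>m) = (\<integral>\<^sup>+y. ennreal (max 0 (t - y)) \<partial>m)"
    by (rule nn_integral_cong) (simp add: ennreal_max_0 ennreal_max_0')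
  then show ?thesis unfolding potential_def
    using nn_integral_eq_integral[OF integrable_potential(1)[OF assms, of t]] by simp
qed

text \<open>Jensen's inequality for the function \<open>max 0 (t - y)\<close> of \<open>y\<close>,
  with equality when \<open>m\<close> lives on one side of \<open>t\<close>, where this function is
  affine.\<close>

lemma potential_ge_of_mean:
  assumes "prob_space m" "sets m = sets borel" "integrable m (\<lambda>y. y)" "(\<integral>y. y \<partial>m) = x"
  shows "finite_first_moment m" "max 0 (t - x) \<le> potential m t"
    "AE y in m. y \<le> t \<Longrightarrow> potential m t = max 0 (t - x)"
    "AE y in m. t \<le> y \<Longrightarrow> potential m t = max 0 (t - x)"
proof -
  interpret prob_space m by fact
  show f: "finite_first_moment m" using assms finite_measure_axioms by (simp add: finite_first_moment_def)
  have i: "(\<integral>y. t - y \<partial>m) = t - x" using assms(3,4) by (simp add: prob_space)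
  have "(\<integral>y. t - y \<partial>m) \<le> potential m t" unfolding potential_def
    by (rule integral_mono) (use assms(3) integrable_potential[OF f] in auto)
  then show ge: "max 0 (t - x) \<le> potential m t" using potential_nonneg[of m t] i by simp
  note borel_measurable_integrable[OF assms(3), measurable]
  have bm: "(\<lambda>y. max 0 (t - y)) \<in> borel_measurable m" "(\<lambda>y. t - y) \<in> borel_measurable m"
    by measurable
  show "potential m t = max 0 (t - x)" if "AE y in m. y \<le> t"
  proof -
    have "potential m t = (\<integral>y. t - y \<partial>m)" unfolding potential_def
      by (rule integral_cong_AE[OF bm]) (use that in eventually_elim, auto)
    then show ?thesis using ge i by simp
  qed
  show "potential m t = max 0 (t - x)" if "AE y in m. t \<le> y"
  proof -
    have "potential m t = (\<integral>y. 0 \<partial>m)" unfolding potential_def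
      by (rule integral_cong_AE[OF bm(1)]) (use that in \<open>simp, eventually_elim, auto\<close>)
    then show ?thesis using ge by simp
  qed
qed

text \<open>Jensen's inequality for almost every \<open>K x\<close>, integrated over
  \<open>S\<close>.\<close>

lemma martingale_potential_ge:
  assumes \<mu>: "borel_prob \<mu>" "finite_first_moment \<mu>" and \<nu>: "finite_first_moment \<nu>"
    and \<pi>: "\<pi> \<in> martingale_plans \<mu> \<nu>" and S: "S \<in> sets borel"
  shows "potential (restricted \<mu> S) t \<le> potential (section_marginal \<pi> S) t"
proof -
  obtain K where K: "is_disintegration \<mu> \<pi> K" "AE x in \<mu>. integrable (K x) (\<lambda>y. y) \<and> (\<integral>y. y \<partial>K x) = x"
    and \<pi>': "\<pi> \<in> transport_plans \<mu> \<nu>" using \<pi> by (auto simp: martingale_plans_def)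
  have K': "K \<in> borel \<rightarrow>\<^sub>M prob_algebra borel" using K(1) by (simp add: is_disintegration_def)
  have "ennreal (potential (restricted \<mu> S) t) \<le> ennreal (potential (section_marginal \<pi> S) t)"
    unfolding potential_section_kernel[OF \<mu> \<nu> \<pi>' K(1) S] potential_restricted_nn[OF \<mu> \<nu> \<pi>' K(1) S]
  proof (rule nn_integral_mono_AE, use K(2) in eventually_elim)
    fix x assume x: "integrable (K x) (\<lambda>y. y) \<and> (\<integral>y. y \<partial>K x) = x"
    note k = potential_ge_of_mean[OF kernel_prob(1,2)[OF K', of x], of x]
    have "ennreal (t - x) \<le> (\<integral>\<^sup>+y. ennreal (t - y) \<partial>K x)"
      using k(2)[of t] x by (simp add: nn_integral_potential_kernel k(1) ennreal_leI)
    then show "indicator S x * ennreal (t - x) \<le> indicator S x * (\<integral>\<^sup>+y. ennreal (t - y) \<partial>K x)"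
      by (rule mult_left_mono) simp
  qed
  then show ?thesis by (simp add: potential_nonneg)
qed

text \<open>A point of \<open>\<Gamma>\<close> that starts after \<open>u\<close> and lands at
  \<open>y'\<close> keeps almost every \<open>K x\<close> with \<open>x \<le> u\<close> on one side
  of \<open>y'\<close>, so \<open>y'\<close> lies outside the set \<open>W\<close> of strict
  inequality. This set is open, which provides the interval.\<close>

lemma left_monotone_future_null:
  assumes \<mu>: "borel_prob \<mu>" "finite_first_moment \<mu>" and \<nu>: "finite_first_moment \<nu>"
    and \<pi>: "\<pi> \<in> martingale_plans \<mu> \<nu>" and lm: "left_monotone \<pi>"
    and lt: "potential (restricted \<mu> {..u}) t < potential (section_marginal \<pi> {..u}) t"
  shows "\<exists>d>0. emeasure (section_marginal \<pi> {u<..}) {t - d<..<t + d} = 0"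
proof -
  obtain K where K: "is_disintegration \<mu> \<pi> K" "AE x in \<mu>. integrable (K x) (\<lambda>y. y) \<and> (\<integral>y. y \<partial>K x) = x"
    and \<pi>': "\<pi> \<in> transport_plans \<mu> \<nu>" using \<pi> by (auto simp: martingale_plans_def)
  have s: "sets \<pi> = sets borel" "distr \<pi> borel fst = \<mu>" "distr \<pi> borel snd = \<nu>"
    using \<pi>' by (auto simp: transport_plans_def)
  note pf = plan_facts[OF \<mu> \<nu> s]
  interpret \<pi>: prob_space \<pi> by (rule pf)
  note mD = finite_first_momentD[OF \<mu>(2)]
  have K': "K \<in> borel \<rightarrow>\<^sub>M prob_algebra borel" "\<pi> = kernel_plan \<mu> K"
    using K(1) is_disintegration_iff_kernel_plan[OF mD(2) s(1)] by auto
  have sp: "space \<pi> = UNIV" using sets_eq_imp_space_eq[OF s(1)] by simp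
  obtain \<Gamma> where \<Gamma>: "\<Gamma> \<in> sets borel" "emeasure \<pi> \<Gamma> = 1"
    "\<And>x y1 y2 x' y'. (x, y1) \<in> \<Gamma> \<Longrightarrow> (x, y2) \<in> \<Gamma> \<Longrightarrow> (x', y') \<in> \<Gamma> \<Longrightarrow> x < x' \<Longrightarrow> y1 < y' \<Longrightarrow> y' < y2 \<Longrightarrow> False"
    using lm unfolding left_monotone_def by metis
  have ae\<Gamma>: "AE p in \<pi>. p \<in> \<Gamma>" using \<Gamma>(2) by (intro \<pi>.AE_prob_1) (simp add: measure_def)
  have aeK: "AE x in \<mu>. AE y in K x. (x, y) \<in> \<Gamma>"
    by (rule AE_kernel_plan[OF mD(2) K'(1) \<Gamma>(1)]) (use ae\<Gamma> in \<open>simp only: K'(2)[symmetric]\<close>)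
  define W where "W = {t. potential (restricted \<mu> {..u}) t < potential (section_marginal \<pi> {..u}) t}"
  have "open W" unfolding W_def
    by (intro open_Collect_less continuous_on_potential finite_first_moment_restricted \<mu>
      finite_first_moment_section_marginal[OF s(1) \<pi>.finite_measure_axioms pf(3)]) simp_all
  \<comment> \<open>If no kernel \<open>K x\<close> with \<open>x \<le> u\<close> charged both sides of \<open>y'\<close>, the two potentials would agree at \<open>y'\<close>.\<close>
  have disj: "\<Gamma> \<inter> {u<..} \<times> W = {}"
  proof (rule ccontr)
    assume "\<Gamma> \<inter> {u<..} \<times> W \<noteq> {}"
    then obtain x' y' where xy: "(x', y') \<in> \<Gamma>" "u < x'" "y' \<in> W" by auto
    have "ennreal (potential (section_marginal \<pi> {..u}) y') = ennreal (potential (restricted \<mu> {..u}) y')"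
      unfolding potential_section_kernel[OF \<mu> \<nu> \<pi>' K(1) atMost_borel] potential_restricted_nn[OF \<mu> \<nu> \<pi>' K(1) atMost_borel]
    proof (rule nn_integral_cong_AE, use K(2) aeK in eventually_elim)
      fix x assume x: "integrable (K x) (\<lambda>y. y) \<and> (\<integral>y. y \<partial>K x) = x" and ae: "AE y in K x. (x, y) \<in> \<Gamma>"
      note k = potential_ge_of_mean[OF kernel_prob(1,2)[OF K'(1), of x], of x]
      show "indicator {..u} x * (\<integral>\<^sup>+y. ennreal (y' - y) \<partial>K x) = indicator {..u} x * ennreal (y' - x)"
      proof (cases "x \<le> u")
        case True
        then have "(\<forall>y. (x, y) \<in> \<Gamma> \<longrightarrow> y \<le> y') \<or> (\<forall>y. (x, y) \<in> \<Gamma> \<longrightarrow> y' \<le> y)"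
          using \<Gamma>(3)[OF _ _ xy(1), of x] xy(2) by (meson le_less_trans not_le)
        then have "potential (K x) y' = max 0 (y' - x)"
        proof
          assume *: "\<forall>y. (x, y) \<in> \<Gamma> \<longrightarrow> y \<le> y'"
          have "AE y in K x. y \<le> y'" using ae by eventually_elim (use * in blast)
          then show ?thesis using k(3)[of y'] x by simp
        next
          assume *: "\<forall>y. (x, y) \<in> \<Gamma> \<longrightarrow> y' \<le> y"
          have "AE y in K x. y' \<le> y" using ae by eventually_elim (use * in blast)
          then show ?thesis using k(4)[of y'] x by simp
        qed
        then show ?thesis using k(1) x
          by (simp add: nn_integral_potential_kernel ennreal_max_0 ennreal_max_0')
      qed simp
    qed
    then have "potential (section_marginal \<pi> {..u}) y' = potential (restricted \<mu> {..u}) y'"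
      by (simp add: potential_nonneg)
    with xy(3) show False by (simp add: W_def)
  qed
  obtain d where d: "d > 0" "\<And>y. dist y t < d \<Longrightarrow> y \<in> W"
    using \<open>open W\<close> lt unfolding open_dist by (auto simp: W_def)
  have sub: "{t - d<..<t + d} \<subseteq> W" using d(2) by (auto simp: dist_real_def)
  have "AE p in \<pi>. p \<notin> {u<..} \<times> {t - d<..<t + d}"
    using ae\<Gamma> by eventually_elim (use disj sub in blast)
  then have "emeasure \<pi> ({u<..} \<times> {t - d<..<t + d}) = 0"
    using s(1) sp by (subst (asm) AE_iff_measurable[of "{u<..} \<times> {t - d<..<t + d}"]) auto
  then show ?thesis using d(1)
    by (intro exI[of _ d]) (simp add: emeasure_section_marginal[OF s(1)])
qed

text \<open>Among all martingale plans a left-monotone one has the smallest potentials at each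
  level. Where the difference \<open>G\<close> is positive, the potential of \<open>\<pi>\<close>
  exceeds that of the restricted \<open>\<mu>\<close>, so \<open>Q \<pi>\<close> is locally affine;
  \<open>G = Q \<rho> - Q \<pi>\<close> is then locally convex and the maximum principle
  applies.\<close>

lemma left_monotone_potential_le:
  assumes \<mu>: "borel_prob \<mu>" and \<nu>: "borel_prob \<nu>" and ord: "\<mu> \<preceq>\<^sub>C \<nu>"
    and \<pi>: "\<pi> \<in> martingale_plans \<mu> \<nu>" "left_monotone \<pi>" and \<rho>: "\<rho> \<in> martingale_plans \<mu> \<nu>"
  shows "potential (section_marginal \<pi> {..u}) t \<le> potential (section_marginal \<rho> {..u}) t"
proof -
  note m = convex_order_potential(1)[OF ord] and n = convex_order_potential(2)[OF ord]
  define f where "f = potential \<nu>"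
  define P where "P \<tau> = potential (section_marginal \<tau> {..u})" for \<tau>
  define Q where "Q \<tau> = potential (section_marginal \<tau> {u<..})" for \<tau>
  have ffm: "finite_first_moment (section_marginal \<tau> S)" if "\<tau> \<in> martingale_plans \<mu> \<nu>" "S \<in> sets borel" for \<tau> S
  proof -
    have s: "sets \<tau> = sets borel" "distr \<tau> borel fst = \<mu>" "distr \<tau> borel snd = \<nu>"
      using that by (auto simp: martingale_plans_def transport_plans_def)
    note pf = plan_facts[OF \<mu> m n s]
    show ?thesis by (rule finite_first_moment_section_marginal[OF s(1) prob_space.finite_measure[OF pf(1)] pf(3) that(2)])
  qed
  have PQ: "P \<tau> t + Q \<tau> t = f t" if "\<tau> \<in> martingale_plans \<mu> \<nu>" for \<tau> t
  proof -
    have s: "sets \<tau> = sets borel" "distr \<tau> borel fst = \<mu>" "distr \<tau> borel snd = \<nu>"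
      using that by (auto simp: martingale_plans_def transport_plans_def)
    note pf = plan_facts[OF \<mu> m n s]
    note fin = prob_space.finite_measure[OF pf(1)]
    have i: "integrable \<tau> (\<lambda>p. indicator S (fst p) * max 0 (t - snd p))" if "S \<in> sets borel" for S
    proof -
      have Am: "S \<times> UNIV \<in> sets \<tau>" using s(1) that by simp
      have "integrable \<tau> (\<lambda>p. max 0 (t - snd p))"
        by (intro integrable_max Bochner_Integration.integrable_diff pf(3) integrable_zero
          finite_measure.integrable_const[OF fin])
      from integrable_mult_indicator[OF Am this] show ?thesis by (simp add: indicator_def mem_Times_iff)
    qed
    have e: "potential (section_marginal \<tau> S) t = (\<integral>p. indicator S (fst p) * max 0 (t - snd p) \<partial>\<tau>)"
      if "S \<in> sets borel" for S
      unfolding potential_def by (rule integral_section_marginal[OF s(1) fin pf(3) that]) simp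
    have "P \<tau> t + Q \<tau> t = (\<integral>p. indicator {..u} (fst p) * max 0 (t - snd p) + indicator {u<..} (fst p) * max 0 (t - snd p) \<partial>\<tau>)"
      unfolding P_def Q_def e[OF atMost_borel] e[OF greaterThan_borel]
      by (rule Bochner_Integration.integral_add[OF i i, symmetric]) auto
    also have "\<dots> = (\<integral>p. max 0 (t - snd p) \<partial>\<tau>)"
      by (rule Bochner_Integration.integral_cong) (auto split: split_indicator)
    also have "\<dots> = f t"
    proof -
      have "snd \<in> \<tau> \<rightarrow>\<^sub>M borel" unfolding measurable_cong_sets[OF s(1) refl] by (rule fst_snd_borel)
      then show ?thesis unfolding f_def potential_def s(3)[symmetric]
        by (subst integral_distr) auto
    qed
    finally show ?thesis .
  qed
  define G where "G t = P \<pi> t - P \<rho> t" for t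
  \<comment> \<open>Both \<open>P \<pi> t\<close> and \<open>P \<rho> t\<close> lie between the
    potential of \<open>\<mu>\<close> restricted to \<open>{..u}\<close> and \<open>f t\<close>
    minus that of \<open>\<mu>\<close> restricted to \<open>{u<..}\<close>, an interval of length
    \<open>f t - potential \<mu> t\<close>.\<close>
  have bound: "\<bar>G t\<bar> \<le> f t - potential \<mu> t" for t
  proof -
    have "{..u} \<union> {u<..} = UNIV" "{..u} \<inter> {u<..} = {}" by auto
    then have "potential \<mu> t = potential (restricted \<mu> {..u}) t + potential (restricted \<mu> {u<..}) t"
      using restricted_disjoint_union(1)[OF m, of "{..u}" "{u<..}" t] restricted_UNIV[OF m] by simp
    moreover have "potential (restricted \<mu> {..u}) t \<le> P \<tau> t" "potential (restricted \<mu> {u<..}) t \<le> Q \<tau> t"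
      if "\<tau> \<in> martingale_plans \<mu> \<nu>" for \<tau>
      unfolding P_def Q_def by (rule martingale_potential_ge[OF \<mu> m n that], simp)+
    note this[OF \<pi>(1)] this[OF \<rho>]
    ultimately show ?thesis using PQ[OF \<pi>(1), of t] PQ[OF \<rho>, of t] by (auto simp: G_def abs_le_iff)
  qed
  have one: "measure \<mu> UNIV = measure \<nu> UNIV"
    using \<mu> \<nu> finite_first_momentD(3)[OF m] finite_first_momentD(3)[OF n]
    by (auto simp: borel_prob_def dest!: prob_space.prob_space)
  have lim0: "((\<lambda>t. f t - potential \<mu> t) \<longlongrightarrow> 0) at_bot"
    using tendsto_diff[OF potential_at_bot[OF n] potential_at_bot[OF m]] by (simp add: f_def)
  have lim1: "((\<lambda>t. f t - potential \<mu> t) \<longlongrightarrow> 0) at_top"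
    using tendsto_diff[OF potential_at_top[OF n] potential_at_top[OF m]] one convex_order_potential(3)[OF ord]
    by (simp add: f_def)
  have "G t \<le> 0"
  proof (rule local_midpoint_nonpos[where G = G])
    show "continuous_on UNIV G" unfolding G_def P_def
      by (intro continuous_intros continuous_on_potential ffm \<pi> \<rho>) auto
    show "(G \<longlongrightarrow> 0) at_bot" by (rule Lim_null_comparison[OF _ lim0]) (use bound in auto)
    show "(G \<longlongrightarrow> 0) at_top" by (rule Lim_null_comparison[OF _ lim1]) (use bound in auto)
    fix t assume "G t > 0"
    then have "potential (restricted \<mu> {..u}) t < potential (section_marginal \<pi> {..u}) t"
      using martingale_potential_ge[OF \<mu> m n \<rho>, of "{..u}" t] by (simp add: G_def P_def)
    from left_monotone_future_null[OF \<mu> m n \<pi> this]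
    obtain d where d: "d > 0" "emeasure (section_marginal \<pi> {u<..}) {t - d<..<t + d} = 0" by blast
    show "\<exists>d>0. \<forall>s. 0 < s \<and> s < d \<longrightarrow> 2 * G t \<le> G (t - s) + G (t + s)"
    proof (intro exI[of _ d] conjI d(1) allI impI)
      fix s assume s: "0 < s \<and> s < d"
      have "emeasure (section_marginal \<pi> {u<..}) {t - s<..<t + s} \<le> emeasure (section_marginal \<pi> {u<..}) {t - d<..<t + d}"
        by (rule emeasure_mono) (use s in auto)
      then have "2 * Q \<pi> t = Q \<pi> (t - s) + Q \<pi> (t + s)"
        unfolding Q_def using potential_affine_iff_null[OF ffm[OF \<pi>(1)], of "{u<..}" s t] s d(2) by simp
      moreover have "2 * Q \<rho> t \<le> Q \<rho> (t - s) + Q \<rho> (t + s)"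
        unfolding Q_def by (rule convex_on_midpoint[OF convex_on_potential[OF ffm[OF \<rho>]]]) simp
      moreover have "G x = Q \<rho> x - Q \<pi> x" for x using PQ[OF \<pi>(1), of x] PQ[OF \<rho>, of x] by (simp add: G_def)
      ultimately show "2 * G t \<le> G (t - s) + G (t + s)" by simp
    qed
  qed
  then show ?thesis by (simp add: G_def P_def)
qed

text \<open>The additive version with the null measure as second summand.\<close>

lemma potential_unique:
  assumes "finite_first_moment m" "finite_first_moment m'" "potential m = potential m'" "A \<in> sets borel"
  shows "emeasure m A = emeasure m' A"
proof -
  have "finite_first_moment (null_measure borel)"
    by (auto simp: finite_first_moment_def intro!: finite_measureI)
  moreover have "potential (null_measure borel) t = 0" for t
    by (simp add: potential_def)
  ultimately show ?thesis
    using potential_add_unique[OF assms(1,2) _ _ assms(4), of "null_measure borel"] assms(3) by simp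
qed

theorem theorem1p5:
  fixes \<mu> \<nu> :: "real measure"
  assumes "borel_prob \<mu>" and "borel_prob \<nu>" and "\<mu> \<preceq>\<^sub>C \<nu>"
  shows "\<exists>!\<pi>. \<pi> \<in> martingale_plans \<mu> \<nu> \<and> left_monotone \<pi>"
proof -
  note m = convex_order_potential(1)[OF assms(3)] and n = convex_order_potential(2)[OF assms(3)]
  have "\<pi> = \<rho>" if \<pi>: "\<pi> \<in> martingale_plans \<mu> \<nu>" "left_monotone \<pi>"
    and \<rho>: "\<rho> \<in> martingale_plans \<mu> \<nu>" "left_monotone \<rho>" for \<pi> \<rho>
  proof -
    have s: "sets \<tau> = sets borel" "distr \<tau> borel fst = \<mu>" "distr \<tau> borel snd = \<nu>"
      if "\<tau> \<in> martingale_plans \<mu> \<nu>" for \<tau>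
      using that by (auto simp: martingale_plans_def transport_plans_def)
    have fin: "finite_measure \<tau>" "integrable \<tau> snd" if "\<tau> \<in> martingale_plans \<mu> \<nu>" for \<tau>
      using plan_facts[OF assms(1) m n s[OF that]] by (auto intro: prob_space.finite_measure)
    \<comment> \<open>Both plans are left-monotone, so minimality of the potentials applies in both
      directions. Equal potentials give equal masses of all quadrants.\<close>
    have eq: "potential (section_marginal \<pi> {..u}) = potential (section_marginal \<rho> {..u})" for u
      by (intro ext antisym left_monotone_potential_le[OF assms \<pi> \<rho>(1)]
        left_monotone_potential_le[OF assms \<rho> \<pi>(1)])
    show ?thesis
    proof (rule measure_eqI_Iic_prod[OF s(1)[OF \<pi>(1)] fin(1)[OF \<pi>(1)] s(1)[OF \<rho>(1)]])
      fix a b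
      have ffm: "finite_first_moment (section_marginal \<tau> {..a})" if "\<tau> \<in> martingale_plans \<mu> \<nu>" for \<tau>
        by (rule finite_first_moment_section_marginal[OF s(1)[OF that] fin[OF that]]) simp
      show "emeasure \<pi> ({..a} \<times> {..b}) = emeasure \<rho> ({..a} \<times> {..b})"
        using potential_unique[OF ffm[OF \<pi>(1)] ffm[OF \<rho>(1)] eq, of "{..b}"]
        by (simp add: emeasure_section_marginal[OF s(1)[OF \<pi>(1)]] emeasure_section_marginal[OF s(1)[OF \<rho>(1)]])
    qed
  qed
  with left_monotone_martingale_plan_exists[OF assms] show ?thesis by blast
qed

end
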